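(* Let $I$ be a homogeneous ideal in $h_{(\mathbf{0,1})}(\hat D)$ or in $h_{(\mathbf{0,1})}(\mathcal{D}_0)$. Then its closed Gröbner fan $\bar{\mathcal{E}}(I,\mathcal{W}_{\mathrm{loc}})$ is a rational polyhedral fan.
   Context: Fix $n\ge 1$, a field $\mathbf{k}$ and $x=(x_1,\dots,x_n)$. $\hat{O}=\mathbf{k}[[x]]$; when $\mathbf{k}=\mathbb{C}$, $\mathcal{O}_0\subset\hat O$ is the ring of convergent power series. $\hat D$ and $\mathcal{D}_0$ are the rings of differential operators with coefficients in $\hat O$ and $\mathcal{O}_0$ (generated by the coefficients and $\partial_1,\dots,\partial_n$ with $\partial_ic(x)-c(x)\partial_i=\partial c(x)/\partial x_i$). $h_{(\mathbf{0,1})}(\hat D)$ (resp. $h_{(\mathbf{0,1})}(\mathcal{D}_0)$) is the $\mathbf{k}$-algebra generated by $\hat O$ (resp. $\mathcal{O}_0$), $\partial_1,\dots,\partial_n$ and a new variable $h$, with $\partial_i c(x)-c(x)\partial_i=\frac{\partial c(x)}{\partial x_i}h$ as the only nontrivial commutation relations. Each element is uniquely written $P=\sum c_{\alpha,\beta,k}x^\alpha\partial^\beta h^k$; $\mathrm{Supp}(P)\subset\mathbb{N}^{2n+1}$ is the set of $(\alpha,\beta,k)$ with $c_{\alpha,\beta,k}\ne0$; $\deg P=\max(|\beta|+k)$ over $\mathrm{Supp}(P)$; $P$ is homogeneous if $|\beta|+k$ is constant on $\mathrm{Supp}(P)$. Ideals are left ideals; an ideal is homogeneous if it is generated by homogeneous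 elements. $\mathcal{W}_{\mathrm{loc}}=\{w=(u,v)\in\mathbb{R}^{2n}:u_i\le0,\ u_i+v_i\ge0\ \forall i\}$. For $A$ one of the two rings and $w=(u,v)\in\mathcal{W}_{\mathrm{loc}}$, $\mathrm{ord}^w(P)=\max\{u\cdot\alpha+v\cdot\beta:(\alpha,\beta,k)\in\mathrm{Supp}(P)\}$ ($h$ has weight $0$), $F^w_m=\{P\in A:\mathrm{ord}^w(P)\le m\}$, $\mathrm{gr}^w(A)=\bigoplus_m F^w_m/F^w_{<m}$, $\mathrm{in}_w(P)$ is the class of $P$ in $F^w_m/F^w_{<m}$ with $m=\mathrm{ord}^w(P)$, $\mathrm{in}_w(0)=0$, and $\mathrm{in}_w(I)$ is the ideal of $\mathrm{gr}^w(A)$ generated by all $\mathrm{in}_w(P)$, $P\in I$. Put $M(w)=\{i:u_i<0\}$, $P(w)=\{i:u_i+v_i>0\}$. Then $\mathrm{gr}^w(A)$ is identified with the ring of polynomials in $h$, in $\partial_i$ ($i\notin P(w)$) and in commutative variables $\xi_i$ ($i\in P(w)$, $\xi_i$ being the class of $\partial_i$), with coefficients in $\mathbf{k}[[x_i:i\notin M(w)]][x_i:i\in M(w)]$ (resp. $\mathbb{C}\{x_i:i\notin M(w)\}[x_i:i\in M(w)]$), with $[\partial_i,a(x)]=\frac{\partial a}{\partial x_i}h$. $S(w)=\{w'\in\mathcal{W}_{\mathrm{loc}}:\mathrm{gr}^{w'}(A)=\mathrm{gr}^w(A)\}$, i.e. those $w'$ with $M(w')=M(w)$ and $P(w')=P(w)$.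 Define $w\sim w'$ iff $w'\in S(w)$ and $\mathrm{in}_w(I)=\mathrm{in}_{w'}(I)$; the class of $w$ is the Gröbner cone $C_I[w]$. The closed Gröbner fan $\bar{\mathcal{E}}(I,\mathcal{W}_{\mathrm{loc}})$ is the set of closures in $\mathbb{R}^{2n}$ of the cones $C_I[w]$, $w\in\mathcal{W}_{\mathrm{loc}}$. A polyhedral fan is a finite collection of closed polyhedral cones such that (1) every face of a cone in the collection is again in the collection, and (2) the intersection of any two cones of the collection is a face of both. It is rational if every cone is generated by finitely many rational vectors. *)

theory Defs
  imports "HOL-Analysis.Analysis" "HOL-Algebra.AbelCoset"
begin

section \<open>Differential operators, homogenised\<close>

text \<open>
  The \<open>n\<close> variables are indexed by the finite type \<open>'n\<close>, which is nonempty, so \<open>n \<ge> 1\<close>.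
  The triple \<open>(\<alpha>, \<beta>, k)\<close> stands for \<open>x^\<alpha> \<partial>^\<beta> h^k\<close>, and an operator is given by the coefficients
  of its normal form \<open>\<Sum> c(\<alpha>, \<beta>, k) x^\<alpha> \<partial>^\<beta> h^k\<close>.
\<close>

type_synonym 'n mon = "(nat^'n) \<times> (nat^'n) \<times> nat"
type_synonym ('k, 'n) hdo = "'n mon \<Rightarrow> 'k"

definition Supp :: "('k::zero, 'n::finite) hdo \<Rightarrow> 'n mon set" where
  "Supp P = {t. P t \<noteq> 0}"

definition msize :: "nat^'n::finite \<Rightarrow> nat" where
  "msize \<gamma> = (\<Sum>i\<in>UNIV. \<gamma> $ i)"

text \<open>
  By the Leibniz rule,
  \<open>x^\<alpha> \<partial>^\<beta> h^k * x^\<alpha>' \<partial>^\<beta>' h^k' =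
     (\<Sum>\<gamma>. \<gamma>! (\<beta> choose \<gamma>) (\<alpha>' choose \<gamma>) x^(\<alpha>+\<alpha>'-\<gamma>) \<partial>^(\<beta>+\<beta>'-\<gamma>) h^(k+k'+|\<gamma>|))\<close>,
  factorials and binomials being products over the variables. Restricting the sum to those \<open>\<gamma>\<close>
  that are supported in a set \<open>J\<close> of variables gives the product for which
  \<open>\<partial>_i c - c \<partial>_i = (\<partial>c/\<partial>x_i) h\<close> if \<open>i \<in> J\<close>, while \<open>\<partial>_i\<close> is central if \<open>i \<notin> J\<close>; see
  \<open>hdo_commute_d_series\<close> and \<open>hdo_mult_assoc\<close>. The sum is finite for each target monomial
  (\<open>finite_contrib\<close>).
\<close>

definition leibniz_coeff :: "nat^'n::finite \<Rightarrow> nat^'n \<Rightarrow> nat^'n \<Rightarrow> nat" where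
  "leibniz_coeff \<beta> \<alpha> \<gamma> = (\<Prod>i\<in>UNIV. fact (\<gamma> $ i) * (\<beta> $ i choose \<gamma> $ i) * (\<alpha> $ i choose \<gamma> $ i))"

definition contrib :: "'n::finite set \<Rightarrow> 'n mon \<Rightarrow> ((nat^'n) \<times> 'n mon \<times> 'n mon) set" where
  "contrib J = (\<lambda>(a, b, c). {(\<gamma>, (\<alpha>, \<beta>, k), (\<alpha>', \<beta>', k')).
     (\<forall>i. i \<notin> J \<longrightarrow> \<gamma> $ i = 0) \<and> \<gamma> \<le> \<beta> \<and> \<gamma> \<le> \<alpha>' \<and>
     \<alpha> + \<alpha>' = a + \<gamma> \<and> \<beta> + \<beta>' = b + \<gamma> \<and> k + k' + msize \<gamma> = c})"

definition hdo_mult :: "'n::finite set \<Rightarrow> ('k::field, 'n) hdo \<Rightarrow> ('k, 'n) hdo \<Rightarrow> ('k, 'n) hdo" where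
  "hdo_mult J P Q = (\<lambda>s. \<Sum>(\<gamma>, (\<alpha>, \<beta>, k), (\<alpha>', \<beta>', k'))\<in>contrib J s.
     of_nat (leibniz_coeff \<beta> \<alpha>' \<gamma>) * P (\<alpha>, \<beta>, k) * Q (\<alpha>', \<beta>', k'))"

definition hdo_monom :: "'n::finite mon \<Rightarrow> ('k::field, 'n) hdo" where
  "hdo_monom t = (\<lambda>s. if s = t then 1 else 0)"

definition hdo_ring :: "'n::finite set \<Rightarrow> ('k::field, 'n) hdo set \<Rightarrow> ('k, 'n) hdo ring" where
  "hdo_ring J C = \<lparr>carrier = C, mult = hdo_mult J, one = hdo_monom (0, 0, 0),
     zero = (\<lambda>_. 0), add = (\<lambda>P Q t. P t + Q t)\<rparr>"

text \<open>Polynomials in \<open>\<partial>\<close> and \<open>h\<close>, with arbitrary formal power series in \<open>x\<close> as coefficients.\<close>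

definition formal_ops :: "('k::field, 'n::finite) hdo set" where
  "formal_ops = {P. finite (snd ` Supp P)}"

definition convergent_series :: "(nat^'n::finite \<Rightarrow> complex) \<Rightarrow> bool" where
  "convergent_series c \<longleftrightarrow> (\<exists>r>0. \<forall>z :: complex^'n. (\<forall>i. norm (z $ i) < r) \<longrightarrow>
     (\<lambda>\<alpha>. c \<alpha> * (\<Prod>i\<in>UNIV. (z $ i) ^ (\<alpha> $ i))) summable_on UNIV)"

definition convergent_ops :: "(complex, 'n::finite) hdo set" where
  "convergent_ops = {P \<in> formal_ops. \<forall>\<beta> k. convergent_series (\<lambda>\<alpha>. P (\<alpha>, \<beta>, k))}"

definition hD_formal :: "('k::field, 'n::finite) hdo ring" where
  "hD_formal = hdo_ring UNIV formal_ops"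

definition hD_conv :: "(complex, 'n::finite) hdo ring" where
  "hD_conv = hdo_ring UNIV convergent_ops"

subsection \<open>Ring structure and commutation relations\<close>

lemma leibniz_coeff_eq_0: "\<not> (\<gamma> \<le> \<beta> \<and> \<gamma> \<le> \<alpha>) \<Longrightarrow> leibniz_coeff \<beta> \<alpha> \<gamma> = 0"
  unfolding leibniz_coeff_def less_eq_vec_def
  by (subst prod_zero_iff) (auto simp: not_le binomial_eq_0)

lemma leibniz_coeff_nz: "(of_nat (leibniz_coeff \<beta> \<alpha> \<gamma>) :: 'k::field) \<noteq> 0 \<Longrightarrow> \<gamma> \<le> \<beta> \<and> \<gamma> \<le> \<alpha>"
  using leibniz_coeff_eq_0[of \<gamma> \<beta> \<alpha>] by (cases "\<gamma> \<le> \<beta> \<and> \<gamma> \<le> \<alpha>") auto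

lemma leibniz_coeff_0 [simp]: "leibniz_coeff \<beta> \<alpha> 0 = 1"
  by (simp add: leibniz_coeff_def)

lemma finite_vec_le: "finite {v :: nat^'n::finite. \<forall>i. v $ i \<le> f i}"
proof -
  have "{v :: nat^'n. \<forall>i. v $ i \<le> f i} \<subseteq> vec_lambda ` (PiE UNIV (\<lambda>i. {..f i}))"
    by (auto intro!: image_eqI[where x="vec_nth _"] simp: PiE_def)
  then show ?thesis by (rule finite_subset) (simp add: finite_PiE)
qed

lemma msize_ge: "\<gamma> $ i \<le> msize \<gamma>"
  unfolding msize_def by (rule member_le_sum) auto

lemma msize_add: "msize (\<gamma> + \<delta>) = msize \<gamma> + msize \<delta>"
  by (simp add: msize_def sum.distrib)

lemma finite_mon_le: "finite {(\<alpha>::nat^'n::finite, \<beta>::nat^'n, k::nat). (\<forall>i. \<alpha> $ i \<le> f i) \<and> (\<forall>i. \<beta> $ i \<le> g i) \<and> k \<le> c}"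
proof (rule finite_subset)
  show "finite ({v :: nat^'n::finite. \<forall>i. v $ i \<le> f i} \<times> {v :: nat^'n. \<forall>i. v $ i \<le> g i} \<times> {..c})"
    by (intro finite_cartesian_product finite_vec_le) auto
qed auto

lemma vec_add_le1: "\<alpha> + \<alpha>' = a + \<gamma> \<Longrightarrow> \<alpha> $ i \<le> a $ i + \<gamma> $ i" for \<alpha> :: "nat^'n::finite"
  by (metis le_add1 vector_add_component)
lemma vec_add_le2: "\<alpha> + \<alpha>' = a + \<gamma> \<Longrightarrow> \<alpha>' $ i \<le> a $ i + \<gamma> $ i" for \<alpha> :: "nat^'n::finite"
  by (metis le_add2 vector_add_component)

lemma finite_contrib: "finite (contrib (J :: 'n::finite set) s)"
proof -
  obtain a b c where s: "s = (a, b, c)" by (cases s)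
  define B :: "'n mon set" where "B = {(\<alpha>, \<beta>, k). (\<forall>i. \<alpha> $ i \<le> a $ i + c) \<and> (\<forall>i. \<beta> $ i \<le> b $ i + c) \<and> k \<le> c}"
  have "contrib J s \<subseteq> {\<gamma>. \<forall>i. \<gamma> $ i \<le> c} \<times> B \<times> B"
  proof
    fix z assume "z \<in> contrib J s"
    then obtain \<gamma> \<alpha> \<beta> k \<alpha>' \<beta>' k' where z: "z = (\<gamma>, (\<alpha>, \<beta>, k), (\<alpha>', \<beta>', k'))"
      and e: "\<alpha> + \<alpha>' = a + \<gamma>" "\<beta> + \<beta>' = b + \<gamma>" "k + k' + msize \<gamma> = c"
      by (auto simp: contrib_def s)
    have g: "\<gamma> $ i \<le> c" for i using e(3) msize_ge[of \<gamma> i] by linarith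
    have "\<alpha> $ i \<le> a $ i + c" "\<alpha>' $ i \<le> a $ i + c" "\<beta> $ i \<le> b $ i + c" "\<beta>' $ i \<le> b $ i + c" for i
      using vec_add_le1[OF e(1), of i] vec_add_le2[OF e(1), of i] vec_add_le1[OF e(2), of i] vec_add_le2[OF e(2), of i] g[of i]
      by linarith+
    then show "z \<in> {\<gamma>. \<forall>i. \<gamma> $ i \<le> c} \<times> B \<times> B" using e(3) g by (auto simp: z B_def)
  qed
  then show ?thesis
    by (rule finite_subset) (unfold B_def, intro finite_cartesian_product finite_mon_le finite_vec_le)
qed

definition leibniz1 :: "nat \<Rightarrow> nat \<Rightarrow> nat \<Rightarrow> nat" where "leibniz1 b a g = fact g * (b choose g) * (a choose g)"

definition ffall :: "nat \<Rightarrow> nat \<Rightarrow> nat" where "ffall a g = fact g * (a choose g)"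

lemma ffall_add: "ffall a (j + l) = ffall a l * ffall (a - l) j"
proof (cases "j + l \<le> a")
  case True
  have 1: "ffall a m * fact (a - m) = fact a" if "m \<le> a" for m
    using binomial_fact_lemma[OF that] by (simp add: ffall_def mult_ac)
  have "ffall a (j + l) * fact (a - (j + l)) = (ffall a l * ffall (a - l) j) * fact (a - (j + l))"
  proof -
    have "ffall (a - l) j * fact (a - (j + l)) = fact (a - l)"
      using binomial_fact_lemma[of j "a - l"] True by (simp add: ffall_def mult_ac diff_diff_left add.commute)
    then have "ffall a l * ffall (a - l) j * fact (a - (j + l)) = fact a"
      using 1[of l] True by (simp add: mult.assoc)
    then show ?thesis using 1[of "j+l"] True by simp
  qed
  then show ?thesis by simp
next
  case False
  then show ?thesis by (auto simp: ffall_def binomial_eq_0)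
qed

lemma ffall_vandermonde: "ffall (m + n) r = (\<Sum>g\<le>r. (r choose g) * ffall m g * ffall n (r - g))"
proof -
  have "ffall (m + n) r = (\<Sum>g\<le>r. fact r * ((m choose g) * (n choose (r - g))))"
    by (simp add: ffall_def vandermonde[symmetric] sum_distrib_left)
  also have "\<dots> = (\<Sum>g\<le>r. (r choose g) * ffall m g * ffall n (r - g))"
  proof (rule sum.cong[OF refl])
    fix g assume "g \<in> {..r}"
    then have "fact g * fact (r - g) * (r choose g) = fact r"
      using binomial_fact_lemma[of g r] by (simp add: mult_ac)
    then show "fact r * ((m choose g) * (n choose (r - g))) = (r choose g) * ffall m g * ffall n (r - g)"
      unfolding ffall_def by (metis (no_types, lifting) mult.assoc mult.commute mult.left_commute)
  qed
  finally show ?thesis .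
qed

lemma leibniz1_ffall: "leibniz1 b a g = (b choose g) * ffall a g"
  by (simp add: leibniz1_def ffall_def mult_ac)

lemma ffall_0: "g > a \<Longrightarrow> ffall a g = 0" by (simp add: ffall_def binomial_eq_0)

lemma leibniz1_assoc:
  "(\<Sum>g\<le>e. leibniz1 b a' g * leibniz1 (b + b' - g) a'' (e - g)) =
   (\<Sum>g\<le>e. leibniz1 b (a' + a'' - (e - g)) g * leibniz1 b' a'' (e - g))"
proof -
  have L: "leibniz1 b a' g * leibniz1 (b + b' - g) a'' (e - g) =
     (\<Sum>j\<le>e-g. (b choose g) * ffall a' g * ((b - g) choose j) * (b' choose (e - g - j)) * ffall a'' (e - g))" for g
  proof (cases "g \<le> b")
    case True
    then have "b + b' - g = (b - g) + b'" by simp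
    then show ?thesis
      by (simp add: leibniz1_ffall vandermonde[symmetric] sum_distrib_left sum_distrib_right mult_ac)
  next
    case False then show ?thesis by (simp add: leibniz1_ffall binomial_eq_0)
  qed
  have R: "leibniz1 b (a' + a'' - (e - g)) g * leibniz1 b' a'' (e - g) =
     (\<Sum>j\<le>g. (b choose g) * (b' choose (e - g)) * ffall a'' (e - g) * (g choose j) * ffall a' j * ffall (a'' - (e - g)) (g - j))" for g
  proof (cases "e - g \<le> a''")
    case True
    then have "a' + a'' - (e - g) = a' + (a'' - (e - g))" by simp
    then show ?thesis
      by (simp add: leibniz1_ffall ffall_vandermonde sum_distrib_left sum_distrib_right mult_ac)
  next
    case False then show ?thesis by (simp add: leibniz1_ffall ffall_0)
  qed
  have "(\<Sum>g\<le>e. leibniz1 b a' g * leibniz1 (b + b' - g) a'' (e - g)) =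
    (\<Sum>(g,j)\<in>Sigma {..e} (\<lambda>g. {..e-g}). (b choose g) * ffall a' g * ((b - g) choose j) * (b' choose (e - g - j)) * ffall a'' (e - g))"
    by (simp add: L sum.Sigma)
  also have "\<dots> = (\<Sum>(g,j)\<in>Sigma {..e} (\<lambda>g. {..g}). (b choose g) * (b' choose (e - g)) * ffall a'' (e - g) * (g choose j) * ffall a' j * ffall (a'' - (e - g)) (g - j))"
  proof (rule sum.reindex_bij_witness[where i="\<lambda>(g,j). (j, g - j)" and j="\<lambda>(g,j). (g + j, g)"], goal_cases)
    case (5 x)
    obtain g j where x: "x = (g, j)" by (cases x)
    with 5 have le: "g \<le> e" "j \<le> e - g" by auto
    have 1: "(b choose (g + j)) * ((g + j) choose g) = (b choose g) * ((b - g) choose j)"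
      using choose_mult[of g "g + j" b]
      by (cases "g + j \<le> b") (auto simp: binomial_eq_0)
    have 2: "ffall a'' (e - g) = ffall a'' (e - (g + j)) * ffall (a'' - (e - (g + j))) j"
      using ffall_add[of a'' j "e - (g + j)"] le by simp
    have "(b choose (g + j)) * (b' choose (e - (g + j))) * ffall a'' (e - (g + j)) * (g + j choose g) * ffall a' g * ffall (a'' - (e - (g + j))) (g + j - g)
       = ((b choose (g + j)) * ((g + j) choose g)) * (b' choose (e - (g + j))) * ffall a' g * (ffall a'' (e - (g + j)) * ffall (a'' - (e - (g + j))) j)"
      by (simp add: mult_ac)
    also have "\<dots> = (b choose g) * ffall a' g * ((b - g) choose j) * (b' choose (e - g - j)) * ffall a'' (e - g)"
      unfolding 1 2[symmetric] by (simp add: mult_ac)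
    finally show ?case by (simp add: x)
  qed auto
  also have "\<dots> = (\<Sum>g\<le>e. leibniz1 b (a' + a'' - (e - g)) g * leibniz1 b' a'' (e - g))"
    unfolding R by (subst sum.Sigma) simp_all
  finally show ?thesis .
qed


definition mi_splits :: "nat^'n::finite \<Rightarrow> ((nat^'n) \<times> (nat^'n)) set" where
  "mi_splits \<epsilon> = {(\<gamma>, \<delta>). \<gamma> + \<delta> = \<epsilon>}"

lemma finite_mi_splits: "finite (mi_splits \<epsilon>)"
proof -
  have "mi_splits \<epsilon> \<subseteq> {v. \<forall>i. v $ i \<le> \<epsilon> $ i} \<times> {v. \<forall>i. v $ i \<le> \<epsilon> $ i}"
    by (auto simp: mi_splits_def)
  then show ?thesis by (rule finite_subset) (intro finite_cartesian_product finite_vec_le)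
qed

lemma sum_mi_splits:
  fixes f :: "'n::finite \<Rightarrow> nat \<Rightarrow> nat \<Rightarrow> nat"
  shows "(\<Sum>(\<gamma>, \<delta>)\<in>mi_splits \<epsilon>. \<Prod>i\<in>UNIV. f i (\<gamma> $ i) (\<delta> $ i)) = (\<Prod>i\<in>UNIV. \<Sum>g\<le>\<epsilon> $ i. f i g (\<epsilon> $ i - g))"
proof -
  have "(\<Prod>i\<in>UNIV. \<Sum>g\<le>\<epsilon> $ i. f i g (\<epsilon> $ i - g)) =
    (\<Sum>h\<in>PiE UNIV (\<lambda>i. {..\<epsilon> $ i}). \<Prod>i\<in>UNIV. f i (h i) (\<epsilon> $ i - h i))"
    by (rule prod_sum_PiE) auto
  also have "\<dots> = (\<Sum>(\<gamma>, \<delta>)\<in>mi_splits \<epsilon>. \<Prod>i\<in>UNIV. f i (\<gamma> $ i) (\<delta> $ i))"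
    by (rule sum.reindex_bij_witness[where i="\<lambda>(\<gamma>, \<delta>). vec_nth \<gamma>" and j="\<lambda>h. (vec_lambda h, \<chi> i. \<epsilon> $ i - h i)"])
       (auto simp: mi_splits_def PiE_def vec_eq_iff Pi_def, metis diff_add_inverse, metis le_add1)
  finally show ?thesis ..
qed

lemma leibniz_coeff_leibniz1: "leibniz_coeff \<beta> \<alpha> \<gamma> = (\<Prod>i\<in>UNIV. leibniz1 (\<beta> $ i) (\<alpha> $ i) (\<gamma> $ i))"
  by (simp add: leibniz_coeff_def leibniz1_def)

lemma leibniz_coeff_assoc:
  fixes \<beta> :: "nat^'n::finite"
  shows "(\<Sum>(\<gamma>, \<delta>)\<in>mi_splits \<epsilon>. leibniz_coeff \<beta> \<alpha>' \<gamma> * leibniz_coeff (\<beta> + \<beta>' - \<gamma>) \<alpha>'' \<delta>) =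
    (\<Sum>(\<gamma>, \<delta>)\<in>mi_splits \<epsilon>. leibniz_coeff \<beta> (\<alpha>' + \<alpha>'' - \<delta>) \<gamma> * leibniz_coeff \<beta>' \<alpha>'' \<delta>)"
  unfolding leibniz_coeff_leibniz1 prod.distrib[symmetric]
  using sum_mi_splits[where f="\<lambda>i g d. leibniz1 (\<beta> $ i) (\<alpha>' $ i) g * leibniz1 (\<beta> $ i + \<beta>' $ i - g) (\<alpha>'' $ i) d" and \<epsilon>=\<epsilon>]
    sum_mi_splits[where f="\<lambda>i g d. leibniz1 (\<beta> $ i) (\<alpha>' $ i + \<alpha>'' $ i - d) g * leibniz1 (\<beta>' $ i) (\<alpha>'' $ i) d" and \<epsilon>=\<epsilon>]
  by (simp add: leibniz1_assoc)

definition mi_triples :: "'n::finite set \<Rightarrow> 'n mon \<Rightarrow> (('n mon \<times> 'n mon \<times> 'n mon) \<times> (nat^'n)) set" where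
  "mi_triples J = (\<lambda>(a, b, c). {(((\<alpha>, \<beta>, k), (\<alpha>', \<beta>', k'), (\<alpha>'', \<beta>'', k'')), \<epsilon>).
     (\<forall>i. i \<notin> J \<longrightarrow> \<epsilon> $ i = 0) \<and>
     \<alpha> + \<alpha>' + \<alpha>'' = a + \<epsilon> \<and> \<beta> + \<beta>' + \<beta>'' = b + \<epsilon> \<and> k + k' + k'' + msize \<epsilon> = c})"

lemma vec_add3_le:
  "x + y + z = a + e \<Longrightarrow> x $ i \<le> a $ i + e $ i \<and> y $ i \<le> a $ i + e $ i \<and> z $ i \<le> a $ i + e $ i" for x :: "nat^'n::finite"
  unfolding vec_eq_iff by (auto dest!: spec[where x=i])

lemma finite_mi_triples: "finite (mi_triples (J :: 'n::finite set) s)"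
proof -
  obtain a b c where s: "s = (a, b, c)" by (cases s)
  define B :: "'n mon set" where "B = {(\<alpha>, \<beta>, k). (\<forall>i. \<alpha> $ i \<le> a $ i + c) \<and> (\<forall>i. \<beta> $ i \<le> b $ i + c) \<and> k \<le> c}"
  have "mi_triples J s \<subseteq> (B \<times> B \<times> B) \<times> {\<gamma>. \<forall>i. \<gamma> $ i \<le> c}"
  proof
    fix z assume "z \<in> mi_triples J s"
    then obtain \<gamma> \<alpha> \<beta> k \<alpha>' \<beta>' k' \<alpha>'' \<beta>'' k'' where z: "z = (((\<alpha>, \<beta>, k), (\<alpha>', \<beta>', k'), (\<alpha>'', \<beta>'', k'')), \<gamma>)"
      and e: "\<alpha> + \<alpha>' + \<alpha>'' = a + \<gamma>" "\<beta> + \<beta>' + \<beta>'' = b + \<gamma>" "k + k' + k'' + msize \<gamma> = c"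
      by (auto simp: mi_triples_def s)
    have g: "\<gamma> $ i \<le> c" for i using e(3) msize_ge[of \<gamma> i] by linarith
    have "\<alpha> $ i \<le> a $ i + c" "\<alpha>' $ i \<le> a $ i + c" "\<beta> $ i \<le> b $ i + c" "\<beta>' $ i \<le> b $ i + c"
      "\<alpha>'' $ i \<le> a $ i + c" "\<beta>'' $ i \<le> b $ i + c" for i
      using vec_add3_le[OF e(1), of i] vec_add3_le[OF e(2), of i] g[of i]
      by linarith+
    then show "z \<in> (B \<times> B \<times> B) \<times> {\<gamma>. \<forall>i. \<gamma> $ i \<le> c}" using e(3) g by (auto simp: z B_def)
  qed
  then show ?thesis
    by (rule finite_subset) (unfold B_def, intro finite_cartesian_product finite_mon_le finite_vec_le)
qed

lemma hdo_mult_alt: "hdo_mult J P Q s = (\<Sum>z\<in>contrib J s. case z of (\<gamma>, t, t') \<Rightarrow>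
     of_nat (leibniz_coeff (fst (snd t)) (fst t') \<gamma>) * P t * Q t')"
  unfolding hdo_mult_def by (rule sum.cong) auto

lemma vec_diff_add_cancel: "\<gamma> \<le> \<beta> \<Longrightarrow> \<beta> + \<beta>' - \<gamma> + \<gamma> = \<beta> + \<beta>'" for \<beta> :: "nat^'n::finite"
  unfolding less_eq_vec_def vec_eq_iff by (simp add: trans_le_add1)
lemma vec_diff_add_cancel2: "\<gamma> \<le> \<beta>' \<Longrightarrow> \<beta> + \<beta>' - \<gamma> + \<gamma> = \<beta> + \<beta>'" for \<beta> :: "nat^'n::finite"
  unfolding less_eq_vec_def vec_eq_iff by (simp add: trans_le_add2)

definition mi_quints :: "'n::finite set \<Rightarrow> 'n mon \<Rightarrow> ((('n mon \<times> 'n mon \<times> 'n mon) \<times> (nat^'n)) \<times> (nat^'n) \<times> (nat^'n)) set" where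
  "mi_quints J s = Sigma (mi_triples J s) (\<lambda>(T, \<epsilon>). mi_splits \<epsilon>)"

lemma finite_mi_quints: "finite (mi_quints J s)"
  unfolding mi_quints_def by (rule finite_SigmaI) (auto simp: finite_mi_triples finite_mi_splits)

lemma mem_mi_quints:
  "((((\<alpha>, \<beta>, k), (\<alpha>', \<beta>', k'), (\<alpha>'', \<beta>'', k'')), \<epsilon>), \<gamma>, \<delta>) \<in> mi_quints J (a, b, c) \<longleftrightarrow>
    \<epsilon> = \<gamma> + \<delta> \<and> (\<forall>i. i \<notin> J \<longrightarrow> \<gamma> $ i = 0) \<and> (\<forall>i. i \<notin> J \<longrightarrow> \<delta> $ i = 0) \<and>
     \<alpha> + \<alpha>' + \<alpha>'' = a + \<gamma> + \<delta> \<and> \<beta> + \<beta>' + \<beta>'' = b + \<gamma> + \<delta> \<and> k + k' + k'' + msize \<gamma> + msize \<delta> = c"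
  by (auto simp: mi_quints_def mi_triples_def mi_splits_def msize_add add.assoc)

lemma sum_mi_quints:
  "(\<Sum>z\<in>mi_quints J s. case z of (((t, t', t''), \<epsilon>), \<gamma>, \<delta>) \<Rightarrow> of_nat (N t t' t'' \<gamma> \<delta>) * P t * Q t' * R t'') =
   (\<Sum>((t, t', t''), \<epsilon>)\<in>mi_triples J s. of_nat (\<Sum>(\<gamma>, \<delta>)\<in>mi_splits \<epsilon>. N t t' t'' \<gamma> \<delta>) * P t * Q t' * (R t'' :: 'k::field))"
  unfolding mi_quints_def
  by (subst sum.Sigma[symmetric])
     (auto simp: finite_mi_triples finite_mi_splits sum_distrib_right case_prod_unfold)

lemma vec_add_cancel1: "x + y = r + g \<Longrightarrow> r + z = a + d \<Longrightarrow> x + y + z = a + g + d" for x :: "nat^'n::finite"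
  unfolding vec_eq_iff vector_add_component by (intro allI, drule_tac x=i in spec, drule_tac x=i in spec) linarith
lemma vec_add_cancel2: "y + z = r + d \<Longrightarrow> x + r = a + g \<Longrightarrow> x + y + z = a + g + d" for x :: "nat^'n::finite"
  unfolding vec_eq_iff vector_add_component by (intro allI, drule_tac x=i in spec, drule_tac x=i in spec) linarith
lemma vec_add_cancel3: "r + g = x + y \<Longrightarrow> x + y + z = a + g + d \<Longrightarrow> r + z = a + d" for x :: "nat^'n::finite"
  unfolding vec_eq_iff vector_add_component by (intro allI, drule_tac x=i in spec, drule_tac x=i in spec) linarith
lemma vec_add_cancel4: "r + d = y + z \<Longrightarrow> x + y + z = a + g + d \<Longrightarrow> x + r = a + g" for x :: "nat^'n::finite"
  unfolding vec_eq_iff vector_add_component by (intro allI, drule_tac x=i in spec, drule_tac x=i in spec) linarith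

lemma hdo_mult_assoc_left:
  fixes P Q R :: "('k::field, 'n::finite) hdo"
  shows
  "hdo_mult J (hdo_mult J P Q) R s =
    (\<Sum>((t, t', t''), \<epsilon>)\<in>mi_triples J s. of_nat (\<Sum>(\<gamma>, \<delta>)\<in>mi_splits \<epsilon>.
        leibniz_coeff (fst (snd t)) (fst t') \<gamma> * leibniz_coeff (fst (snd t) + fst (snd t') - \<gamma>) (fst t'') \<delta>)
       * P t * Q t' * R t'')"
proof -
  obtain a b c where s: "s = (a, b, c)" by (cases s)
  define N where "N = (\<lambda>(t::'n mon) (t'::'n mon) (t''::'n mon) \<gamma> \<delta>. leibniz_coeff (fst (snd t)) (fst t') \<gamma> * 
     leibniz_coeff (fst (snd t) + fst (snd t') - \<gamma>) (fst t'') \<delta>)"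
  define V0 where "V0 = {z \<in> mi_quints J s. case z of (((t, t', t''), \<epsilon>), \<gamma>, \<delta>) \<Rightarrow>
      \<gamma> \<le> fst (snd t) \<and> \<gamma> \<le> fst t' \<and> \<delta> \<le> fst (snd t) + fst (snd t') - \<gamma> \<and> \<delta> \<le> fst t''}"
  have "hdo_mult J (hdo_mult J P Q) R s =
    (\<Sum>(z, z')\<in>Sigma (contrib J s) (\<lambda>(\<delta>, r, t''). contrib J r).
       case z of (\<delta>, r, t'') \<Rightarrow> case z' of (\<gamma>, t, t') \<Rightarrow>
       of_nat (leibniz_coeff (fst (snd r)) (fst t'') \<delta>) * (of_nat (leibniz_coeff (fst (snd t)) (fst t') \<gamma>) * P t * Q t') * R t'')"
    by (subst sum.Sigma[symmetric])
       (auto simp: finite_contrib hdo_mult_alt sum_distrib_left sum_distrib_right case_prod_unfold)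
  also have "\<dots> = (\<Sum>z\<in>V0. case z of (((t, t', t''), \<epsilon>), \<gamma>, \<delta>) \<Rightarrow> of_nat (N t t' t'' \<gamma> \<delta>) * P t * Q t' * R t'')"
  proof (rule sum.reindex_bij_witness[where
      j="\<lambda>((\<delta>, r, t''), (\<gamma>, t, t')). (((t, t', t''), \<gamma> + \<delta>), \<gamma>, \<delta>)" and
      i="\<lambda>(((t, t', t''), \<epsilon>), \<gamma>, \<delta>). ((\<delta>, (fst t + fst t' - \<gamma>, fst (snd t) + fst (snd t') - \<gamma>, snd (snd t) + snd (snd t') + msize \<gamma>), t''), (\<gamma>, t, t'))"], goal_cases)
    case (1 z)
    then show ?case by (auto simp: contrib_def s)
  next
    case (2 z)
    obtain \<gamma> \<delta> \<alpha> \<beta> k \<alpha>' \<beta>' k' \<alpha>'' \<beta>'' k'' r1 r2 r3 where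
      z: "z = ((\<delta>, (r1, r2, r3), (\<alpha>'', \<beta>'', k'')), (\<gamma>, (\<alpha>, \<beta>, k), (\<alpha>', \<beta>', k')))" by (cases z) (simp only: split_paired_all)
    from 2 have e: "\<alpha> + \<alpha>' = r1 + \<gamma>" "r1 + \<alpha>'' = a + \<delta>" "\<beta> + \<beta>' = r2 + \<gamma>" "r2 + \<beta>'' = b + \<delta>"
      and o: "\<gamma> \<le> \<beta>" "\<gamma> \<le> \<alpha>'" "\<delta> \<le> r2" "\<delta> \<le> \<alpha>''" "k + k' + msize \<gamma> = r3" "r3 + k'' + msize \<delta> = c"
         "\<forall>i. i \<notin> J \<longrightarrow> \<gamma> $ i = 0" "\<forall>i. i \<notin> J \<longrightarrow> \<delta> $ i = 0"
      by (auto simp: z contrib_def s)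
    have "\<alpha> + \<alpha>' + \<alpha>'' = a + \<gamma> + \<delta>" "\<beta> + \<beta>' + \<beta>'' = b + \<gamma> + \<delta>"
      using vec_add_cancel1[OF e(1) e(2)] vec_add_cancel1[OF e(3) e(4)] by simp_all
    then show ?case using o e by (auto simp: z V0_def s mem_mi_quints)
  next
    case (3 z)
    then show ?case by (auto simp: V0_def s mi_quints_def mi_splits_def)
  next
    case (4 z)
    obtain \<gamma> \<delta> \<epsilon> \<alpha> \<beta> k \<alpha>' \<beta>' k' \<alpha>'' \<beta>'' k'' where
      z: "z = ((((\<alpha>, \<beta>, k), (\<alpha>', \<beta>', k'), (\<alpha>'', \<beta>'', k'')), \<epsilon>), \<gamma>, \<delta>)" by (cases z) (simp only: split_paired_all)
    from 4 have e: "\<alpha> + \<alpha>' + \<alpha>'' = a + \<gamma> + \<delta>" "\<beta> + \<beta>' + \<beta>'' = b + \<gamma> + \<delta>" "k + k' + k'' + msize \<gamma> + msize \<delta> = c"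
      and o: "\<gamma> \<le> \<beta>" "\<gamma> \<le> \<alpha>'" "\<delta> \<le> \<beta> + \<beta>' - \<gamma>" "\<delta> \<le> \<alpha>''"
         "\<forall>i. i \<notin> J \<longrightarrow> \<gamma> $ i = 0" "\<forall>i. i \<notin> J \<longrightarrow> \<delta> $ i = 0"
      by (auto simp: z V0_def s mem_mi_quints)
    have c: "\<alpha> + \<alpha>' - \<gamma> + \<gamma> = \<alpha> + \<alpha>'" "\<beta> + \<beta>' - \<gamma> + \<gamma> = \<beta> + \<beta>'"
      using o by (auto intro: vec_diff_add_cancel vec_diff_add_cancel2)
    have "\<alpha> + \<alpha>' - \<gamma> + \<alpha>'' = a + \<delta>" "\<beta> + \<beta>' - \<gamma> + \<beta>'' = b + \<delta>"
      using vec_add_cancel3[OF c(1) e(1)] vec_add_cancel3[OF c(2) e(2)] by simp_all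
    then show ?case using o e c by (auto simp: z contrib_def s)
  next
    case (5 z)
    obtain \<gamma> \<delta> \<alpha> \<beta> k \<alpha>' \<beta>' k' \<alpha>'' \<beta>'' k'' r1 r2 r3 where
      z: "z = ((\<delta>, (r1, r2, r3), (\<alpha>'', \<beta>'', k'')), (\<gamma>, (\<alpha>, \<beta>, k), (\<alpha>', \<beta>', k')))" by (cases z) (simp only: split_paired_all)
    from 5 have "\<beta> + \<beta>' = r2 + \<gamma>" by (auto simp: z contrib_def s)
    then have "r2 = \<beta> + \<beta>' - \<gamma>" by simp
    then show ?case by (simp add: z N_def mult_ac)
  qed
  also have "\<dots> = (\<Sum>z\<in>mi_quints J s. case z of (((t, t', t''), \<epsilon>), \<gamma>, \<delta>) \<Rightarrow> of_nat (N t t' t'' \<gamma> \<delta>) * P t * Q t' * R t'')"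
    by (rule sum.mono_neutral_left) (auto simp: finite_mi_quints V0_def N_def dest!: leibniz_coeff_nz)
  finally show ?thesis by (simp only: sum_mi_quints N_def)
qed

lemma hdo_mult_assoc_right:
  fixes P Q R :: "('k::field, 'n::finite) hdo"
  shows
  "hdo_mult J P (hdo_mult J Q R) s =
    (\<Sum>((t, t', t''), \<epsilon>)\<in>mi_triples J s. of_nat (\<Sum>(\<gamma>, \<delta>)\<in>mi_splits \<epsilon>.
        leibniz_coeff (fst (snd t)) (fst t' + fst t'' - \<delta>) \<gamma> * leibniz_coeff (fst (snd t')) (fst t'') \<delta>)
       * P t * Q t' * R t'')"
proof -
  obtain a b c where s: "s = (a, b, c)" by (cases s)
  define N where "N = (\<lambda>(t::'n mon) (t'::'n mon) (t''::'n mon) \<gamma> \<delta>. leibniz_coeff (fst (snd t)) (fst t' + fst t'' - \<delta>) \<gamma> * 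
     leibniz_coeff (fst (snd t')) (fst t'') \<delta>)"
  define V0 where "V0 = {z \<in> mi_quints J s. case z of (((t, t', t''), \<epsilon>), \<gamma>, \<delta>) \<Rightarrow>
      \<gamma> \<le> fst (snd t) \<and> \<gamma> \<le> fst t' + fst t'' - \<delta> \<and> \<delta> \<le> fst (snd t') \<and> \<delta> \<le> fst t''}"
  have "hdo_mult J P (hdo_mult J Q R) s =
    (\<Sum>(z, z')\<in>Sigma (contrib J s) (\<lambda>(\<gamma>, t, r). contrib J r).
       case z of (\<gamma>, t, r) \<Rightarrow> case z' of (\<delta>, t', t'') \<Rightarrow>
       of_nat (leibniz_coeff (fst (snd t)) (fst r) \<gamma>) * P t * (of_nat (leibniz_coeff (fst (snd t')) (fst t'') \<delta>) * Q t' * R t''))"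
    by (subst sum.Sigma[symmetric])
       (auto simp: finite_contrib hdo_mult_alt sum_distrib_left sum_distrib_right case_prod_unfold)
  also have "\<dots> = (\<Sum>z\<in>V0. case z of (((t, t', t''), \<epsilon>), \<gamma>, \<delta>) \<Rightarrow> of_nat (N t t' t'' \<gamma> \<delta>) * P t * Q t' * R t'')"
  proof (rule sum.reindex_bij_witness[where
      j="\<lambda>((\<gamma>, t, r), (\<delta>, t', t'')). (((t, t', t''), \<gamma> + \<delta>), \<gamma>, \<delta>)" and
      i="\<lambda>(((t, t', t''), \<epsilon>), \<gamma>, \<delta>). ((\<gamma>, t, (fst t' + fst t'' - \<delta>, fst (snd t') + fst (snd t'') - \<delta>, snd (snd t') + snd (snd t'') + msize \<delta>)), (\<delta>, t', t''))"], goal_cases)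
    case (1 z)
    then show ?case by (auto simp: contrib_def s)
  next
    case (2 z)
    obtain \<gamma> \<delta> \<alpha> \<beta> k \<alpha>' \<beta>' k' \<alpha>'' \<beta>'' k'' r1 r2 r3 where
      z: "z = ((\<gamma>, (\<alpha>, \<beta>, k), (r1, r2, r3)), (\<delta>, (\<alpha>', \<beta>', k'), (\<alpha>'', \<beta>'', k'')))" by (cases z) (simp only: split_paired_all)
    from 2 have e: "\<alpha>' + \<alpha>'' = r1 + \<delta>" "\<alpha> + r1 = a + \<gamma>" "\<beta>' + \<beta>'' = r2 + \<delta>" "\<beta> + r2 = b + \<gamma>"
      and o: "\<gamma> \<le> \<beta>" "\<gamma> \<le> r1" "\<delta> \<le> \<beta>'" "\<delta> \<le> \<alpha>''" "k' + k'' + msize \<delta> = r3" "k + r3 + msize \<gamma> = c"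
         "\<forall>i. i \<notin> J \<longrightarrow> \<gamma> $ i = 0" "\<forall>i. i \<notin> J \<longrightarrow> \<delta> $ i = 0"
      by (auto simp: z contrib_def s)
    have "\<alpha> + \<alpha>' + \<alpha>'' = a + \<gamma> + \<delta>" "\<beta> + \<beta>' + \<beta>'' = b + \<gamma> + \<delta>"
      using vec_add_cancel2[OF e(1) e(2)] vec_add_cancel2[OF e(3) e(4)] by simp_all
    then show ?case using o e by (auto simp: z V0_def s mem_mi_quints)
  next
    case (3 z)
    then show ?case by (auto simp: V0_def s mi_quints_def mi_splits_def)
  next
    case (4 z)
    obtain \<gamma> \<delta> \<epsilon> \<alpha> \<beta> k \<alpha>' \<beta>' k' \<alpha>'' \<beta>'' k'' where
      z: "z = ((((\<alpha>, \<beta>, k), (\<alpha>', \<beta>', k'), (\<alpha>'', \<beta>'', k'')), \<epsilon>), \<gamma>, \<delta>)" by (cases z) (simp only: split_paired_all)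
    from 4 have e: "\<alpha> + \<alpha>' + \<alpha>'' = a + \<gamma> + \<delta>" "\<beta> + \<beta>' + \<beta>'' = b + \<gamma> + \<delta>" "k + k' + k'' + msize \<gamma> + msize \<delta> = c"
      and o: "\<gamma> \<le> \<beta>" "\<gamma> \<le> \<alpha>' + \<alpha>'' - \<delta>" "\<delta> \<le> \<beta>'" "\<delta> \<le> \<alpha>''"
         "\<forall>i. i \<notin> J \<longrightarrow> \<gamma> $ i = 0" "\<forall>i. i \<notin> J \<longrightarrow> \<delta> $ i = 0"
      by (auto simp: z V0_def s mem_mi_quints)
    have c: "\<alpha>' + \<alpha>'' - \<delta> + \<delta> = \<alpha>' + \<alpha>''" "\<beta>' + \<beta>'' - \<delta> + \<delta> = \<beta>' + \<beta>''"
      using o by (auto intro: vec_diff_add_cancel vec_diff_add_cancel2)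
    have "\<alpha> + (\<alpha>' + \<alpha>'' - \<delta>) = a + \<gamma>" "\<beta> + (\<beta>' + \<beta>'' - \<delta>) = b + \<gamma>"
      using vec_add_cancel4[OF c(1) e(1)] vec_add_cancel4[OF c(2) e(2)] by simp_all
    then show ?case using o e c by (auto simp: z contrib_def s)
  next
    case (5 z)
    obtain \<gamma> \<delta> \<alpha> \<beta> k \<alpha>' \<beta>' k' \<alpha>'' \<beta>'' k'' r1 r2 r3 where
      z: "z = ((\<gamma>, (\<alpha>, \<beta>, k), (r1, r2, r3)), (\<delta>, (\<alpha>', \<beta>', k'), (\<alpha>'', \<beta>'', k'')))" by (cases z) (simp only: split_paired_all)
    from 5 have "\<alpha>' + \<alpha>'' = r1 + \<delta>" by (auto simp: z contrib_def s)
    then have "r1 = \<alpha>' + \<alpha>'' - \<delta>" by simp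
    then show ?case by (simp add: z N_def mult_ac)
  qed
  also have "\<dots> = (\<Sum>z\<in>mi_quints J s. case z of (((t, t', t''), \<epsilon>), \<gamma>, \<delta>) \<Rightarrow> of_nat (N t t' t'' \<gamma> \<delta>) * P t * Q t' * R t'')"
    by (rule sum.mono_neutral_left) (auto simp: finite_mi_quints V0_def N_def dest!: leibniz_coeff_nz)
  finally show ?thesis by (simp only: sum_mi_quints N_def)
qed

lemma hdo_mult_assoc: "hdo_mult J (hdo_mult J P Q) R = hdo_mult J P (hdo_mult J Q R)"
  unfolding fun_eq_iff hdo_mult_assoc_left hdo_mult_assoc_right leibniz_coeff_assoc by simp

lemma hdo_mult_nz:
  assumes "hdo_mult J P Q s \<noteq> 0"
  obtains \<gamma> t t' where "(\<gamma>, t, t') \<in> contrib J s" "P t \<noteq> 0" "Q t' \<noteq> 0"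
proof -
  from assms obtain z where "z \<in> contrib J s" "(case z of (\<gamma>, t, t') \<Rightarrow>
     of_nat (leibniz_coeff (fst (snd t)) (fst t') \<gamma>) * P t * Q t') \<noteq> 0"
    unfolding hdo_mult_alt by (meson sum.not_neutral_contains_not_neutral)
  then show ?thesis by (cases z) (auto intro!: that)
qed

lemma Supp_hdo_mult:
  assumes "(a, b, c) \<in> Supp (hdo_mult J P Q)"
  obtains \<gamma> \<alpha> \<beta> k \<alpha>' \<beta>' k' where "(\<alpha>, \<beta>, k) \<in> Supp P" "(\<alpha>', \<beta>', k') \<in> Supp Q"
    "\<forall>i. \<gamma> $ i \<le> \<beta> $ i" "a = \<alpha> + \<alpha>' - \<gamma>" "b = \<beta> + \<beta>' - \<gamma>" "c = k + k' + msize \<gamma>"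
proof -
  from assms have "hdo_mult J P Q (a, b, c) \<noteq> 0" by (simp add: Supp_def)
  then obtain \<gamma> t t' where *: "(\<gamma>, t, t') \<in> contrib J (a, b, c)" "P t \<noteq> 0" "Q t' \<noteq> 0" by (rule hdo_mult_nz)
  obtain \<alpha> \<beta> k \<alpha>' \<beta>' k' where t: "t = (\<alpha>, \<beta>, k)" "t' = (\<alpha>', \<beta>', k')"
    by (cases t, cases t') auto
  show ?thesis
    by (rule that[of \<alpha> \<beta> k \<alpha>' \<beta>' k' \<gamma>]) (use * in \<open>auto simp: Supp_def contrib_def t less_eq_vec_def\<close>)
qed

lemma hdo_mult_closed:
  assumes "P \<in> formal_ops" "Q \<in> formal_ops"
  shows "hdo_mult J P Q \<in> formal_ops"
proof -
  define E where "E = (\<Union>p\<in>snd ` Supp P. \<Union>q\<in>snd ` Supp Q.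
     (\<lambda>\<gamma>. (fst p + fst q - \<gamma>, snd p + snd q + msize \<gamma>)) ` {\<gamma>. \<forall>i. \<gamma> $ i \<le> fst p $ i})"
  have "finite E" unfolding E_def
    by (intro finite_UN_I finite_imageI[OF finite_vec_le] assms[unfolded formal_ops_def mem_Collect_eq])
  moreover have "snd ` Supp (hdo_mult J P Q) \<subseteq> E"
  proof
    fix z assume "z \<in> snd ` Supp (hdo_mult J P Q)"
    then obtain a b c where s: "(a, b, c) \<in> Supp (hdo_mult J P Q)" "z = (b, c)" by force
    from s(1) obtain \<gamma> \<alpha> \<beta> k \<alpha>' \<beta>' k' where 1: "(\<alpha>, \<beta>, k) \<in> Supp P" "(\<alpha>', \<beta>', k') \<in> Supp Q"
      "\<forall>i. \<gamma> $ i \<le> \<beta> $ i" "b = \<beta> + \<beta>' - \<gamma>" "c = k + k' + msize \<gamma>"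
      by (rule Supp_hdo_mult)
    then have 2: "(\<beta>, k) \<in> snd ` Supp P" "(\<beta>', k') \<in> snd ` Supp Q" by force+
    show "z \<in> E" unfolding E_def s(2)
      by (rule UN_I[OF 2(1)], rule UN_I[OF 2(2)], rule image_eqI[of _ _ \<gamma>]) (use 1 in auto)
  qed
  ultimately show ?thesis by (simp add: formal_ops_def finite_subset)
qed

lemma hdo_mult_add_right: "hdo_mult J P (\<lambda>t. Q t + R t) = (\<lambda>t. hdo_mult J P Q t + hdo_mult J P R t)"
  by (rule ext) (simp add: hdo_mult_alt case_prod_unfold sum.distrib[symmetric] algebra_simps)

lemma hdo_mult_add_left: "hdo_mult J (\<lambda>t. P t + Q t) R = (\<lambda>t. hdo_mult J P R t + hdo_mult J Q R t)"
  by (rule ext) (simp add: hdo_mult_alt case_prod_unfold sum.distrib[symmetric] algebra_simps)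

definition hdo_series :: "(nat^'n::finite \<Rightarrow> 'k::field) \<Rightarrow> ('k, 'n) hdo" where
  "hdo_series f = (\<lambda>(\<alpha>, \<beta>, k). if \<beta> = 0 \<and> k = 0 then f \<alpha> else 0)"

lemma le_0_vec [simp]: "\<gamma> \<le> 0 \<longleftrightarrow> \<gamma> = 0" for \<gamma> :: "nat^'n::finite"
  by (auto simp: less_eq_vec_def vec_eq_iff)

lemma zero_le_vec [simp]: "0 \<le> \<gamma>" for \<gamma> :: "nat^'n::finite"
  by (auto simp: less_eq_vec_def)

lemma msize_0 [simp]: "msize 0 = 0" by (simp add: msize_def)

definition mi_unit :: "'n::finite \<Rightarrow> nat^'n" where
  "mi_unit i = (\<chi> j. if j = i then 1 else 0)"

lemma msize_mi_unit [simp]: "msize (mi_unit i) = 1"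
  by (simp add: msize_def mi_unit_def)

lemma hdo_series_mult:
  fixes Q :: "('k::field, 'n::finite) hdo"
  shows "hdo_mult J (hdo_series f) Q (a, b, c) = (\<Sum>(\<alpha>, \<alpha>')\<in>{(\<alpha>, \<alpha>'). \<alpha> + \<alpha>' = a}. f \<alpha> * Q (\<alpha>', b, c))"
proof -
  define g where "g = (\<lambda>(\<alpha>, \<alpha>'). (0 :: nat^'n, (\<alpha> :: nat^'n, 0 :: nat^'n, 0 :: nat), (\<alpha>' :: nat^'n, b :: nat^'n, c :: nat)))"
  have "hdo_mult J (hdo_series f) Q (a, b, c) = (\<Sum>z\<in>g ` mi_splits a. case z of (\<gamma>, t, t') \<Rightarrow>
     of_nat (leibniz_coeff (fst (snd t)) (fst t') \<gamma>) * hdo_series f t * Q t')"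
    unfolding hdo_mult_alt
  proof (rule sum.mono_neutral_right, goal_cases)
    case 3
    show ?case
    proof (safe, rule ccontr, goal_cases)
      case (1 \<gamma> \<alpha> \<beta> k \<alpha>' \<beta>' k')
      then have "\<beta> = 0" "k = 0" by (auto simp: hdo_series_def split: if_splits)
      with 1 have "(\<gamma>, (\<alpha>, \<beta>, k), (\<alpha>', \<beta>', k')) = g (\<alpha>, \<alpha>')" "(\<alpha>, \<alpha>') \<in> mi_splits a"
        by (auto simp: contrib_def g_def mi_splits_def)
      with 1 show ?case by blast
    qed
  qed (rule finite_contrib, auto simp: contrib_def g_def mi_splits_def)
  also have "\<dots> = (\<Sum>(\<alpha>, \<alpha>')\<in>mi_splits a. f \<alpha> * Q (\<alpha>', b, c))"
    by (subst sum.reindex) (auto simp: inj_on_def g_def hdo_series_def intro!: sum.cong)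
  finally show ?thesis by (simp add: mi_splits_def)
qed

lemma hdo_one_mult: "hdo_mult J (hdo_monom (0, 0, 0)) Q = Q"
proof (rule ext)
  fix s
  have "hdo_mult J (hdo_monom (0, 0, 0)) Q s = (\<Sum>z\<in>{(0, (0, 0, 0), s)}. case z of (\<gamma>, t, t') \<Rightarrow>
     of_nat (leibniz_coeff (fst (snd t)) (fst t') \<gamma>) * hdo_monom (0, 0, 0) t * Q t')"
    unfolding hdo_mult_alt
    by (rule sum.mono_neutral_right, rule finite_contrib)
       (auto simp: contrib_def hdo_monom_def split: prod.splits if_splits)
  then show "hdo_mult J (hdo_monom (0, 0, 0)) Q s = Q s" by (simp add: hdo_monom_def)
qed

lemma hdo_mult_one: "hdo_mult J P (hdo_monom (0, 0, 0)) = P"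
proof (rule ext)
  fix s
  have "hdo_mult J P (hdo_monom (0, 0, 0)) s = (\<Sum>z\<in>{(0, s, (0, 0, 0))}. case z of (\<gamma>, t, t') \<Rightarrow>
     of_nat (leibniz_coeff (fst (snd t)) (fst t') \<gamma>) * P t * hdo_monom (0, 0, 0) t')"
    unfolding hdo_mult_alt
    by (rule sum.mono_neutral_right, rule finite_contrib)
       (auto simp: contrib_def hdo_monom_def split: prod.splits if_splits)
  then show "hdo_mult J P (hdo_monom (0, 0, 0)) s = P s" by (simp add: hdo_monom_def)
qed

lemma hdo_h_mult: "hdo_mult J (hdo_monom (0, 0, 1)) Q (a, b, c) = (if c > 0 then Q (a, b, c - 1) else 0)"
proof -
  have "hdo_mult J (hdo_monom (0, 0, 1)) Q (a, b, c) = (\<Sum>z\<in>(if c > 0 then {(0, (0, 0, 1), (a, b, c - 1))} else {}). case z of (\<gamma>, t, t') \<Rightarrow>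
     of_nat (leibniz_coeff (fst (snd t)) (fst t') \<gamma>) * hdo_monom (0, 0, 1) t * Q t')"
    unfolding hdo_mult_alt
    by (rule sum.mono_neutral_right, rule finite_contrib)
       (auto simp: contrib_def hdo_monom_def split: prod.splits if_splits)
  then show ?thesis by (simp add: hdo_monom_def)
qed

lemma hdo_mult_h: "hdo_mult J P (hdo_monom (0, 0, 1)) (a, b, c) = (if c > 0 then P (a, b, c - 1) else 0)"
proof -
  have "hdo_mult J P (hdo_monom (0, 0, 1)) (a, b, c) = (\<Sum>z\<in>(if c > 0 then {(0, (a, b, c - 1), (0, 0, 1))} else {}). case z of (\<gamma>, t, t') \<Rightarrow>
     of_nat (leibniz_coeff (fst (snd t)) (fst t') \<gamma>) * P t * hdo_monom (0, 0, 1) t')"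
    unfolding hdo_mult_alt
    by (rule sum.mono_neutral_right, rule finite_contrib)
       (auto simp: contrib_def hdo_monom_def split: prod.splits if_splits)
  then show ?thesis by (simp add: hdo_monom_def)
qed

lemma mi_unit_nth: "mi_unit i $ j = (if j = i then 1 else 0)"
  by (simp add: mi_unit_def)

lemma mi_unit_le_iff: "mi_unit i \<le> b \<longleftrightarrow> 0 < b $ i" for b :: "nat^'n::finite"
  by (auto simp: less_eq_vec_def mi_unit_nth)

lemma le_mi_unit_iff: "\<gamma> \<le> mi_unit i \<longleftrightarrow> \<gamma> = 0 \<or> \<gamma> = mi_unit i" for \<gamma> :: "nat^'n::finite"
proof
  assume "\<gamma> \<le> mi_unit i"
  then have *: "\<gamma> $ j \<le> (if j = i then 1 else 0)" for j
    by (simp add: less_eq_vec_def mi_unit_nth)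
  have "\<gamma> $ i = 0 \<or> \<gamma> $ i = 1" using *[of i] by auto
  moreover have "\<gamma> $ j = 0" if "j \<noteq> i" for j using *[of j] that by simp
  ultimately show "\<gamma> = 0 \<or> \<gamma> = mi_unit i"
    by (metis (no_types, lifting) mi_unit_nth vec_eq_iff zero_index)
qed (auto simp: less_eq_vec_def)

lemma mi_unit_sub: "mi_unit i + \<beta>' = b \<longleftrightarrow> 0 < b $ i \<and> \<beta>' = b - mi_unit i" for b :: "nat^'n::finite"
proof
  assume "mi_unit i + \<beta>' = b"
  then show "0 < b $ i \<and> \<beta>' = b - mi_unit i" by (auto simp: mi_unit_nth)
next
  assume "0 < b $ i \<and> \<beta>' = b - mi_unit i"
  then show "mi_unit i + \<beta>' = b" by (simp add: vec_eq_iff mi_unit_nth)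
qed

lemma mi_unit_sub': "\<beta>' + mi_unit i = b \<longleftrightarrow> 0 < b $ i \<and> \<beta>' = b - mi_unit i" for b :: "nat^'n::finite"
  using mi_unit_sub[of i \<beta>' b] by (simp add: add.commute)

lemma mi_unit_neq_0 [simp]: "mi_unit i \<noteq> 0" "0 \<noteq> mi_unit i"
  by (simp_all add: vec_eq_iff mi_unit_nth)

lemma leibniz_coeff_mi_unit: "leibniz_coeff (mi_unit i) (a + mi_unit i) (mi_unit i) = a $ i + 1"
proof -
  have "leibniz_coeff (mi_unit i) (a + mi_unit i) (mi_unit i) = (\<Prod>j\<in>UNIV. if j = i then a $ i + 1 else 1)"
    unfolding leibniz_coeff_def by (rule prod.cong) (auto simp: mi_unit_nth)
  then show ?thesis by simp
qed

lemma hdo_d_mult: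
  "hdo_mult J (hdo_monom (0, mi_unit i, 0)) Q (a, b, c) =
     (if 0 < b $ i then Q (a, b - mi_unit i, c) else 0) +
     (if i \<in> J \<and> 0 < c then of_nat (a $ i + 1) * Q (a + mi_unit i, b, c - 1) else 0)"
proof -
  have "hdo_mult J (hdo_monom (0, mi_unit i, 0)) Q (a, b, c) =
    (\<Sum>z\<in>(if 0 < b $ i then {(0, (0, mi_unit i, 0), (a, b - mi_unit i, c))} else {}) \<union>
        (if i \<in> J \<and> 0 < c then {(mi_unit i, (0, mi_unit i, 0), (a + mi_unit i, b, c - 1))} else {}). case z of (\<gamma>, t, t') \<Rightarrow>
     of_nat (leibniz_coeff (fst (snd t)) (fst t') \<gamma>) * hdo_monom (0, mi_unit i, 0) t * Q t')"
    unfolding hdo_mult_alt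
  proof (rule sum.mono_neutral_right, goal_cases)
    case 2
    show ?case by (auto simp: contrib_def mi_unit_sub mi_unit_le_iff) (auto simp: mi_unit_nth)
  next
    case 3
    show ?case
    proof (safe, rule ccontr, goal_cases)
      case (1 \<gamma> \<alpha> \<beta> k \<alpha>' \<beta>' k')
      then have t: "\<beta> = mi_unit i" "k = 0" "\<alpha> = 0" by (auto simp: hdo_monom_def split: if_splits)
      with 1 have "\<gamma> = 0 \<or> \<gamma> = mi_unit i" by (auto simp: contrib_def le_mi_unit_iff)
      then show ?case
      proof
        assume "\<gamma> = 0"
        then show ?thesis using 1 t by (auto simp: contrib_def mi_unit_sub)
      next
        assume "\<gamma> = mi_unit i"
        then have "i \<in> J" using 1 by (auto simp: contrib_def) (metis mi_unit_nth zero_neq_one)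
        with \<open>\<gamma> = mi_unit i\<close> show ?thesis using 1 t by (auto simp: contrib_def add.commute)
      qed
    qed
  qed (rule finite_contrib)
  then show ?thesis
    using leibniz_coeff_mi_unit[of i a] by (auto simp: hdo_monom_def add.commute)
qed

lemma hdo_mult_d:
  "hdo_mult J P (hdo_monom (0, mi_unit i, 0)) (a, b, c) = (if 0 < b $ i then P (a, b - mi_unit i, c) else 0)"
proof -
  have "hdo_mult J P (hdo_monom (0, mi_unit i, 0)) (a, b, c) = (\<Sum>z\<in>(if 0 < b $ i then {(0, (a, b - mi_unit i, c), (0, mi_unit i, 0))} else {}). case z of (\<gamma>, t, t') \<Rightarrow>
     of_nat (leibniz_coeff (fst (snd t)) (fst t') \<gamma>) * P t * hdo_monom (0, mi_unit i, 0) t')"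
    unfolding hdo_mult_alt
    by (rule sum.mono_neutral_right, rule finite_contrib)
       (auto simp: contrib_def hdo_monom_def mi_unit_sub' split: prod.splits if_splits)
  then show ?thesis by (simp add: hdo_monom_def)
qed

lemma hdo_commute_d_d:
  "hdo_mult J (hdo_monom (0, mi_unit i, 0)) (hdo_monom (0, mi_unit j, 0)) =
   hdo_mult J (hdo_monom (0, mi_unit j, 0)) (hdo_monom (0, mi_unit i, 0))"
proof (rule ext)
  fix t :: "'a mon"
  obtain a b c where t: "t = (a, b, c)" by (cases t)
  have *: "0 < b $ j \<and> mi_unit i = b - mi_unit j \<longleftrightarrow> 0 < b $ i \<and> mi_unit j = b - mi_unit i"
    unfolding mi_unit_sub[symmetric] by (simp only: add.commute)
  have "hdo_mult J (hdo_monom (0, mi_unit i, 0)) (hdo_monom (0, mi_unit j, 0)) t =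
    (if a = 0 \<and> c = 0 \<and> 0 < b $ j \<and> mi_unit i = b - mi_unit j then 1 else 0)"
    unfolding t hdo_mult_d by (auto simp: hdo_monom_def)
  also have "\<dots> = hdo_mult J (hdo_monom (0, mi_unit j, 0)) (hdo_monom (0, mi_unit i, 0)) t"
    unfolding * unfolding t hdo_mult_d by (auto simp: hdo_monom_def)
  finally show "hdo_mult J (hdo_monom (0, mi_unit i, 0)) (hdo_monom (0, mi_unit j, 0)) t =
    hdo_mult J (hdo_monom (0, mi_unit j, 0)) (hdo_monom (0, mi_unit i, 0)) t" .
qed

lemma hdo_commute_d_series:
  "hdo_mult J (hdo_monom (0, mi_unit i, 0)) (hdo_series f) =
   (\<lambda>t. hdo_mult J (hdo_series f) (hdo_monom (0, mi_unit i, 0)) t +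
     (if i \<in> J then hdo_mult J (hdo_series (\<lambda>\<alpha>. of_nat (\<alpha> $ i + 1) * f (\<alpha> + mi_unit i))) (hdo_monom (0, 0, 1)) t else 0))"
proof (rule ext)
  fix t :: "'a mon"
  obtain a b c where t: "t = (a, b, c)" by (cases t)
  show "hdo_mult J (hdo_monom (0, mi_unit i, 0)) (hdo_series f) t =
   hdo_mult J (hdo_series f) (hdo_monom (0, mi_unit i, 0)) t +
     (if i \<in> J then hdo_mult J (hdo_series (\<lambda>\<alpha>. of_nat (\<alpha> $ i + 1) * f (\<alpha> + mi_unit i))) (hdo_monom (0, 0, 1)) t else 0)"
    unfolding t hdo_d_mult hdo_mult_d hdo_mult_h by (simp add: hdo_series_def)
qed

lemma ring_hdo_ring:
  assumes "C \<subseteq> formal_ops" "\<And>P Q. P \<in> C \<Longrightarrow> Q \<in> C \<Longrightarrow> hdo_mult J P Q \<in> C" "hdo_monom (0, 0, 0) \<in> C" "(\<lambda>_. 0) \<in> C"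
    "\<And>P Q. P \<in> C \<Longrightarrow> Q \<in> C \<Longrightarrow> (\<lambda>t. P t + Q t) \<in> C" "\<And>P. P \<in> C \<Longrightarrow> (\<lambda>t. - P t) \<in> C"
  shows "ring (hdo_ring J C)"
proof (rule ringI)
  show "abelian_group (hdo_ring J C)"
  proof (rule abelian_groupI)
    fix P assume "P \<in> carrier (hdo_ring J C)"
    then show "\<exists>Q\<in>carrier (hdo_ring J C). Q \<oplus>\<^bsub>hdo_ring J C\<^esub> P = \<zero>\<^bsub>hdo_ring J C\<^esub>"
      using assms(6) by (auto simp: hdo_ring_def intro!: bexI[of _ "\<lambda>t. - P t"])
  qed (use assms in \<open>simp_all add: hdo_ring_def ac_simps\<close>)
  show "Group.monoid (hdo_ring J C)"
    by (rule Group.monoidI) (use assms in \<open>simp_all add: hdo_ring_def hdo_mult_assoc hdo_one_mult hdo_mult_one\<close>)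
qed (simp_all add: hdo_ring_def hdo_mult_add_left hdo_mult_add_right)

lemma Supp_add: "Supp (\<lambda>t. P t + Q t) \<subseteq> Supp P \<union> Supp (Q :: ('k::field, 'n::finite) hdo)"
  by (auto simp: Supp_def)

lemma ring_hD_formal: "ring hD_formal"
  unfolding hD_formal_def
proof (rule ring_hdo_ring)
  fix P Q :: "('b, 'a) hdo" assume "P \<in> formal_ops" "Q \<in> formal_ops"
  then show "(\<lambda>t. P t + Q t) \<in> formal_ops"
    unfolding formal_ops_def mem_Collect_eq
    by (rule_tac finite_subset[OF image_mono[OF Supp_add]]) (simp add: image_Un)
qed (auto simp: hdo_mult_closed, auto simp: formal_ops_def Supp_def hdo_monom_def)

section \<open>Left ideals\<close>

definition left_ideal :: "'a set \<Rightarrow> ('a, 'b) ring_scheme \<Rightarrow> bool" where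
  "left_ideal I R \<longleftrightarrow> additive_subgroup I R \<and> (\<forall>a\<in>carrier R. \<forall>x\<in>I. a \<otimes>\<^bsub>R\<^esub> x \<in> I)"

definition gen_left_ideal :: "('a, 'b) ring_scheme \<Rightarrow> 'a set \<Rightarrow> 'a set" where
  "gen_left_ideal R S = \<Inter>{I. left_ideal I R \<and> S \<subseteq> I}"

definition homogeneous_op :: "('k::zero, 'n::finite) hdo \<Rightarrow> bool" where
  "homogeneous_op P \<longleftrightarrow> (\<exists>d. \<forall>(\<alpha>, \<beta>, k)\<in>Supp P. msize \<beta> + k = d)"

definition homogeneous_ideal :: "('k::field, 'n::finite) hdo set \<Rightarrow> ('k, 'n) hdo ring \<Rightarrow> bool" where
  "homogeneous_ideal I A \<longleftrightarrow> left_ideal I A \<and>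
     (\<exists>G\<subseteq>carrier A. (\<forall>P\<in>G. homogeneous_op P) \<and> I = gen_left_ideal A G)"

section \<open>Weights, graded rings and initial ideals\<close>

type_synonym 'n weight = "(real^'n) \<times> (real^'n)"

definition W_loc :: "'n::finite weight set" where
  "W_loc = {(u, v). \<forall>i. u $ i \<le> 0 \<and> u $ i + v $ i \<ge> 0}"

definition M_set :: "'n::finite weight \<Rightarrow> 'n set" where
  "M_set = (\<lambda>(u, v). {i. u $ i < 0})"

definition P_set :: "'n::finite weight \<Rightarrow> 'n set" where
  "P_set = (\<lambda>(u, v). {i. u $ i + v $ i > 0})"

definition wt :: "'n::finite weight \<Rightarrow> 'n mon \<Rightarrow> real" where
  "wt = (\<lambda>(u, v) (\<alpha>, \<beta>, k). (\<Sum>i\<in>UNIV. u $ i * \<alpha> $ i) + (\<Sum>i\<in>UNIV. v $ i * \<beta> $ i))"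

definition filt :: "('k::field, 'n::finite) hdo ring \<Rightarrow> 'n weight \<Rightarrow> real \<Rightarrow> ('k, 'n) hdo set" where
  "filt A w m = {P \<in> carrier A. \<forall>t\<in>Supp P. wt w t \<le> m}"

definition filt_less :: "('k::field, 'n::finite) hdo ring \<Rightarrow> 'n weight \<Rightarrow> real \<Rightarrow> ('k, 'n) hdo set" where
  "filt_less A w m = {P \<in> carrier A. \<forall>t\<in>Supp P. wt w t < m}"

text \<open>
  The class of \<open>P\<close> modulo the elements of order \<open>< m\<close> is represented by the part of \<open>P\<close> of weight
  exactly \<open>m\<close> (\<open>symb_eq_0_iff\<close>).
\<close>

definition symb :: "'n::finite weight \<Rightarrow> real \<Rightarrow> ('k::field, 'n) hdo \<Rightarrow> ('k, 'n) hdo" where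
  "symb w m P = (\<lambda>t. if wt w t = m then P t else 0)"

text \<open>
  The graded ring in its identification with a ring of normal forms: \<open>\<partial>_i\<close> becomes a commutative
  variable for \<open>i \<in> P_set w\<close>, and the coefficients are polynomial in \<open>x_i\<close> for \<open>i \<in> M_set w\<close>. It is the
  direct sum of the spaces of symbols (\<open>gr_carrier_iff\<close>, \<open>symb_id\<close>, \<open>symb_in_gr\<close>) with the
  product induced by that of \<open>A\<close> (\<open>symb_mult\<close>).
\<close>

definition gr :: "'n::finite weight \<Rightarrow> ('k::field, 'n) hdo ring \<Rightarrow> ('k, 'n) hdo ring" where
  "gr w A = hdo_ring (- P_set w)
     {P \<in> carrier A. \<forall>i\<in>M_set w. finite ((\<lambda>(\<alpha>, \<beta>, k). \<alpha> $ i) ` Supp P)}"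

text \<open>For \<open>w \<in> W_loc\<close> and nonzero \<open>P \<in> formal_ops\<close> this supremum is a maximum (\<open>ord_attained\<close>).\<close>

definition ord_w :: "'n::finite weight \<Rightarrow> ('k::field, 'n) hdo \<Rightarrow> real" where
  "ord_w w P = Sup (wt w ` Supp P)"

definition initial_form :: "'n::finite weight \<Rightarrow> ('k::field, 'n) hdo \<Rightarrow> ('k, 'n) hdo" where
  "initial_form w P = symb w (ord_w w P) P"

definition initial_ideal :: "('k::field, 'n::finite) hdo ring \<Rightarrow> 'n weight \<Rightarrow> ('k, 'n) hdo set \<Rightarrow> ('k, 'n) hdo set" where
  "initial_ideal A w I = gen_left_ideal (gr w A) (initial_form w ` I)"

subsection \<open>Symbols and the graded ring\<close>

lemma formal_ops_subset: "P \<in> formal_ops \<Longrightarrow> Supp Q \<subseteq> Supp P \<Longrightarrow> Q \<in> formal_ops"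
  unfolding formal_ops_def mem_Collect_eq by (erule finite_subset[rotated]) auto

lemma wt_le:
  assumes "(u, v) \<in> W_loc"
  shows "wt (u, v) (\<alpha>, \<beta>, k) \<le> u $ i * \<alpha> $ i + (\<Sum>i\<in>UNIV. v $ i * \<beta> $ i)"
proof -
  have "(\<Sum>j\<in>UNIV. u $ j * \<alpha> $ j) = u $ i * \<alpha> $ i + (\<Sum>j\<in>UNIV - {i}. u $ j * \<alpha> $ j)"
    by (simp add: sum.remove)
  moreover have "(\<Sum>j\<in>UNIV - {i}. u $ j * \<alpha> $ j) \<le> 0"
    using assms by (intro sum_nonpos) (auto simp: W_loc_def mult_nonpos_nonneg)
  ultimately show ?thesis by (simp add: wt_def)
qed

lemma bounded_below_imp_finite:
  assumes "w \<in> W_loc" "P \<in> formal_ops" "i \<in> M_set w" and L: "\<And>t. t \<in> Supp P \<Longrightarrow> L \<le> wt w t"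
  shows "finite ((\<lambda>(\<alpha>, \<beta>, k). \<alpha> $ i) ` Supp P)"
proof (cases "Supp P = {}")
  case False
  obtain u v where w: "w = (u, v)" by (cases w)
  have u: "u $ i < 0" using assms(3) by (simp add: w M_set_def)
  define V where "V = (\<lambda>(\<beta> :: nat^'a, k :: nat). (\<Sum>i\<in>UNIV. v $ i * real (\<beta> $ i))) ` snd ` Supp P"
  have V: "finite V" using assms(2) unfolding V_def formal_ops_def by simp
  have "\<alpha> $ i \<le> nat \<lceil>(L - Max V) / u $ i\<rceil>" if "(\<alpha>, \<beta>, k) \<in> Supp P" for \<alpha> \<beta> k
  proof -
    have "(\<Sum>i\<in>UNIV. v $ i * real (\<beta> $ i)) \<in> V" unfolding V_def using that by force
    then have "(\<Sum>i\<in>UNIV. v $ i * real (\<beta> $ i)) \<le> Max V" using V by simp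
    then have "L \<le> u $ i * \<alpha> $ i + Max V"
      using wt_le[of u v \<alpha> \<beta> k i] assms(1) L[OF that] by (simp add: w)
    then have "\<alpha> $ i \<le> (L - Max V) / u $ i" using u by (simp add: field_simps)
    then show ?thesis by linarith
  qed
  then have "(\<lambda>(\<alpha>, \<beta>, k). \<alpha> $ i) ` Supp P \<subseteq> {..nat \<lceil>(L - Max V) / u $ i\<rceil>}" by auto
  then show ?thesis by (rule finite_subset) simp
qed simp

lemma finite_weights:
  assumes "w \<in> W_loc" "P \<in> formal_ops" and fin: "\<And>i. i \<in> M_set w \<Longrightarrow> finite ((\<lambda>(\<alpha>, \<beta>, k). \<alpha> $ i) ` Supp P)"
  shows "finite (wt w ` Supp P)"
proof -
  obtain u v where w: "w = (u, v)" by (cases w)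
  define g where "g = (\<lambda>(f :: 'a \<Rightarrow> nat, \<beta> :: nat^'a, k :: nat). (\<Sum>i\<in>UNIV. u $ i * f i) + (\<Sum>i\<in>UNIV. v $ i * \<beta> $ i))"
  have "wt w ` Supp P \<subseteq> g ` (PiE UNIV (\<lambda>i. if i \<in> M_set w then (\<lambda>(\<alpha>, \<beta>, k). \<alpha> $ i) ` Supp P else {0}) \<times> snd ` Supp P)"
  proof clarify
    fix \<alpha> \<beta> k assume t: "(\<alpha>, \<beta>, k) \<in> Supp P"
    define f where "f = (\<lambda>i. if i \<in> M_set w then \<alpha> $ i else 0)"
    have "wt w (\<alpha>, \<beta>, k) = g (f, \<beta>, k)"
      using assms(1) by (auto simp: wt_def w g_def f_def M_set_def W_loc_def less_le intro!: sum.cong)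
    moreover have "f \<in> PiE UNIV (\<lambda>i. if i \<in> M_set w then (\<lambda>(\<alpha>, \<beta>, k). \<alpha> $ i) ` Supp P else {0})"
      using t by (force simp: f_def)
    moreover have "(\<beta>, k) \<in> snd ` Supp P" using t by force
    ultimately show "wt w (\<alpha>, \<beta>, k) \<in> g ` (PiE UNIV (\<lambda>i. if i \<in> M_set w then (\<lambda>(\<alpha>, \<beta>, k). \<alpha> $ i) ` Supp P else {0}) \<times> snd ` Supp P)"
      by blast
  qed
  moreover have "finite \<dots>"
    by (rule finite_imageI, rule finite_cartesian_product, rule finite_PiE)
       (use assms(2) in \<open>auto simp: formal_ops_def fin\<close>)
  ultimately show ?thesis by (rule finite_subset)
qed

lemma gr_carrier_iff:
  assumes "w \<in> W_loc" "carrier A \<subseteq> formal_ops"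
  shows "P \<in> carrier (gr w A) \<longleftrightarrow> P \<in> carrier A \<and> finite (wt w ` Supp P)"
proof
  assume "P \<in> carrier (gr w A)"
  then show "P \<in> carrier A \<and> finite (wt w ` Supp P)"
    using assms finite_weights[of w P] by (auto simp: gr_def hdo_ring_def)
next
  assume *: "P \<in> carrier A \<and> finite (wt w ` Supp P)"
  have "finite ((\<lambda>(\<alpha>, \<beta>, k). \<alpha> $ i) ` Supp P)" if "i \<in> M_set w" for i
    by (rule bounded_below_imp_finite[of w P i "Min (wt w ` Supp P)"]) (use * assms that in auto)
  with * show "P \<in> carrier (gr w A)" by (auto simp: gr_def hdo_ring_def)
qed

lemma ord_attained:
  assumes "w \<in> W_loc" "P \<in> formal_ops" "P \<noteq> (\<lambda>_. 0)"
  shows "\<exists>t\<in>Supp P. wt w t = ord_w w P" "\<And>t. t \<in> Supp P \<Longrightarrow> wt w t \<le> ord_w w P"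
proof -
  obtain t0 where t0: "t0 \<in> Supp P" using assms(3) unfolding Supp_def fun_eq_iff by blast
  define Q where "Q = (\<lambda>t. if wt w t0 \<le> wt w t then P t else 0)"
  have SQ: "Supp Q = {t \<in> Supp P. wt w t0 \<le> wt w t}" by (auto simp: Supp_def Q_def)
  have Q: "Q \<in> formal_ops" by (rule formal_ops_subset[OF assms(2)]) (auto simp: SQ)
  have "finite (wt w ` Supp Q)"
    using assms(1) Q
    by (rule finite_weights, rule_tac bounded_below_imp_finite[OF assms(1) Q, where L="wt w t0"]) (auto simp: SQ)
  then have "Max (wt w ` Supp Q) \<in> wt w ` Supp Q" and le: "\<And>t. t \<in> Supp Q \<Longrightarrow> wt w t \<le> Max (wt w ` Supp Q)"
    using t0 by (auto simp: SQ intro!: Max_in)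
  then obtain t1 where t1: "t1 \<in> Supp P" "wt w t0 \<le> wt w t1" "wt w t1 = Max (wt w ` Supp Q)" by (auto simp: SQ)
  have max: "wt w t \<le> wt w t1" if "t \<in> Supp P" for t
    using le[of t] that t1 by (cases "wt w t0 \<le> wt w t") (auto simp: SQ)
  then have "ord_w w P = wt w t1" unfolding ord_w_def using t1(1) by (intro cSup_eq_maximum) auto
  then show "\<exists>t\<in>Supp P. wt w t = ord_w w P" "\<And>t. t \<in> Supp P \<Longrightarrow> wt w t \<le> ord_w w P"
    using t1 max by auto
qed

lemma symb_eq_0_iff: "P \<in> filt A w m \<Longrightarrow> symb w m P = (\<lambda>_. 0) \<longleftrightarrow> P \<in> filt_less A w m"
  by (force simp: filt_def filt_less_def symb_def fun_eq_iff Supp_def less_le)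

lemma symb_id:
  assumes "w \<in> W_loc" "carrier A \<subseteq> formal_ops" "P \<in> carrier (gr w A)" "\<And>t. t \<in> Supp P \<Longrightarrow> wt w t = m"
  shows "P \<in> filt A w m" "symb w m P = P"
  using assms by (auto simp: filt_def symb_def gr_carrier_iff Supp_def fun_eq_iff)

lemma summable_on_restrict:
  fixes f :: "'a \<Rightarrow> complex"
  assumes "f summable_on UNIV"
  shows "(\<lambda>x. if x \<in> S then f x else 0) summable_on UNIV"
proof -
  have "f summable_on S" using assms summable_on_subset_banach by blast
  then show ?thesis by (rule summable_on_cong_neutral[THEN iffD1, rotated -1]) auto
qed

lemma convergent_series_restrict:
  assumes "convergent_series c"
  shows "convergent_series (\<lambda>\<alpha>. if \<alpha> \<in> S then c \<alpha> else 0)"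
proof -
  obtain r where r: "r > 0" "\<And>z :: complex^'a. (\<forall>i. norm (z $ i) < r) \<Longrightarrow>
     (\<lambda>\<alpha>. c \<alpha> * (\<Prod>i\<in>UNIV. (z $ i) ^ (\<alpha> $ i))) summable_on UNIV"
    using assms unfolding convergent_series_def by blast
  have "(\<lambda>\<alpha>. (if \<alpha> \<in> S then c \<alpha> else 0) * (\<Prod>i\<in>UNIV. (z $ i) ^ (\<alpha> $ i))) summable_on UNIV"
    if "\<forall>i. norm (z $ i) < r" for z :: "complex^'a"
    using summable_on_restrict[OF r(2)[OF that], of S] by (rule summable_on_cong[THEN iffD1, rotated]) auto
  then show ?thesis using r(1) unfolding convergent_series_def by blast
qed

lemma symb_in_gr:
  assumes "w \<in> W_loc"
  shows "P \<in> filt hD_formal w m \<Longrightarrow> symb w m P \<in> carrier (gr w hD_formal)"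
    and "Q \<in> filt hD_conv w m \<Longrightarrow> symb w m Q \<in> carrier (gr w hD_conv)"
proof -
  have fin: "finite (wt w ` Supp (symb w m R))" for R :: "('x::field, 'a) hdo"
    by (rule finite_subset[of _ "{m}"]) (auto simp: Supp_def symb_def)
  have formal: "symb w m R \<in> formal_ops" if "R \<in> formal_ops" for R :: "('x::field, 'a) hdo"
    by (rule formal_ops_subset[OF that]) (auto simp: Supp_def symb_def)
  show "symb w m P \<in> carrier (gr w hD_formal)" if "P \<in> filt hD_formal w m"
    using that formal fin assms by (subst gr_carrier_iff) (auto simp: filt_def hD_formal_def hdo_ring_def)
  show "symb w m Q \<in> carrier (gr w hD_conv)" if "Q \<in> filt hD_conv w m"
  proof -
    have Q: "Q \<in> formal_ops" "\<And>\<beta> k. convergent_series (\<lambda>\<alpha>. Q (\<alpha>, \<beta>, k))"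
      using that by (auto simp: filt_def hD_conv_def hdo_ring_def convergent_ops_def)
    have "convergent_series (\<lambda>\<alpha>. symb w m Q (\<alpha>, \<beta>, k))" for \<beta> k
      using convergent_series_restrict[OF Q(2)[of \<beta> k], of "{\<alpha>. wt w (\<alpha>, \<beta>, k) = m}"] by (simp add: symb_def)
    then have "symb w m Q \<in> convergent_ops" using formal[OF Q(1)] by (simp add: convergent_ops_def)
    then show ?thesis
      using fin assms by (subst gr_carrier_iff) (auto simp: hD_conv_def hdo_ring_def convergent_ops_def)
  qed
qed

lemma wt_contrib:
  assumes "(\<gamma>, t, t') \<in> contrib J s"
  shows "wt (u, v) t + wt (u, v) t' = wt (u, v) s + (\<Sum>i\<in>UNIV. (u $ i + v $ i) * \<gamma> $ i)"
proof -
  obtain a b c where s: "s = (a, b, c)" by (cases s)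
  obtain \<alpha> \<beta> k where t: "t = (\<alpha>, \<beta>, k)" by (cases t)
  obtain \<alpha>' \<beta>' k' where t': "t' = (\<alpha>', \<beta>', k')" by (cases t')
  have e: "\<alpha> + \<alpha>' = a + \<gamma>" "\<beta> + \<beta>' = b + \<gamma>" using assms by (auto simp: contrib_def s t t')
  have "real (\<alpha> $ i) + real (\<alpha>' $ i) = real (a $ i) + real (\<gamma> $ i)"
    "real (\<beta> $ i) + real (\<beta>' $ i) = real (b $ i) + real (\<gamma> $ i)" for i
    using arg_cong[OF e(1), of "\<lambda>x. real (x $ i)"] arg_cong[OF e(2), of "\<lambda>x. real (x $ i)"] by simp_all
  then have "u $ i * (real (\<alpha> $ i) + real (\<alpha>' $ i)) + v $ i * (real (\<beta> $ i) + real (\<beta>' $ i)) =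
      u $ i * (real (a $ i) + real (\<gamma> $ i)) + v $ i * (real (b $ i) + real (\<gamma> $ i))" for i
    by simp
  then have "(\<Sum>i\<in>UNIV. u $ i * (real (\<alpha> $ i) + real (\<alpha>' $ i)) + v $ i * (real (\<beta> $ i) + real (\<beta>' $ i))) =
      (\<Sum>i\<in>UNIV. u $ i * (real (a $ i) + real (\<gamma> $ i)) + v $ i * (real (b $ i) + real (\<gamma> $ i)))"
    by (intro sum.cong) auto
  then show ?thesis by (simp add: s t t' wt_def sum.distrib distrib_left distrib_right)
qed

lemma symb_mult:
  assumes w: "w \<in> W_loc" and P: "P \<in> filt A w m" and Q: "Q \<in> filt A w m'"
  shows "symb w (m + m') (hdo_mult UNIV P Q) = hdo_mult (- P_set w) (symb w m P) (symb w m' Q)"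
proof (rule ext)
  fix s
  obtain u v where uv: "w = (u, v)" by (cases w)
  have g0: "(u $ i + v $ i) * real (\<gamma> $ i) \<ge> 0" for \<gamma> :: "nat^'a" and i
    using w by (auto simp: W_loc_def uv)
  have Pw: "i \<in> P_set w \<longleftrightarrow> u $ i + v $ i \<noteq> 0" for i
  proof -
    have "u $ i + v $ i \<ge> 0" using w by (simp add: W_loc_def uv)
    then show ?thesis by (simp add: P_set_def uv less_le)
  qed
  have P': "P t \<noteq> 0 \<Longrightarrow> wt w t \<le> m" and Q': "Q t \<noteq> 0 \<Longrightarrow> wt w t \<le> m'" for t
    using P Q unfolding filt_def Supp_def by blast+
  have sub: "contrib (- P_set w) s \<subseteq> contrib UNIV s"
    by (cases s) (auto simp: contrib_def)
  have eqv: "(\<gamma>, t, t') \<in> contrib (- P_set w) s \<longleftrightarrow> wt w t + wt w t' = wt w s"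
    if c: "(\<gamma>, t, t') \<in> contrib UNIV s" for \<gamma> t t'
  proof -
    have "wt w t + wt w t' = wt w s \<longleftrightarrow> (\<Sum>i\<in>UNIV. (u $ i + v $ i) * \<gamma> $ i) = 0"
      using wt_contrib[OF c, of u v] by (simp add: uv)
    also have "\<dots> \<longleftrightarrow> (\<forall>i. (u $ i + v $ i) * \<gamma> $ i = 0)"
      using sum_nonneg_eq_0_iff[of UNIV "\<lambda>i. (u $ i + v $ i) * real (\<gamma> $ i)"] g0[of _ \<gamma>] by simp
    also have "\<dots> \<longleftrightarrow> (\<forall>i. i \<in> P_set w \<longrightarrow> \<gamma> $ i = 0)"
      using Pw by (metis mult_eq_0_iff of_nat_eq_0_iff)
    also have "\<dots> \<longleftrightarrow> (\<gamma>, t, t') \<in> contrib (- P_set w) s"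
      using c by (cases s) (auto simp: contrib_def)
    finally show ?thesis by simp
  qed
  have ge: "wt w s \<le> wt w t + wt w t'" if c: "(\<gamma>, t, t') \<in> contrib UNIV s" for \<gamma> t t'
    using wt_contrib[OF c, of u v] sum_nonneg[of UNIV "\<lambda>i. (u $ i + v $ i) * \<gamma> $ i"] g0 by (simp add: uv)
  show "symb w (m + m') (hdo_mult UNIV P Q) s = hdo_mult (- P_set w) (symb w m P) (symb w m' Q) s"
  proof (cases "wt w s = m + m'")
    case True
    have "hdo_mult UNIV P Q s = (\<Sum>z\<in>contrib UNIV s. case z of (\<gamma>, t, t') \<Rightarrow>
        of_nat (leibniz_coeff (fst (snd t)) (fst t') \<gamma>) * symb w m P t * symb w m' Q t')"
      unfolding hdo_mult_alt
    proof (rule sum.cong[OF refl], clarify)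
      fix \<gamma> \<alpha> \<beta> k \<alpha>' \<beta>' k'
      assume c: "(\<gamma>, (\<alpha>, \<beta>, k), (\<alpha>', \<beta>', k')) \<in> contrib UNIV s"
      show "of_nat (leibniz_coeff (fst (snd (\<alpha>, \<beta>, k))) (fst (\<alpha>', \<beta>', k')) \<gamma>) * P (\<alpha>, \<beta>, k) * Q (\<alpha>', \<beta>', k') =
        of_nat (leibniz_coeff (fst (snd (\<alpha>, \<beta>, k))) (fst (\<alpha>', \<beta>', k')) \<gamma>) * symb w m P (\<alpha>, \<beta>, k) * symb w m' Q (\<alpha>', \<beta>', k')"
      proof (cases "P (\<alpha>, \<beta>, k) = 0 \<or> Q (\<alpha>', \<beta>', k') = 0")
        case True
        then show ?thesis by (auto simp: symb_def)
      next
        case False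
        then have "wt w (\<alpha>, \<beta>, k) = m" "wt w (\<alpha>', \<beta>', k') = m'"
          using ge[OF c] \<open>wt w s = m + m'\<close> P'[of "(\<alpha>, \<beta>, k)"] Q'[of "(\<alpha>', \<beta>', k')"] by linarith+
        then show ?thesis by (simp add: symb_def)
      qed
    qed
    also have "\<dots> = hdo_mult (- P_set w) (symb w m P) (symb w m' Q) s"
      unfolding hdo_mult_alt
      by (rule sum.mono_neutral_right[OF finite_contrib sub])
         (clarify, use eqv True in \<open>force simp: symb_def split: if_splits\<close>)
    finally show ?thesis using True by (simp add: symb_def)
  next
    case False
    have "hdo_mult (- P_set w) (symb w m P) (symb w m' Q) s = 0"
    proof (rule ccontr)
      assume "hdo_mult (- P_set w) (symb w m P) (symb w m' Q) s \<noteq> 0"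
      then obtain \<gamma> t t' where *: "(\<gamma>, t, t') \<in> contrib (- P_set w) s" "symb w m P t \<noteq> 0" "symb w m' Q t' \<noteq> 0"
        by (rule hdo_mult_nz)
      then have "wt w t = m" "wt w t' = m'" by (auto simp: symb_def split: if_splits)
      moreover have "wt w t + wt w t' = wt w s" using eqv[of \<gamma> t t'] *(1) sub by blast
      ultimately show False using False by simp
    qed
    then show ?thesis using False by (simp add: symb_def)
  qed
qed

section \<open>The closed Groebner fan\<close>

definition same_graded :: "'n::finite weight \<Rightarrow> 'n weight set" where
  "same_graded w = {w' \<in> W_loc. M_set w' = M_set w \<and> P_set w' = P_set w}"

definition groebner_cone :: "('k::field, 'n::finite) hdo ring \<Rightarrow> ('k, 'n) hdo set \<Rightarrow> 'n weight \<Rightarrow> 'n weight set" where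
  "groebner_cone A I w = {w' \<in> same_graded w. initial_ideal A w I = initial_ideal A w' I}"

definition closed_groebner_fan :: "('k::field, 'n::finite) hdo ring \<Rightarrow> ('k, 'n) hdo set \<Rightarrow> 'n weight set set" where
  "closed_groebner_fan A I = (\<lambda>w. closure (groebner_cone A I w)) ` W_loc"

text \<open>The library counts the empty set as a face of every convex set; it is not a face of a cone here.\<close>

definition polyhedral_fan :: "'a::euclidean_space set set \<Rightarrow> bool" where
  "polyhedral_fan \<F> \<longleftrightarrow> finite \<F> \<and>
     (\<forall>C\<in>\<F>. polyhedron C \<and> convex_cone C) \<and>
     (\<forall>C\<in>\<F>. \<forall>F. F face_of C \<and> F \<noteq> {} \<longrightarrow> F \<in> \<F>) \<and>
     (\<forall>C\<in>\<F>. \<forall>D\<in>\<F>. C \<inter> D face_of C \<and> C \<inter> D face_of D)"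

definition rational_cone :: "'a::euclidean_space set \<Rightarrow> bool" where
  "rational_cone C \<longleftrightarrow>
     (\<exists>V. finite V \<and> (\<forall>v\<in>V. \<forall>b\<in>Basis. v \<bullet> b \<in> \<rat>) \<and> C = convex_cone hull V)"

definition rational_polyhedral_fan :: "'a::euclidean_space set set \<Rightarrow> bool" where
  "rational_polyhedral_fan \<F> \<longleftrightarrow> polyhedral_fan \<F> \<and> (\<forall>C\<in>\<F>. rational_cone C)"

end

theory Submission
  imports Defs
begin

text \<open>
  The fan is described by \<^emph>\<open>duality\<close>. An operator has infinite support in general, so that passing to a
  reduced standard basis of \<open>I\<close> is an infinite process. A functional on the coefficients with finite
  support, on the other hand, has a lowest monomial for every order. As \<open>I\<close> is homogeneous, it suffices to
  look at the spaces \<open>L\<^sub>d\<close> of functionals with finite support that live on the monomials of degree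
  \<open>|\<beta>| + k = d\<close> and annihilate \<open>I\<close>.

  Let \<open>R\<close> be an admissible order: compatible with multiplication, with \<open>x^\<gamma> < 1\<close> and \<open>h < x\<^sub>i \<partial>\<^sub>i\<close>.
  Gaussian elimination gives each \<open>L\<^sub>d\<close> a unique reduced basis \<open>l\<^sub>t\<close>, indexed by the monomials \<open>t\<close> that are
  lowest in some member of \<open>L\<^sub>d\<close>; put \<open>K\<^sub>R = {w. w(t) \<le> w(s) for all t and all s in the support of l\<^sub>t}\<close>.
  The monomials that are not lowest form an upward closed set, because they are the leading monomials of the
  operators that the functionals annihilate. By Dickson's lemma only finitely many such sets occur
  (\<open>finite_nonmins\<close>), the reduced basis depends on this set only, and finitely many of the inequalities that
  define \<open>K\<^sub>R\<close> imply the others (\<open>cone_of_finitely_many_inequalities\<close>). A weight \<open>w\<close> lies in \<open>K\<^sub>R\<close> for the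
  order \<open>R\<close> that compares by \<open>w\<close> first. So finitely many rational polyhedral cones \<open>K\<^sub>R\<close> cover the weights.

  If \<open>w\<close> lies in \<open>K\<^sub>R\<close>, the annihilator of \<open>in\<^sub>w(I)\<close> has as a basis the \<open>w\<close>-initial parts of the \<open>l\<^sub>t\<close>, which
  are determined by the equalities among the inequalities of \<open>K\<^sub>R\<close> at \<open>w\<close>. Conversely \<open>in\<^sub>w(I)\<close> is determined
  by its annihilator. Hence two weights with the same graded ring have the same initial ideal if and only if
  both lie in \<open>K\<^sub>R\<close> with the same equalities (\<open>initial_ideal_eq_iff\<close>). So the Groebner cone of \<open>w\<close> is the
  relatively open cell of \<open>w\<close> in \<open>K\<^sub>R\<close>, its closure is a face of \<open>K\<^sub>R\<close>, and the cones that arise in this way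
  form a rational fan by an argument about convex cones alone (\<open>rational_polyhedral_fan_of_cells\<close>).

  Passing between ideals and annihilators is more than linear algebra, as the spaces are infinite
  dimensional. Two facts about submodules over the power series ring are used: an element that is annihilated
  by all functionals annihilating a submodule lies in it (\<open>submod_closed_annihilator\<close>), and a functional that
  annihilates an intersection of two submodules is a sum of two functionals, one for each submodule
  (\<open>annihilator_of_intersection\<close>). Both follow from division by finitely many elements, with leading
  monomials taken for a generic real weight \<open>theta\<close>. In the convergent case the quotients converge, because for
  large \<open>\<sigma>\<close> the tails of the divisors are small in the norm \<open>\<Sum> |c\<^sub>t| exp (\<sigma> theta t)\<close>. The locale \<open>op_class\<close>
  collects what is needed of the coefficients, so that both cases are treated at once.
\<close>


section \<open>Cells of linear inequalities form a fan\<close>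

definition ineq_cone :: "'a::euclidean_space set \<Rightarrow> 'a set" where
  "ineq_cone A = {x. \<forall>a\<in>A. 0 \<le> a \<bullet> x}"

definition ineq_cell :: "'a::euclidean_space set \<Rightarrow> 'a \<Rightarrow> 'a set" where
  "ineq_cell A w = {x \<in> ineq_cone A. \<forall>a\<in>A. a \<bullet> x = 0 \<longleftrightarrow> a \<bullet> w = 0}"

definition ineq_face :: "'a::euclidean_space set \<Rightarrow> 'a \<Rightarrow> 'a set" where
  "ineq_face A w = {x \<in> ineq_cone A. \<forall>a\<in>A. a \<bullet> w = 0 \<longrightarrow> a \<bullet> x = 0}"

definition rational_vec :: "'a::euclidean_space \<Rightarrow> bool" where
  "rational_vec v \<longleftrightarrow> (\<forall>b\<in>Basis. v \<bullet> b \<in> \<rat>)"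

lemma ineq_cone_Inter: "ineq_cone A = \<Inter>((\<lambda>a. {x. a \<bullet> x \<ge> 0}) ` A)"
  by (auto simp: ineq_cone_def)

lemma polyhedron_ineq_cone: "finite A \<Longrightarrow> polyhedron (ineq_cone A)"
  unfolding ineq_cone_Inter by (rule polyhedron_Inter) (auto simp: polyhedron_halfspace_ge)

lemma convex_cone_ineq_cone: "convex_cone (ineq_cone A)"
  unfolding ineq_cone_Inter by (rule convex_cone_Inter) (auto simp: convex_cone_halfspace_ge)

lemma ineq_face_eq_ineq_cone:
  "ineq_face A w = ineq_cone (A \<union> uminus ` {a\<in>A. a \<bullet> w = 0})"
  unfolding ineq_face_def ineq_cone_def by (auto intro!: antisym simp: ball_Un)

lemma polyhedron_ineq_face: "finite A \<Longrightarrow> polyhedron (ineq_face A w)"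
  unfolding ineq_face_eq_ineq_cone by (rule polyhedron_ineq_cone) auto

lemma convex_cone_ineq_face: "convex_cone (ineq_face A w)"
  unfolding ineq_face_eq_ineq_cone by (rule convex_cone_ineq_cone)

lemma self_in_ineq_face: "w \<in> ineq_cone A \<Longrightarrow> w \<in> ineq_face A w"
  by (simp add: ineq_face_def)

text \<open>
  A point \<open>x\<close> of the face is the limit of the points \<open>x + w / n\<close>, which lie in the cell.
\<close>

lemma closure_ineq_cell:
  assumes "w \<in> ineq_cone A"
  shows "closure (ineq_cell A w) = ineq_face A w"
proof
  have "closed (ineq_face A w)"
    unfolding ineq_face_eq_ineq_cone ineq_cone_Inter by (intro closed_INT ballI closed_halfspace_ge)
  moreover have "ineq_cell A w \<subseteq> ineq_face A w"
    by (auto simp: ineq_cell_def ineq_face_def)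
  ultimately show "closure (ineq_cell A w) \<subseteq> ineq_face A w"
    by (simp add: closure_minimal)
next
  show "ineq_face A w \<subseteq> closure (ineq_cell A w)"
  proof
    fix x assume x: "x \<in> ineq_face A w"
    define f where "f = (\<lambda>n. x + (1 / real (Suc n)) *\<^sub>R w)"
    have "f n \<in> ineq_cell A w" for n
    proof -
      have eq: "a \<bullet> f n = a \<bullet> x + (a \<bullet> w) / real (Suc n)" for a
        by (simp add: f_def inner_add_right)
      have "0 \<le> a \<bullet> f n \<and> (a \<bullet> f n = 0 \<longleftrightarrow> a \<bullet> w = 0)" if "a \<in> A" for a
      proof -
        have p: "0 \<le> a \<bullet> x" "0 \<le> a \<bullet> w" "a \<bullet> w = 0 \<longrightarrow> a \<bullet> x = 0"
          using x assms that by (auto simp: ineq_face_def ineq_cone_def)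
        have q: "0 \<le> (a \<bullet> w) / real (Suc n)" using p by simp
        have r: "(a \<bullet> w) / real (Suc n) = 0 \<longleftrightarrow> a \<bullet> w = 0" by simp
        show ?thesis unfolding eq using p q r by linarith
      qed
      then show ?thesis by (simp add: ineq_cell_def ineq_cone_def)
    qed
    moreover have "f \<longlonglongrightarrow> x + 0 *\<^sub>R w"
      unfolding f_def by (intro tendsto_intros LIMSEQ_Suc lim_1_over_n)
    ultimately show "x \<in> closure (ineq_cell A w)"
      unfolding closure_sequential by auto
  qed
qed

lemma ineq_face_face_of:
  assumes "w \<in> ineq_cone A"
  shows "ineq_face A w face_of ineq_cone A"
  unfolding face_of_def
proof (intro conjI ballI impI)
  show "ineq_face A w \<subseteq> ineq_cone A" by (auto simp: ineq_face_def)
  show "convex (ineq_face A w)"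
    using convex_cone_ineq_face[of A w] by (simp add: convex_cone_def)
next
  fix x y z assume x: "x \<in> ineq_cone A" and y: "y \<in> ineq_cone A" and z: "z \<in> ineq_face A w"
    and "z \<in> open_segment x y"
  then obtain t where t: "z = (1 - t) *\<^sub>R x + t *\<^sub>R y" "0 < t" "t < 1"
    by (auto simp: in_segment)
  have *: "a \<bullet> x = 0 \<and> a \<bullet> y = 0" if "a \<in> A" "a \<bullet> w = 0" for a
  proof -
    have "(1 - t) * (a \<bullet> x) + t * (a \<bullet> y) = 0"
      using z that by (simp add: ineq_face_def t inner_add_right)
    moreover have "0 \<le> (1 - t) * (a \<bullet> x)" "0 \<le> t * (a \<bullet> y)"
      using x y that t by (auto simp: ineq_cone_def)
    ultimately have "(1 - t) * (a \<bullet> x) = 0" "t * (a \<bullet> y) = 0" by linarith+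
    then show ?thesis using t by simp
  qed
  show "x \<in> ineq_face A w" "y \<in> ineq_face A w"
    using * x y by (auto simp: ineq_face_def)
qed

lemma ineq_face_mono:
  assumes "x \<in> ineq_face A w"
  shows "ineq_face A x \<subseteq> ineq_face A w"
  using assms by (auto simp: ineq_face_def)

text \<open>
  Inequalities that are strict at \<open>x\<close> survive a small step away from \<open>y\<close>, and those that are equalities at \<open>x\<close>
  are equalities at \<open>y\<close> too. So \<open>x\<close> lies in the relative interior of its face.
\<close>

lemma point_beyond_in_ineq_cone:
  assumes "finite A" and x: "x \<in> ineq_cone A" and y: "y \<in> ineq_face A x"
  obtains e where "0 < e" "x - e *\<^sub>R (y - x) \<in> ineq_cone A"
proof -
  have "\<exists>e>0. \<forall>a\<in>A. 0 \<le> a \<bullet> (x - e *\<^sub>R (y - x))"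
    using assms(1) x y
  proof (induction A rule: finite_induct)
    case empty
    show ?case by (intro exI[of _ 1]) auto
  next
    case (insert a A)
    then obtain e where e: "e > 0" "\<forall>b\<in>A. 0 \<le> b \<bullet> (x - e *\<^sub>R (y - x))"
      by (auto simp: ineq_cone_def ineq_face_def)
    have a: "0 \<le> a \<bullet> x" "0 \<le> a \<bullet> y" "a \<bullet> x = 0 \<longrightarrow> a \<bullet> y = 0"
      using insert.prems by (auto simp: ineq_cone_def ineq_face_def)
    obtain e' where e': "0 < e'" "0 \<le> a \<bullet> (x - e' *\<^sub>R (y - x))"
    proof (cases "a \<bullet> x = 0")
      case True then show ?thesis using a by (intro that[of 1]) (auto simp: inner_diff_right)
    next
      case False
      then have ax: "a \<bullet> x > 0" using a by simp
      let ?e = "(a \<bullet> x) / (1 + a \<bullet> y)"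
      have "?e * (a \<bullet> y) \<le> a \<bullet> x" using a ax by (simp add: field_simps)
      moreover have "0 \<le> ?e * (a \<bullet> x)" using a ax by simp
      moreover have "a \<bullet> (x - ?e *\<^sub>R (y - x)) = a \<bullet> x - ?e * (a \<bullet> y) + ?e * (a \<bullet> x)"
        unfolding inner_diff_right inner_scaleR_right by (simp only: right_diff_distrib)
      ultimately have "0 \<le> a \<bullet> (x - ?e *\<^sub>R (y - x))" by linarith
      moreover have "0 < ?e" using a ax by simp
      ultimately show ?thesis using that by blast
    qed
    have "0 \<le> b \<bullet> (x - min e e' *\<^sub>R (y - x))" if "0 \<le> b \<bullet> x" "0 \<le> b \<bullet> (x - c *\<^sub>R (y - x))" "min e e' \<le> c" for b c
    proof (cases "b \<bullet> (y - x) \<ge> 0")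
      case True
      then have "min e e' * (b \<bullet> (y - x)) \<le> c * (b \<bullet> (y - x))" using that by (intro mult_right_mono) auto
      then show ?thesis using that by (simp add: inner_diff_right)
    next
      case False
      then have "min e e' * (b \<bullet> (y - x)) \<le> 0" using e e' by (simp add: mult_le_0_iff)
      then show ?thesis using that by (simp add: inner_diff_right)
    qed
    then have "\<forall>b\<in>insert a A. 0 \<le> b \<bullet> (x - min e e' *\<^sub>R (y - x))"
      using e e' insert.prems(1) by (auto simp: ineq_cone_def)
    then show ?case using e e' by (intro exI[of _ "min e e'"]) auto
  qed
  then show ?thesis using that by (auto simp: ineq_cone_def)
qed

text \<open>
  A face that contains \<open>x\<close> in its relative interior is the smallest face containing \<open>x\<close>. For the inclusion of
  \<open>ineq_face A x\<close>, the segment from one of its points \<open>y\<close> to \<open>x\<close> is prolonged a little beyond \<open>x\<close>.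
\<close>

lemma ineq_face_eqI:
  assumes "finite A" "G face_of ineq_cone A" "x \<in> rel_interior G"
  shows "G = ineq_face A x"
proof
  have xG: "x \<in> G" using assms(3) rel_interior_subset by blast
  then have x: "x \<in> ineq_cone A" using assms(2) face_of_imp_subset by blast
  show "G \<subseteq> ineq_face A x"
    by (rule subset_of_face_of[OF ineq_face_face_of[OF x] face_of_imp_subset[OF assms(2)]])
       (use self_in_ineq_face[OF x] assms(3) in blast)
  show "ineq_face A x \<subseteq> G"
  proof
    fix y assume y: "y \<in> ineq_face A x"
    obtain e where e: "0 < e" "x - e *\<^sub>R (y - x) \<in> ineq_cone A"
      using point_beyond_in_ineq_cone[OF assms(1) x y] .
    show "y \<in> G"
    proof (cases "y = x")
      case False
      define z where "z = x - e *\<^sub>R (y - x)"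
      have zy: "(1 + e) *\<^sub>R x = z + e *\<^sub>R y" by (simp add: z_def algebra_simps)
      have "x = (1 - e / (1 + e)) *\<^sub>R z + (e / (1 + e)) *\<^sub>R y"
      proof -
        have "(1 / (1 + e)) *\<^sub>R ((1 + e) *\<^sub>R x) = (1 / (1 + e)) *\<^sub>R (z + e *\<^sub>R y)" using zy by simp
        moreover have "1 / (1 + e) = 1 - e / (1 + e)" using e(1) by (simp add: field_simps)
        ultimately have "(1 / (1 + e)) *\<^sub>R ((1 + e) *\<^sub>R x) =
          (1 - e / (1 + e)) *\<^sub>R z + ((1 / (1 + e)) * e) *\<^sub>R y"
          by (simp only: scaleR_add_right scaleR_scaleR)
        then show ?thesis using e(1) by simp
      qed
      moreover have "z \<noteq> y"
      proof
        assume "z = y"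
        then have "(1 + e) *\<^sub>R x = (1 + e) *\<^sub>R y" using zy by (simp add: scaleR_add_left)
        then show False using e False by simp
      qed
      ultimately have "x \<in> open_segment z y"
        using e(1) by (auto simp: in_segment intro!: exI[of _ "e / (1 + e)"])
      then show ?thesis
        using face_ofD[OF assms(2) _ _ _ xG, of z y] e(2) y by (auto simp: z_def ineq_face_def)
    qed (use xG in simp)
  qed
qed

lemma ineq_cone_Un: "ineq_cone (A \<union> B) = ineq_cone A \<inter> ineq_cone B"
  by (auto simp: ineq_cone_def)

lemma ineq_cell_sym: "w \<in> ineq_cone A \<Longrightarrow> w' \<in> ineq_cell A w \<Longrightarrow> w \<in> ineq_cell A w'"
  by (auto simp: ineq_cell_def)

text \<open>
  A linear form that is nonnegative on the cone and vanishes at one point of a cell vanishes on the whole cell: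
  it would be negative slightly beyond \<open>w\<close>. This transfers equalities for infinitely many valid inequalities from
  finitely many defining ones.
\<close>

lemma ineq_cell_zero:
  assumes A: "finite A" and w: "w \<in> ineq_cone A" and w': "w' \<in> ineq_cell A w"
    and a: "\<And>x. x \<in> ineq_cone A \<Longrightarrow> 0 \<le> a \<bullet> x" and "a \<bullet> w = 0"
  shows "a \<bullet> w' = 0"
proof -
  have w'': "w' \<in> ineq_face A w" using w' by (auto simp: ineq_cell_def ineq_face_def)
  obtain e where e: "0 < e" "w - e *\<^sub>R (w' - w) \<in> ineq_cone A"
    by (rule point_beyond_in_ineq_cone[OF A w w''])
  have "0 \<le> a \<bullet> (w - e *\<^sub>R (w' - w))" by (rule a[OF e(2)])
  then have "e * (a \<bullet> w') \<le> 0" using \<open>a \<bullet> w = 0\<close> by (simp add: inner_diff_right)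
  then have "a \<bullet> w' \<le> 0" using e(1) by (simp add: mult_le_0_iff)
  moreover have "0 \<le> a \<bullet> w'" using a w' by (simp add: ineq_cell_def)
  ultimately show ?thesis by simp
qed

lemma rational_vec_simps:
  "rational_vec 0" "rational_vec x \<Longrightarrow> rational_vec (- x)"
  "rational_vec x \<Longrightarrow> rational_vec y \<Longrightarrow> rational_vec (x - y)"
  "c \<in> \<rat> \<Longrightarrow> rational_vec x \<Longrightarrow> rational_vec (c *\<^sub>R x)"
  by (auto simp: rational_vec_def inner_diff_left)

lemma Basis_rational_vec: "b \<in> Basis \<Longrightarrow> rational_vec b"
  by (auto simp: rational_vec_def inner_Basis)

lemma rational_vec_Pair: "rational_vec (x, y) \<longleftrightarrow> rational_vec x \<and> rational_vec y"
  by (simp add: rational_vec_def Basis_prod_def ball_Un)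

lemma rational_vec_inner: "rational_vec x \<Longrightarrow> rational_vec y \<Longrightarrow> x \<bullet> y \<in> \<rat>"
  unfolding rational_vec_def by (subst euclidean_inner) (intro Rats_sum Rats_mult, auto)

lemma convex_cone_sum:
  assumes "convex_cone S" "finite F" "\<And>v. v \<in> F \<Longrightarrow> 0 \<le> c v \<and> f v \<in> S"
  shows "(\<Sum>v\<in>F. c v *\<^sub>R f v) \<in> S"
  using assms(2,3)
  by (induction F rule: finite_induct)
     (auto simp: convex_cone_contains_0 convex_cone_add convex_cone_scaleR assms(1))

lemma convex_cone_hull_finite:
  assumes "finite V" "x \<in> convex_cone hull V"
  obtains c where "\<And>v. v \<in> V \<Longrightarrow> 0 \<le> c v" "x = (\<Sum>v\<in>V. c v *\<^sub>R v)"
proof -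
  let ?S = "{x. \<exists>c. (\<forall>v\<in>V. 0 \<le> c v) \<and> x = (\<Sum>v\<in>V. c v *\<^sub>R v)}"
  have "V \<subseteq> ?S"
  proof
    fix v assume v: "v \<in> V"
    have "(\<Sum>u\<in>V. (if u = v then 1 else 0) *\<^sub>R u) = (\<Sum>u\<in>V. if u = v then v else 0)"
      by (rule sum.cong) auto
    also have "\<dots> = v" using v assms(1) by simp
    finally show "v \<in> ?S" by (intro CollectI exI[of _ "\<lambda>u. if u = v then 1 else 0"]) auto
  qed
  moreover have "convex_cone ?S"
    unfolding convex_cone_iff
  proof (intro conjI ballI allI impI)
    fix x y assume "x \<in> ?S" "y \<in> ?S"
    then obtain c d where "(\<forall>v\<in>V. 0 \<le> c v) \<and> x = (\<Sum>v\<in>V. c v *\<^sub>R v)" "(\<forall>v\<in>V. 0 \<le> d v) \<and> y = (\<Sum>v\<in>V. d v *\<^sub>R v)"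
      by blast
    then show "x + y \<in> ?S"
      by (intro CollectI exI[of _ "\<lambda>v. c v + d v"]) (auto simp: scaleR_add_left sum.distrib)
  next
    fix x and r :: real assume "x \<in> ?S" "0 \<le> r"
    then obtain c where "(\<forall>v\<in>V. 0 \<le> c v) \<and> x = (\<Sum>v\<in>V. c v *\<^sub>R v)" by blast
    then show "r *\<^sub>R x \<in> ?S" using \<open>0 \<le> r\<close>
      by (intro CollectI exI[of _ "\<lambda>v. r * c v"]) (auto simp: scaleR_sum_right)
  qed (auto intro: exI[of _ "\<lambda>_. 0"])
  ultimately have "convex_cone hull V \<subseteq> ?S" by (rule hull_minimal)
  then show ?thesis using assms(2) that by blast
qed

text \<open>
  One step of the double description method: up to positive factors, the new generators are the points in which
  the segments between generators on different sides meet the hyperplane. They are rational if \<open>a\<close> and \<open>V\<close> are.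
\<close>

lemma convex_cone_hull_Int_halfspace:
  fixes a :: "'a::euclidean_space"
  assumes "finite V"
  defines "V' \<equiv> {v\<in>V. 0 \<le> a \<bullet> v} \<union> (\<lambda>(p, q). (a \<bullet> p) *\<^sub>R q - (a \<bullet> q) *\<^sub>R p) ` ({p\<in>V. 0 < a \<bullet> p} \<times> {q\<in>V. a \<bullet> q < 0})"
  shows "convex_cone hull V \<inter> {x. 0 \<le> a \<bullet> x} = convex_cone hull V'"
proof
  have "V' \<subseteq> convex_cone hull V \<inter> {x. 0 \<le> a \<bullet> x}"
  proof -
    have "(a \<bullet> p) *\<^sub>R q - (a \<bullet> q) *\<^sub>R p \<in> convex_cone hull V" if "p \<in> V" "q \<in> V" "0 < a \<bullet> p" "a \<bullet> q < 0" for p q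
    proof -
      have "(a \<bullet> p) *\<^sub>R q + (- (a \<bullet> q)) *\<^sub>R p \<in> convex_cone hull V"
        using that by (intro convex_cone_hull_add convex_cone_hull_mul hull_inc) auto
      then show ?thesis by simp
    qed
    then show ?thesis unfolding V'_def by (auto simp: hull_inc inner_diff_right)
  qed
  moreover have "convex_cone (convex_cone hull V \<inter> {x. 0 \<le> a \<bullet> x})"
    using convex_cone_Inter[of "{convex_cone hull V, {x. 0 \<le> a \<bullet> x}}"]
      convex_cone_convex_cone_hull convex_cone_halfspace_ge[of a] by auto
  ultimately show "convex_cone hull V' \<subseteq> convex_cone hull V \<inter> {x. 0 \<le> a \<bullet> x}"
    by (rule hull_minimal)
next
  show "convex_cone hull V \<inter> {x. 0 \<le> a \<bullet> x} \<subseteq> convex_cone hull V'"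
  proof
    fix x assume x: "x \<in> convex_cone hull V \<inter> {x. 0 \<le> a \<bullet> x}"
    then obtain c where c: "\<And>v. v \<in> V \<Longrightarrow> 0 \<le> c v" and xc: "x = (\<Sum>v\<in>V. c v *\<^sub>R v)"
      using convex_cone_hull_finite[OF assms(1)] by blast
    define Z P Q where "Z = {v\<in>V. a \<bullet> v = 0}" and "P = {v\<in>V. 0 < a \<bullet> v}" and "Q = {v\<in>V. a \<bullet> v < 0}"
    have V: "V = Z \<union> (P \<union> Q)" "Z \<inter> (P \<union> Q) = {}" "P \<inter> Q = {}" "finite Z" "finite P" "finite Q"
      using assms(1) by (auto simp: Z_def P_def Q_def)
    have split: "(\<Sum>v\<in>V. f v) = (\<Sum>v\<in>Z. f v) + ((\<Sum>v\<in>P. f v) + (\<Sum>v\<in>Q. f v))" for f :: "'a \<Rightarrow> 'b::comm_monoid_add"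
      unfolding V(1) using V by (subst sum.union_disjoint, simp, simp, simp, subst sum.union_disjoint) auto
    define p q where "p = (\<Sum>v\<in>P. c v * (a \<bullet> v))" and "q = (\<Sum>v\<in>Q. c v * - (a \<bullet> v))"
    have p0: "0 \<le> p" and q0: "0 \<le> q"
      unfolding p_def q_def using c by (auto simp: P_def Q_def intro!: sum_nonneg mult_nonneg_nonpos)
    have "a \<bullet> x = p - q"
      unfolding xc inner_sum_right split[of "\<lambda>v. a \<bullet> c v *\<^sub>R v"] p_def q_def by (simp add: Z_def sum_negf)
    then have pq: "q \<le> p" using x by simp
    have hull: "convex_cone (convex_cone hull V')" by (rule convex_cone_convex_cone_hull)
    have inP: "v \<in> convex_cone hull V'" if "v \<in> Z \<union> P" for v
      using that by (intro hull_inc) (auto simp: V'_def Z_def P_def)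
    have mZ: "(\<Sum>v\<in>Z. c v *\<^sub>R v) \<in> convex_cone hull V'"
      using inP c V by (intro convex_cone_sum[OF hull]) auto
    show "x \<in> convex_cone hull V'"
    proof (cases "p = 0")
      case True
      then have "q = 0" using pq q0 by simp
      have "c v = 0" if "v \<in> Q" for v
      proof -
        have "0 \<le> c u * - (a \<bullet> u)" if "u \<in> Q" for u
          using that c[of u] by (intro mult_nonneg_nonneg) (auto simp: Q_def)
        then have "c v * - (a \<bullet> v) = 0"
          using sum_nonneg_0[OF V(6) _ \<open>q = 0\<close>[unfolded q_def] that] by blast
        then show ?thesis using that by (simp add: Q_def)
      qed
      then have "x = (\<Sum>v\<in>Z. c v *\<^sub>R v) + (\<Sum>v\<in>P. c v *\<^sub>R v)" unfolding xc split by simp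
      then show ?thesis using mZ inP c V
        by (auto intro!: convex_cone_add[OF hull] convex_cone_sum[OF hull])
    next
      case False
      then have p: "p > 0" using p0 by simp
      \<comment> \<open>the mixed generators absorb all of \<open>Q\<close> and the fraction \<open>q / p\<close> of \<open>P\<close>, and \<open>q \<le> p\<close>\<close>
      have mix: "(\<Sum>u\<in>P. \<Sum>v\<in>Q. (c u * c v / p) *\<^sub>R ((a \<bullet> u) *\<^sub>R v - (a \<bullet> v) *\<^sub>R u)) =
        (\<Sum>v\<in>Q. c v *\<^sub>R v) + (\<Sum>u\<in>P. (c u * (q / p)) *\<^sub>R u)"
      proof -
        have "(\<Sum>u\<in>P. \<Sum>v\<in>Q. (c u * c v / p) *\<^sub>R ((a \<bullet> u) *\<^sub>R v - (a \<bullet> v) *\<^sub>R u)) =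
          (\<Sum>u\<in>P. \<Sum>v\<in>Q. (c u * (a \<bullet> u) * (c v / p)) *\<^sub>R v) + (\<Sum>u\<in>P. \<Sum>v\<in>Q. (c v * - (a \<bullet> v) * (c u / p)) *\<^sub>R u)"
          by (simp add: sum.distrib[symmetric] scaleR_diff_right mult_ac)
        also have "(\<Sum>u\<in>P. \<Sum>v\<in>Q. (c u * (a \<bullet> u) * (c v / p)) *\<^sub>R v) = (\<Sum>v\<in>Q. (p * (c v / p)) *\<^sub>R v)"
          by (subst sum.swap) (simp only: p_def sum_distrib_right scaleR_sum_left)
        also have "(\<Sum>u\<in>P. \<Sum>v\<in>Q. (c v * - (a \<bullet> v) * (c u / p)) *\<^sub>R u) = (\<Sum>u\<in>P. (q * (c u / p)) *\<^sub>R u)"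
          by (simp only: q_def sum_distrib_right scaleR_sum_left)
        finally show ?thesis using p by (simp add: mult_ac)
      qed
      have "x = (\<Sum>v\<in>Z. c v *\<^sub>R v) + ((\<Sum>u\<in>P. (c u * (1 - q / p)) *\<^sub>R u) +
          (\<Sum>u\<in>P. \<Sum>v\<in>Q. (c u * c v / p) *\<^sub>R ((a \<bullet> u) *\<^sub>R v - (a \<bullet> v) *\<^sub>R u)))"
        unfolding xc split mix
        by (simp add: right_diff_distrib scaleR_diff_left sum_subtractf)
      moreover have "(\<Sum>u\<in>P. (c u * (1 - q / p)) *\<^sub>R u) \<in> convex_cone hull V'"
      proof (rule convex_cone_sum[OF hull V(5)])
        fix u assume u: "u \<in> P"
        then have "0 \<le> c u" using c by (simp add: P_def)
        moreover have "q / p \<le> 1" using pq p by simp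
        ultimately show "0 \<le> c u * (1 - q / p) \<and> u \<in> convex_cone hull V'"
          using inP u by simp
      qed
      moreover have "(\<Sum>u\<in>P. 1 *\<^sub>R (\<Sum>v\<in>Q. (c u * c v / p) *\<^sub>R ((a \<bullet> u) *\<^sub>R v - (a \<bullet> v) *\<^sub>R u))) \<in> convex_cone hull V'"
      proof (intro convex_cone_sum[OF hull] conjI)
        fix u v assume "u \<in> P" "v \<in> Q"
        then show "0 \<le> c u * c v / p" "(a \<bullet> u) *\<^sub>R v - (a \<bullet> v) *\<^sub>R u \<in> convex_cone hull V'"
          using c p by (auto simp: P_def Q_def V'_def intro!: hull_inc)
      qed (use V in auto)
      ultimately show ?thesis using mZ by (auto intro!: convex_cone_add[OF hull])
    qed
  qed
qed

lemma rational_cone_ineq_cone: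
  assumes "finite A" "\<And>a. a \<in> A \<Longrightarrow> rational_vec a"
  shows "rational_cone (ineq_cone A)"
proof -
  have "\<exists>V. finite V \<and> (\<forall>v\<in>V. rational_vec v) \<and> ineq_cone A = convex_cone hull V"
    using assms
  proof (induction A rule: finite_induct)
    case empty
    let ?V = "Basis \<union> uminus ` Basis :: 'a set"
    have "x \<in> convex_cone hull ?V" for x :: 'a
    proof -
      have "(\<Sum>b\<in>Basis. \<bar>x \<bullet> b\<bar> *\<^sub>R (if x \<bullet> b \<ge> 0 then b else - b)) \<in> convex_cone hull ?V"
        by (rule convex_cone_sum[OF convex_cone_convex_cone_hull]) (auto intro: hull_inc)
      also have "(\<Sum>b\<in>Basis. \<bar>x \<bullet> b\<bar> *\<^sub>R (if x \<bullet> b \<ge> 0 then b else - b)) = (\<Sum>b\<in>Basis. (x \<bullet> b) *\<^sub>R b)"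
        by (rule sum.cong) auto
      finally show ?thesis by (simp add: euclidean_representation)
    qed
    then have "ineq_cone {} = convex_cone hull ?V" by (auto simp: ineq_cone_def)
    then show ?case by (intro exI[of _ ?V]) (auto simp: rational_vec_simps Basis_rational_vec)
  next
    case (insert a A)
    then obtain V where V: "finite V" "\<forall>v\<in>V. rational_vec v" "ineq_cone A = convex_cone hull V" by auto
    let ?V' = "{v\<in>V. 0 \<le> a \<bullet> v} \<union> (\<lambda>(p, q). (a \<bullet> p) *\<^sub>R q - (a \<bullet> q) *\<^sub>R p) ` ({p\<in>V. 0 < a \<bullet> p} \<times> {q\<in>V. a \<bullet> q < 0})"
    have "ineq_cone (insert a A) = convex_cone hull V \<inter> {x. 0 \<le> a \<bullet> x}"
      using V(3) by (auto simp: ineq_cone_def)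
    also have "\<dots> = convex_cone hull ?V'" by (rule convex_cone_hull_Int_halfspace[OF V(1)])
    finally show ?case
    proof (intro exI[of _ ?V'] conjI)
      show "finite ?V'" using V(1) by simp
      show "\<forall>v\<in>?V'. rational_vec v"
        using V(2) insert.prems by (auto intro!: rational_vec_simps rational_vec_inner)
    qed
  qed
  then show ?thesis by (auto simp: rational_cone_def rational_vec_def)
qed

lemma rational_cone_ineq_face:
  assumes "finite A" "\<And>a. a \<in> A \<Longrightarrow> rational_vec a"
  shows "rational_cone (ineq_face A w)"
  unfolding ineq_face_eq_ineq_cone
  using assms by (intro rational_cone_ineq_cone) (auto simp: rational_vec_simps)

text \<open>
  The closure of a class is a face of one of the cones. Every face of this kind is the closure of the class of any
  point in its relative interior. If \<open>x\<close> is a relative interior point of an intersection \<open>C \<inter> D\<close> with \<open>C\<close> and \<open>D\<close>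
  coming from different cones \<open>A\<close> and \<open>B\<close>, then the faces of the two cones spanned by \<open>x\<close> agree, since both are
  the closure of the class of \<open>x\<close>; this is what glues the cones although they may overlap.
\<close>

theorem rational_polyhedral_fan_of_cells:
  fixes cell :: "'a::euclidean_space \<Rightarrow> 'a set"
  assumes fin: "finite \<A>" "\<And>A. A \<in> \<A> \<Longrightarrow> finite A"
    and rat: "\<And>A a. A \<in> \<A> \<Longrightarrow> a \<in> A \<Longrightarrow> rational_vec a"
    and sub: "\<And>A. A \<in> \<A> \<Longrightarrow> ineq_cone A \<subseteq> W"
    and cov: "\<And>w. w \<in> W \<Longrightarrow> \<exists>A\<in>\<A>. w \<in> ineq_cone A"
    and cell: "\<And>A w. A \<in> \<A> \<Longrightarrow> w \<in> ineq_cone A \<Longrightarrow> cell w = ineq_cell A w"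
  shows "rational_polyhedral_fan ((\<lambda>w. closure (cell w)) ` W)" (is "rational_polyhedral_fan ?F")
proof -
  have cl: "closure (cell w) = ineq_face A w" if "A \<in> \<A>" "w \<in> ineq_cone A" for A w
    using closure_ineq_cell[OF that(2)] cell[OF that] by simp
  have mem: "\<exists>A\<in>\<A>. \<exists>w\<in>ineq_cone A. C = ineq_face A w" if C: "C \<in> ?F" for C
  proof -
    obtain w where w: "w \<in> W" "C = closure (cell w)" using C by auto
    obtain A where "A \<in> \<A>" "w \<in> ineq_cone A" using cov[OF w(1)] by blast
    then show ?thesis using cl w(2) by blast
  qed
  have memI: "ineq_face A w \<in> ?F" if "A \<in> \<A>" "w \<in> ineq_cone A" for A w
    using cl[OF that] sub[OF that(1)] that(2) by (auto intro!: image_eqI[of _ _ w])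
  have sub_cone: "ineq_face A w \<subseteq> ineq_cone A" for A and w :: 'a by (auto simp: ineq_face_def)
  have "finite ?F"
  proof (rule finite_subset)
    show "?F \<subseteq> (\<Union>A\<in>\<A>. (\<lambda>B. {x \<in> ineq_cone A. \<forall>b\<in>B. b \<bullet> x = 0}) ` Pow A)"
    proof
      fix C assume "C \<in> ?F"
      then obtain A w where A: "A \<in> \<A>" "C = ineq_face A w" using mem by blast
      have "C = {x \<in> ineq_cone A. \<forall>b\<in>{a\<in>A. a \<bullet> w = 0}. b \<bullet> x = 0}" by (auto simp: A ineq_face_def)
      then show "C \<in> (\<Union>A\<in>\<A>. (\<lambda>B. {x \<in> ineq_cone A. \<forall>b\<in>B. b \<bullet> x = 0}) ` Pow A)"
        using A(1) by blast
    qed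
  qed (use fin in auto)
  moreover have "polyhedron C \<and> convex_cone C \<and> rational_cone C" if C: "C \<in> ?F" for C
  proof -
    obtain A w where A: "A \<in> \<A>" "C = ineq_face A w" using mem[OF C] by blast
    show ?thesis
      unfolding A(2) using fin(2)[OF A(1)] rat[OF A(1)]
      by (intro conjI polyhedron_ineq_face convex_cone_ineq_face rational_cone_ineq_face)
  qed
  moreover have "G \<in> ?F" if C: "C \<in> ?F" and G: "G face_of C" "G \<noteq> {}" for C G
  proof -
    obtain A w where A: "A \<in> \<A>" "w \<in> ineq_cone A" "C = ineq_face A w" using mem[OF C] by blast
    have face: "G face_of ineq_cone A" using face_of_trans[OF G(1)] ineq_face_face_of[OF A(2)] A(3) by blast
    obtain x where x: "x \<in> rel_interior G"
      using G rel_interior_eq_empty[of G] face_of_imp_convex by fastforce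
    have "x \<in> ineq_cone A" using x rel_interior_subset face_of_imp_subset[OF face] by blast
    then show ?thesis using ineq_face_eqI[OF fin(2)[OF A(1)] face x] memI[OF A(1)] by simp
  qed
  moreover have "C \<inter> D face_of C \<and> C \<inter> D face_of D" if C: "C \<in> ?F" and D: "D \<in> ?F" for C D
  proof -
    obtain A w where A: "A \<in> \<A>" "w \<in> ineq_cone A" "C = ineq_face A w" using mem[OF C] by blast
    obtain B v where B: "B \<in> \<A>" "v \<in> ineq_cone B" "D = ineq_face B v" using mem[OF D] by blast
    have "convex_cone (C \<inter> D)"
      unfolding A B using convex_cone_Inter[of "{ineq_face A w, ineq_face B v}"] convex_cone_ineq_face by auto
    then obtain x where x: "x \<in> rel_interior (C \<inter> D)"
      using rel_interior_eq_empty[of "C \<inter> D"] unfolding convex_cone_def by blast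
    then have xC: "x \<in> C" "x \<in> D" using rel_interior_subset by blast+
    then have xA: "x \<in> ineq_cone A" "x \<in> ineq_cone B" using A(3) B(3) sub_cone by blast+
    have eq: "ineq_face A x = ineq_face B x"
      using cl[OF A(1) xA(1)] cl[OF B(1) xA(2)] by simp
    have subC: "ineq_face A x \<subseteq> C" and subD: "ineq_face A x \<subseteq> D"
      using ineq_face_mono[of x A w] ineq_face_mono[of x B v] xC A(3) B(3) eq by auto
    have fC: "ineq_face A x face_of C"
      by (rule face_of_subset[OF ineq_face_face_of[OF xA(1)] subC]) (use A sub_cone in auto)
    have fD: "ineq_face A x face_of D"
      by (rule face_of_subset[OF ineq_face_face_of[OF xA(2), folded eq] subD]) (use B sub_cone in auto)
    have "C \<inter> D \<subseteq> ineq_face A x"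
      using x self_in_ineq_face[OF xA(1)] by (intro subset_of_face_of[OF fC]) auto
    then have "C \<inter> D = ineq_face A x" using subC subD by blast
    then show ?thesis using fC fD by simp
  qed
  ultimately show ?thesis
    unfolding rational_polyhedral_fan_def polyhedral_fan_def
    by (intro conjI ballI allI impI) simp_all
qed

section \<open>Linear algebra\<close>

definition fun_subspace :: "('a \<Rightarrow> 'k::field) set \<Rightarrow> bool" where
  "fun_subspace S \<longleftrightarrow> (\<lambda>_. 0) \<in> S \<and> (\<forall>x\<in>S. \<forall>y\<in>S. (\<lambda>t. x t + y t) \<in> S) \<and> (\<forall>c. \<forall>x\<in>S. (\<lambda>t. c * x t) \<in> S)"

lemma fun_subspaceD:
  assumes "fun_subspace S"
  shows "(\<lambda>_. 0) \<in> S" "x \<in> S \<Longrightarrow> y \<in> S \<Longrightarrow> (\<lambda>t. x t + y t) \<in> S" "x \<in> S \<Longrightarrow> (\<lambda>t. c * x t) \<in> S"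
    "x \<in> S \<Longrightarrow> y \<in> S \<Longrightarrow> (\<lambda>t. x t - c * y t) \<in> S"
proof -
  show *: "(\<lambda>_. 0) \<in> S" "x \<in> S \<Longrightarrow> y \<in> S \<Longrightarrow> (\<lambda>t. x t + y t) \<in> S" "x \<in> S \<Longrightarrow> (\<lambda>t. c * x t) \<in> S" for x y c
    using assms by (auto simp: fun_subspace_def)
  show "x \<in> S \<Longrightarrow> y \<in> S \<Longrightarrow> (\<lambda>t. x t - c * y t) \<in> S"
    using *(2)[of x "\<lambda>t. (- c) * y t"] *(3)[of y "- c"] by simp
qed

lemma fun_subspace_sum:
  assumes "fun_subspace S" "finite A" "\<And>a. a \<in> A \<Longrightarrow> f a \<in> S"
  shows "(\<lambda>t. \<Sum>a\<in>A. f a t) \<in> S"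
  using assms(2,3) by (induction A rule: finite_induct) (auto simp: fun_subspaceD[OF assms(1)])

lemma fun_subspace_slice: "fun_subspace S \<Longrightarrow> fun_subspace {s \<in> S. s t = 0}"
  by (auto simp: fun_subspace_def)

lemma fun_subspace_Int: "fun_subspace S \<Longrightarrow> fun_subspace T \<Longrightarrow> fun_subspace (S \<inter> T)"
  by (auto simp: fun_subspace_def)

lemma fun_subspace_support: "fun_subspace {P :: 'a \<Rightarrow> 'k::field. \<forall>t. P t \<noteq> 0 \<longrightarrow> Q t}"
  unfolding fun_subspace_def
proof (intro conjI ballI allI)
  fix x y :: "'a \<Rightarrow> 'k" assume "x \<in> {P. \<forall>t. P t \<noteq> 0 \<longrightarrow> Q t}" "y \<in> {P. \<forall>t. P t \<noteq> 0 \<longrightarrow> Q t}"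
  then have "Q t" if "x t + y t \<noteq> 0" for t using that by (cases "x t = 0") auto
  then show "(\<lambda>t. x t + y t) \<in> {P. \<forall>t. P t \<noteq> 0 \<longrightarrow> Q t}" by blast
qed auto

text \<open>
  Restricted to the finite set \<open>F\<close>, the subspace is the common kernel of the functionals that annihilate it. The
  induction eliminates one coordinate at a time with a member of \<open>S\<close> normalised there.
\<close>

lemma agree_on_finite_of_annihilator:
  assumes "finite F" "fun_subspace S"
    and "\<And>\<phi>. (\<And>s. s \<in> S \<Longrightarrow> (\<Sum>t\<in>F. \<phi> t * s t) = 0) \<Longrightarrow> (\<Sum>t\<in>F. \<phi> t * p t) = 0"
  shows "\<exists>s\<in>S. \<forall>t\<in>F. s t = (p t :: 'k::field)"
  using assms
proof (induction F arbitrary: S p rule: finite_induct)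
  case empty
  then show ?case using fun_subspaceD(1) by blast
next
  case (insert u F)
  have ext: "(\<Sum>t\<in>insert u F. (if t = u then c else \<phi> t) * s t) = c * s u + (\<Sum>t\<in>F. \<phi> t * s t)" for c \<phi> and s :: "'a \<Rightarrow> 'k"
    using insert.hyps by (subst sum.insert) (auto intro!: sum.cong)
  show ?case
  proof (cases "\<forall>s\<in>S. s u = 0")
    case True
    have "p u = 0"
      using insert.prems(2)[of "\<lambda>t. if t = u then 1 else 0"] True unfolding ext by simp
    moreover have "\<exists>s\<in>S. \<forall>t\<in>F. s t = p t"
    proof (rule insert.IH[OF insert.prems(1)])
      fix \<phi> assume "\<And>s. s \<in> S \<Longrightarrow> (\<Sum>t\<in>F. \<phi> t * s t) = 0"
      then show "(\<Sum>t\<in>F. \<phi> t * p t) = 0"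
        using insert.prems(2)[of "\<lambda>t. if t = u then 0 else \<phi> t"] unfolding ext by simp
    qed
    ultimately show ?thesis using True by auto
  next
    case False
    then obtain s0 where s0: "s0 \<in> S" "s0 u \<noteq> 0" by blast
    define s1 where "s1 = (\<lambda>t. inverse (s0 u) * s0 t)"
    have s1: "s1 \<in> S" "s1 u = 1"
      using fun_subspaceD(3)[OF insert.prems(1) s0(1)] s0(2) by (auto simp: s1_def)
    have "\<exists>s\<in>{s \<in> S. s u = 0}. \<forall>t\<in>F. s t = p t - p u * s1 t"
    proof (rule insert.IH[OF fun_subspace_slice[OF insert.prems(1)]])
      fix \<phi> assume \<phi>: "\<And>s. s \<in> {s \<in> S. s u = 0} \<Longrightarrow> (\<Sum>t\<in>F. \<phi> t * s t) = 0"
      define c where "c = - (\<Sum>t\<in>F. \<phi> t * s1 t)"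
      have "(\<Sum>t\<in>insert u F. (if t = u then c else \<phi> t) * p t) = 0"
      proof (rule insert.prems(2), unfold ext)
        fix s assume s: "s \<in> S"
        have "(\<Sum>t\<in>F. \<phi> t * (s t - s u * s1 t)) = 0"
          using \<phi>[of "\<lambda>t. s t - s u * s1 t"] fun_subspaceD(4)[OF insert.prems(1) s s1(1)] s1(2) by simp
        then show "c * s u + (\<Sum>t\<in>F. \<phi> t * s t) = 0"
          by (simp add: c_def algebra_simps sum_subtractf sum_distrib_left)
      qed
      then show "(\<Sum>t\<in>F. \<phi> t * (p t - p u * s1 t)) = 0"
        unfolding ext by (simp add: c_def algebra_simps sum_subtractf sum_distrib_left)
    qed
    then obtain s where s: "s \<in> S" "s u = 0" "\<forall>t\<in>F. s t = p t - p u * s1 t" by blast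
    have "(\<lambda>t. s t - (- p u) * s1 t) \<in> S" by (rule fun_subspaceD(4)[OF insert.prems(1) s(1) s1(1)])
    then show ?thesis by (rule bexI[rotated]) (use s s1 in auto)
  qed
qed

text \<open>
  A functional on an infinite-dimensional \<open>S\<close> that depends on finitely many coordinates only is given by
  coefficients at these.
\<close>

lemma functional_of_finite_support:
  assumes "finite F" "fun_subspace S"
    and "\<And>x y. x \<in> S \<Longrightarrow> y \<in> S \<Longrightarrow> \<phi> (\<lambda>t. x t + y t) = \<phi> x + \<phi> y"
    and "\<And>c x. x \<in> S \<Longrightarrow> \<phi> (\<lambda>t. c * x t) = c * \<phi> x"
    and "\<And>x. x \<in> S \<Longrightarrow> (\<forall>t\<in>F. x t = 0) \<Longrightarrow> \<phi> x = 0"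
  shows "\<exists>\<psi>. \<forall>x\<in>S. \<phi> x = (\<Sum>t\<in>F. \<psi> t * (x t :: 'k::field))"
  using assms
proof (induction F arbitrary: S rule: finite_induct)
  case empty
  then show ?case by simp
next
  case (insert u F)
  let ?S0 = "{s \<in> S. s u = 0}"
  have "\<exists>\<psi>. \<forall>x\<in>?S0. \<phi> x = (\<Sum>t\<in>F. \<psi> t * x t)"
    by (rule insert.IH[OF fun_subspace_slice[OF insert.prems(1)]]) (use insert.prems in auto)
  then obtain \<psi> where \<psi>: "\<And>x. x \<in> S \<Longrightarrow> x u = 0 \<Longrightarrow> \<phi> x = (\<Sum>t\<in>F. \<psi> t * x t)" by blast
  have ext: "(\<Sum>t\<in>insert u F. (if t = u then c else \<psi> t) * s t) = c * s u + (\<Sum>t\<in>F. \<psi> t * s t)" for c and s :: "'a \<Rightarrow> 'k"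
    using insert.hyps by (subst sum.insert) (auto intro!: sum.cong)
  show ?case
  proof (cases "\<forall>s\<in>S. s u = 0")
    case True
    then show ?thesis
      by (intro exI[of _ "\<lambda>t. if t = u then 0 else \<psi> t"]) (simp only: ext, auto simp: \<psi>)
  next
    case False
    then obtain s0 where s0: "s0 \<in> S" "s0 u \<noteq> 0" by blast
    define s1 where "s1 = (\<lambda>t. inverse (s0 u) * s0 t)"
    have s1: "s1 \<in> S" "s1 u = 1"
      using fun_subspaceD(3)[OF insert.prems(1) s0(1)] s0(2) by (auto simp: s1_def)
    define c where "c = \<phi> s1 - (\<Sum>t\<in>F. \<psi> t * s1 t)"
    have "\<phi> x = c * x u + (\<Sum>t\<in>F. \<psi> t * x t)" if x: "x \<in> S" for x
    proof -
      have sub: "(\<lambda>t. x t - x u * s1 t) \<in> S" by (rule fun_subspaceD(4)[OF insert.prems(1) x s1(1)])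
      have m: "(\<lambda>t. x u * s1 t) \<in> S" by (rule fun_subspaceD(3)[OF insert.prems(1) s1(1)])
      have "\<phi> x = \<phi> (\<lambda>t. (x t - x u * s1 t) + x u * s1 t)" by simp
      also have "\<dots> = \<phi> (\<lambda>t. x t - x u * s1 t) + x u * \<phi> s1"
        using insert.prems(2)[OF sub m] insert.prems(3)[OF s1(1)] by simp
      also have "\<phi> (\<lambda>t. x t - x u * s1 t) = (\<Sum>t\<in>F. \<psi> t * (x t - x u * s1 t))"
        using \<psi>[OF sub] s1(2) by simp
      finally show ?thesis by (simp add: c_def algebra_simps sum_subtractf sum_distrib_left)
    qed
    then show ?thesis
      by (intro exI[of _ "\<lambda>t. if t = u then c else \<psi> t"]) (simp only: ext, auto)
  qed
qed

section \<open>Dickson's lemma\<close>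

lemma nat_seq_mono_subseq: "\<exists>f :: nat \<Rightarrow> nat. strict_mono f \<and> mono (\<lambda>i. (s :: nat \<Rightarrow> nat) (f i))"
proof -
  obtain f where f: "strict_mono f" "monoseq (\<lambda>n. s (f n))" using seq_monosub[of s] by blast
  show ?thesis
  proof (cases "mono (\<lambda>i. s (f i))")
    case False
    then have dec: "\<And>m n. m \<le> n \<Longrightarrow> s (f n) \<le> s (f m)" using f(2) by (auto simp: monoseq_def mono_def)
    obtain N where N: "\<And>n. s (f N) \<le> s (f n)"
      using ex_has_least_nat[of "\<lambda>_. True" 0 "\<lambda>n. s (f n)"] by auto
    have "s (f (N + i)) = s (f N)" for i using dec[of N "N + i"] N[of "N + i"] by simp
    then have "mono (\<lambda>i. s (f (N + i)))" by (simp add: mono_def)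
    moreover have "strict_mono (\<lambda>i. f (N + i))" using f(1) by (simp add: strict_mono_def)
    ultimately show ?thesis by blast
  qed (use f in blast)
qed

lemma coordinates_mono_subseq:
  assumes "finite I"
  shows "\<exists>f :: nat \<Rightarrow> nat. strict_mono f \<and> (\<forall>c\<in>I. mono (\<lambda>i. (c :: 'a \<Rightarrow> nat) (X (f i :: nat))))"
  using assms
proof (induction I rule: finite_induct)
  case empty
  show ?case by (intro exI[of _ id]) (auto simp: strict_mono_def)
next
  case (insert c I)
  then obtain f :: "nat \<Rightarrow> nat" where f: "strict_mono f" "\<forall>c\<in>I. mono (\<lambda>i. c (X (f i)))" by blast
  obtain g :: "nat \<Rightarrow> nat" where g: "strict_mono g" "mono (\<lambda>i. c (X (f (g i))))"
    using nat_seq_mono_subseq[of "\<lambda>i. c (X (f i))"] by blast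
  have "mono (\<lambda>i. c' (X (f (g i))))" if "c' \<in> I" for c'
    using f(2) that strict_mono_mono[OF g(1)] by (auto simp: mono_def)
  then show ?case
    using g f(1) by (intro exI[of _ "\<lambda>i. f (g i)"]) (auto simp: strict_mono_def)
qed

lemma dickson_mon:
  fixes X :: "nat \<Rightarrow> 'n::finite mon"
  shows "\<exists>i j r. i < j \<and> X j = X i + r"
proof -
  define I where "I = range (\<lambda>i t. fst (t :: 'n mon) $ i) \<union> range (\<lambda>i t. fst (snd (t :: 'n mon)) $ i) \<union> {\<lambda>t. snd (snd t)}"
  have "finite I" by (simp add: I_def)
  then obtain f :: "nat \<Rightarrow> nat" where f: "strict_mono f" "\<forall>c\<in>I. mono (\<lambda>i. c (X (f i)))"
    using coordinates_mono_subseq by blast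
  obtain a b k where 0: "X (f 0) = (a, b, k)" by (cases "X (f 0)")
  obtain a' b' k' where 1: "X (f (Suc 0)) = (a', b', k')" by (cases "X (f (Suc 0))")
  have le: "c (X (f 0)) \<le> c (X (f (Suc 0)))" if "c \<in> I" for c
    using f(2) that by (auto simp: mono_def)
  have "a $ i \<le> a' $ i" "b $ i \<le> b' $ i" for i
    using le[of "\<lambda>t. fst t $ i"] le[of "\<lambda>t. fst (snd t) $ i"] by (auto simp: I_def 0 1)
  moreover have "k \<le> k'" using le[of "\<lambda>t. snd (snd t)"] by (auto simp: I_def 0 1)
  ultimately have "X (f (Suc 0)) = X (f 0) + (a' - a, b' - b, k' - k)"
    by (simp add: 0 1 vec_eq_iff)
  moreover have "f 0 < f (Suc 0)" using f(1) by (simp add: strict_mono_def)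
  ultimately show ?thesis by blast
qed

text \<open>
  Otherwise one could forever pick an element that is not above any of the elements picked before.
\<close>

lemma finite_basis_of_good_sequences:
  assumes good: "\<And>X :: nat \<Rightarrow> 'a. (\<And>i. X i \<in> S) \<Longrightarrow> \<exists>i j. i < j \<and> Q (X i) (X j)"
  shows "\<exists>B. finite B \<and> B \<subseteq> S \<and> (\<forall>x\<in>S. \<exists>b\<in>B. Q b x)"
proof (rule ccontr)
  assume contr: "\<not> ?thesis"
  define pick where "pick B = (SOME x. x \<in> S \<and> (\<forall>b\<in>B. \<not> Q b x))" for B
  have pick: "pick B \<in> S \<and> (\<forall>b\<in>B. \<not> Q b (pick B))" if "finite B" "B \<subseteq> S" for B
  proof -
    have "\<not> (\<forall>x\<in>S. \<exists>b\<in>B. Q b x)" using contr that by (metis (no_types))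
    then have "\<exists>x. x \<in> S \<and> (\<forall>b\<in>B. \<not> Q b x)" by blast
    then show ?thesis unfolding pick_def by (rule someI_ex)
  qed
  define Bs where "Bs = rec_nat {} (\<lambda>_ B. insert (pick B) B)"
  have Bs: "Bs 0 = {}" "Bs (Suc n) = insert (pick (Bs n)) (Bs n)" for n by (simp_all add: Bs_def)
  have fin: "finite (Bs n) \<and> Bs n \<subseteq> S" for n by (induction n) (auto simp: Bs pick)
  have mono: "pick (Bs i) \<in> Bs j" if "i < j" for i j
    using that by (induction j) (auto simp: Bs less_Suc_eq)
  obtain i j where "i < j" "Q (pick (Bs i)) (pick (Bs j))"
    using good[of "\<lambda>n. pick (Bs n)"] pick fin by blast
  then show False using pick[of "Bs j"] fin[of j] mono by blast
qed

section \<open>Degrees\<close>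

definition mdeg :: "'n::finite mon \<Rightarrow> nat" where
  "mdeg = (\<lambda>(\<alpha>, \<beta>, k). msize \<beta> + k)"

definition xmon :: "nat^'n::finite \<Rightarrow> 'n mon" where
  "xmon \<gamma> = (\<gamma>, 0, 0)"

lemma xmon_0 [simp]: "xmon 0 = 0" by (simp add: xmon_def zero_prod_def)

lemma xmon_eq_iff [simp]: "xmon \<gamma> = xmon \<delta> \<longleftrightarrow> \<gamma> = \<delta>" by (simp add: xmon_def)

lemma mdeg_add [simp]: "mdeg (s + t) = mdeg s + mdeg t"
  by (cases s; cases t) (simp add: mdeg_def msize_add)

lemma mdeg_xmon [simp]: "mdeg (xmon \<gamma>) = 0" by (simp add: mdeg_def xmon_def)

lemma mon_add_cancel [simp]: "s + t = s + r \<longleftrightarrow> t = r" for s t r :: "'n::finite mon"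
  by (cases s; cases t; cases r) (auto simp: vec_eq_iff)

lemma msize_eq_0_iff [simp]: "msize \<beta> = 0 \<longleftrightarrow> \<beta> = 0"
  by (auto simp: msize_def vec_eq_iff)

lemma mdeg_eq_0_iff: "mdeg r = 0 \<longleftrightarrow> (\<exists>\<gamma>. r = xmon \<gamma>)"
  by (cases r) (auto simp: mdeg_def xmon_def)

lemma finite_mdeg_slices: "finite (snd ` {t :: 'n::finite mon. mdeg t = d})"
proof (rule finite_subset)
  show "snd ` {t :: 'n mon. mdeg t = d} \<subseteq> {\<beta>. \<forall>i. \<beta> $ i \<le> d} \<times> {..d}"
  proof
    fix z assume "z \<in> snd ` {t :: 'n mon. mdeg t = d}"
    then obtain \<alpha> \<beta> k where z: "z = (\<beta>, k)" "mdeg (\<alpha>, \<beta>, k) = d" by auto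
    then have "\<forall>i. \<beta> $ i \<le> d \<and> k \<le> d"
      using msize_ge[of \<beta>] by (auto simp: mdeg_def intro: trans_le_add1)
    then show "z \<in> {\<beta>. \<forall>i. \<beta> $ i \<le> d} \<times> {..d}" by (auto simp: z)
  qed
qed (simp add: finite_vec_le)

lemma dickson_xmon:
  assumes "S \<subseteq> {t :: 'n::finite mon. mdeg t = d}"
  shows "\<exists>B. finite B \<and> B \<subseteq> S \<and> (\<forall>s\<in>S. \<exists>b\<in>B. \<exists>\<gamma>. s = b + xmon \<gamma>)"
proof (rule finite_basis_of_good_sequences)
  fix X :: "nat \<Rightarrow> 'n mon" assume X: "\<And>i. X i \<in> S"
  obtain i j r where ij: "i < j" "X j = X i + r" using dickson_mon by blast
  have "mdeg (X i) = d" "mdeg (X j) = d" using X assms by blast+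
  then have "mdeg r = 0" using ij(2) by simp
  then obtain \<gamma> where "r = xmon \<gamma>" unfolding mdeg_eq_0_iff by (elim exE)
  then have "i < j \<and> (\<exists>\<gamma>. X j = X i + xmon \<gamma>)" using ij by (intro conjI exI[of _ \<gamma>]) simp_all
  then show "\<exists>i j. i < j \<and> (\<exists>\<gamma>. X j = X i + xmon \<gamma>)" by (intro exI)
qed

section \<open>A generic weight\<close>

text \<open>
  The weight \<open>m \<cdot> \<beta> - l \<cdot> \<alpha>\<close> of \<open>x^\<alpha> \<partial>^\<beta> h^k\<close> is to be generic, to decrease under multiplication by \<open>x\<^sub>i\<close> and to be
  larger on \<open>x\<^sub>i \<partial>\<^sub>i\<close> than on \<open>h\<close>.
\<close>

definition generic_weights :: "('n::finite \<Rightarrow> real) \<Rightarrow> ('n \<Rightarrow> real) \<Rightarrow> bool" where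
  "generic_weights l m \<longleftrightarrow> (\<forall>i. 0 < l i \<and> l i < m i) \<and>
     inj (\<lambda>(\<alpha> :: nat^'n, \<beta> :: nat^'n). (\<Sum>i\<in>UNIV. m i * real (\<beta> $ i)) - (\<Sum>i\<in>UNIV. l i * real (\<alpha> $ i)))"

text \<open>
  Logarithms of distinct primes are linearly independent over the rationals by unique factorisation.
\<close>

lemma generic_weights_exist: "\<exists>l m. generic_weights l (m :: 'n::finite \<Rightarrow> real)"
proof -
  define P where "P = {p :: nat. prime p}"
  have P: "infinite P" by (simp add: P_def primes_infinite)
  obtain idx :: "'n \<Rightarrow> nat" where idx: "inj idx"
    using finite_imp_inj_to_nat_seg[of "UNIV :: 'n set"] by auto
  define r where "r = (\<lambda>(i, b). enumerate P (2 * idx i + (if b then 1 else 0)))"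
  have r: "prime (r ib)" for ib using enumerate_in_set[OF P] by (auto simp: r_def P_def split: prod.splits)
  have r_inj: "inj r"
  proof (rule injI)
    fix ib jc :: "'n \<times> bool" assume eq: "r ib = r jc"
    obtain i b j c where ij: "ib = (i, b)" "jc = (j, c)" by fastforce
    have "2 * idx i + (if b then 1 else 0) = 2 * idx j + (if c then 1 else (0::nat))"
      using eq strict_mono_enumerate[OF P] by (simp add: r_def ij strict_mono_eq)
    then have "idx i = idx j \<and> b = c" by (auto split: if_splits) presburger+
    then show "ib = jc" using idx by (simp add: ij inj_eq)
  qed
  define l :: "'n \<Rightarrow> real" where "l = (\<lambda>i. ln (real (r (i, False))))"
  define m :: "'n \<Rightarrow> real" where "m = (\<lambda>i. ln (real (r (i, True))))"
  have pos: "0 < l i \<and> l i < m i" for i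
  proof -
    have "r (i, False) < r (i, True)"
      using enumerate_mono[OF _ P, of "2 * idx i" "2 * idx i + 1"] by (simp add: r_def)
    moreover have "1 < r (i, False)" using r prime_gt_1_nat by blast
    ultimately show ?thesis by (simp add: l_def m_def)
  qed
  have lnprod: "ln (real (\<Prod>ib\<in>UNIV. r ib ^ e ib)) = (\<Sum>i\<in>UNIV. l i * e (i, False)) + (\<Sum>i\<in>UNIV. m i * e (i, True))" for e
  proof -
    have "ln (real (\<Prod>ib\<in>UNIV. r ib ^ e ib)) = (\<Sum>ib\<in>UNIV. ln (real (r ib)) * real (e ib))"
      unfolding of_nat_prod
      by (subst ln_prod) (auto simp: ln_realpow prime_gt_0_nat[OF r] mult.commute)
    also have "\<dots> = (\<Sum>i\<in>UNIV. \<Sum>b\<in>UNIV. ln (real (r (i, b))) * real (e (i, b)))"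
      by (subst sum.cartesian_product) (rule sum.cong, auto)
    finally show ?thesis by (simp add: UNIV_bool l_def m_def sum.distrib)
  qed
  have exps: "e ib = e' ib" if eq: "(\<Prod>ib\<in>UNIV. r ib ^ e ib) = (\<Prod>ib\<in>UNIV. r ib ^ e' ib)" for e e' ib
  proof -
    have "multiplicity (r ib) (\<Prod>ib\<in>UNIV. r ib ^ e ib) = e ib" for e
    proof -
      have "(\<Prod>ib\<in>UNIV. r ib ^ e ib) = (\<Prod>p\<in>range r. p ^ e (inv_into UNIV r p))"
        by (subst prod.reindex[OF r_inj]) (simp add: inv_f_f[OF r_inj])
      moreover have "multiplicity (r ib) (\<Prod>p\<in>range r. p ^ e (inv_into UNIV r p)) = e ib"
        using r by (subst multiplicity_prod_prime_powers) (auto simp: inv_f_f[OF r_inj])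
      ultimately show ?thesis by simp
    qed
    then show ?thesis using eq by metis
  qed
  have "\<alpha> = \<alpha>' \<and> \<beta> = \<beta>'" if eq: "(\<Sum>i\<in>UNIV. m i * \<beta> $ i) - (\<Sum>i\<in>UNIV. l i * \<alpha> $ i) =
        (\<Sum>i\<in>UNIV. m i * \<beta>' $ i) - (\<Sum>i\<in>UNIV. l i * \<alpha>' $ i)" for \<alpha> \<beta> \<alpha>' \<beta>' :: "nat^'n"
  proof -
    \<comment> \<open>negative terms change sides, so that both sides become logarithms of natural numbers\<close>
    define e e' where "e = (\<lambda>(i, b). if b then \<beta> $ i else \<alpha>' $ i)" and "e' = (\<lambda>(i, b). if b then \<beta>' $ i else \<alpha> $ i)"
    have "ln (real (\<Prod>ib\<in>UNIV. r ib ^ e ib)) = ln (real (\<Prod>ib\<in>UNIV. r ib ^ e' ib))"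
      unfolding lnprod using eq by (simp add: e_def e'_def)
    moreover have pos: "0 < (\<Prod>ib\<in>UNIV. r ib ^ e ib)" for e
      using prime_gt_0_nat[OF r] by (intro prod_pos) auto
    ultimately have "(\<Prod>ib\<in>UNIV. r ib ^ e ib) = (\<Prod>ib\<in>UNIV. r ib ^ e' ib)"
      by (subst (asm) ln_inj_iff) (simp_all only: of_nat_0_less_iff of_nat_eq_iff)
    note * = exps[OF this]
    have "\<beta> $ i = \<beta>' $ i" "\<alpha> $ i = \<alpha>' $ i" for i
      using *[of "(i, True)"] *[of "(i, False)"] by (simp_all add: e_def e'_def)
    then show ?thesis by (simp add: vec_eq_iff)
  qed
  then show ?thesis
    using pos by (intro exI[of _ l] exI[of _ m]) (auto simp: generic_weights_def inj_def)
qed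

definition lam_mu :: "('n::finite \<Rightarrow> real) \<times> ('n \<Rightarrow> real)" where
  "lam_mu = (SOME lm. generic_weights (fst lm) (snd lm))"

definition theta :: "'n::finite mon \<Rightarrow> real" where
  "theta = (\<lambda>(\<alpha>, \<beta>, k). (\<Sum>i\<in>UNIV. snd lam_mu i * real (\<beta> $ i)) - (\<Sum>i\<in>UNIV. fst lam_mu i * real (\<alpha> $ i)))"

lemma generic_lam_mu: "generic_weights (fst lam_mu) (snd (lam_mu :: ('n::finite \<Rightarrow> real) \<times> _))"
  unfolding lam_mu_def
proof (rule someI_ex)
  obtain l m :: "'n \<Rightarrow> real" where "generic_weights l m" using generic_weights_exist by blast
  then show "\<exists>lm :: ('n \<Rightarrow> real) \<times> _. generic_weights (fst lm) (snd lm)"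
    by (intro exI[of _ "(l, m)"]) simp
qed

lemma lam_mu:
  fixes \<alpha> \<beta> :: "nat^'n::finite" and i :: 'n
  shows "0 < fst lam_mu i" "fst lam_mu i < snd lam_mu i"
    "theta (\<alpha>, \<beta>, k) = theta (\<alpha>', \<beta>', k') \<Longrightarrow> \<alpha> = \<alpha>' \<and> \<beta> = \<beta>'"
  using generic_lam_mu[where 'n='n] unfolding generic_weights_def theta_def
  by (auto dest!: injD[where x="(\<alpha>, \<beta>)" and y="(\<alpha>', \<beta>')"])

lemma theta_add: "theta (s + t) = theta s + theta t"
  by (cases s; cases t) (simp add: theta_def distrib_left sum.distrib)

lemma theta_xmon: "theta (xmon \<gamma>) = - (\<Sum>i\<in>UNIV. fst lam_mu i * real (\<gamma> $ i))"
  by (simp add: theta_def xmon_def)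

lemma theta_xmon_nonpos: "theta (xmon \<gamma>) \<le> 0"
  unfolding theta_xmon by (simp add: sum_nonneg less_imp_le lam_mu(1))

lemma theta_xmon_neg:
  assumes "\<gamma> \<noteq> 0"
  shows "theta (xmon \<gamma>) < 0"
proof -
  obtain i where "\<gamma> $ i \<noteq> 0" using assms by (auto simp: vec_eq_iff)
  then have "0 < (\<Sum>i\<in>UNIV. fst lam_mu i * real (\<gamma> $ i))"
    by (intro sum_pos2[of _ i]) (auto simp: less_imp_le lam_mu(1))
  then show ?thesis by (simp add: theta_xmon)
qed

lemma theta_inj: "mdeg s = mdeg t \<Longrightarrow> theta s = theta t \<Longrightarrow> s = t"
  by (cases s; cases t) (auto simp: mdeg_def dest!: lam_mu(3))

lemma theta_slice_le: "theta (\<alpha>, \<beta>, k) \<le> theta (0, \<beta>, k)"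
  using theta_xmon_nonpos[of \<alpha>] theta_add[of "(0, \<beta>, k)" "xmon \<alpha>"] by (simp add: xmon_def)

lemma theta_bounded: "\<exists>M. \<forall>t :: 'n::finite mon. mdeg t = d \<longrightarrow> theta t \<le> M"
proof -
  let ?S = "(\<lambda>(\<beta>, k). theta (0 :: nat^'n, \<beta>, k)) ` snd ` {t :: 'n mon. mdeg t = d}"
  have "theta t \<le> Max ?S" if "mdeg t = d" for t :: "'n mon"
  proof -
    obtain \<alpha> \<beta> k where t: "t = (\<alpha>, \<beta>, k)" by (cases t)
    have "theta (0, \<beta>, k) \<in> ?S" using that unfolding t by (force simp: image_iff)
    then have "theta (0, \<beta>, k) \<le> Max ?S" using finite_mdeg_slices[of d, where 'n='n] by simp
    then show ?thesis using theta_slice_le[of \<alpha> \<beta> k] t by simp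
  qed
  then show ?thesis by blast
qed

text \<open>
  A real weight, unlike a general monomial order, has only finitely many monomials of given degree above any level.
  This makes recursion along decreasing weight possible and makes partial sums of norms finite.
\<close>

lemma finite_theta_ge: "finite {t :: 'n::finite mon. mdeg t = d \<and> K \<le> theta t}"
proof -
  obtain M where M: "\<And>t :: 'n mon. mdeg t = d \<Longrightarrow> theta t \<le> M" using theta_bounded by blast
  have "{t :: 'n mon. mdeg t = d \<and> K \<le> theta t} \<subseteq>
    {(\<alpha>, \<beta>, k). (\<forall>i. \<alpha> $ i \<le> nat \<lceil>(M - K) / fst lam_mu i\<rceil>) \<and> (\<forall>i. \<beta> $ i \<le> d) \<and> k \<le> d}"
  proof
    fix t :: "'n mon" assume "t \<in> {t. mdeg t = d \<and> K \<le> theta t}"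
    then obtain \<alpha> \<beta> k where t: "t = (\<alpha>, \<beta>, k)" and d: "mdeg (\<alpha>, \<beta>, k) = d" and K: "K \<le> theta (\<alpha>, \<beta>, k)"
      by (cases t) auto
    have "theta (\<alpha>, \<beta>, k) = theta (0, \<beta>, k) + theta (xmon \<alpha>)"
      using theta_add[of "(0, \<beta>, k)" "xmon \<alpha>"] by (simp add: xmon_def)
    moreover have "theta (0, \<beta>, k) \<le> M" using M d by (simp add: mdeg_def)
    ultimately have le: "(\<Sum>i\<in>UNIV. fst lam_mu i * real (\<alpha> $ i)) \<le> M - K" using K by (simp add: theta_xmon)
    have "\<alpha> $ i \<le> nat \<lceil>(M - K) / fst lam_mu i\<rceil>" for i
    proof -
      have "fst lam_mu i * real (\<alpha> $ i) \<le> (\<Sum>i\<in>UNIV. fst lam_mu i * real (\<alpha> $ i))"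
        by (intro member_le_sum) (auto simp: less_imp_le lam_mu(1))
      then have "real (\<alpha> $ i) \<le> (M - K) / fst lam_mu i"
        using le lam_mu(1)[of i] by (simp add: field_simps)
      then show ?thesis by linarith
    qed
    moreover have "\<beta> $ i \<le> d" for i using msize_ge[of \<beta> i] d by (simp add: mdeg_def)
    ultimately show "t \<in> {(\<alpha>, \<beta>, k). (\<forall>i. \<alpha> $ i \<le> nat \<lceil>(M - K) / fst lam_mu i\<rceil>) \<and> (\<forall>i. \<beta> $ i \<le> d) \<and> k \<le> d}"
      using d by (simp add: mdeg_def t)
  qed
  then show ?thesis by (rule finite_subset) (rule finite_mon_le)
qed

(* Monomials are triples, but statements quantified over them are to stay as they are. *)
declare split_paired_All [simp del] split_paired_Ex [simp del]

section \<open>Division in modules over the power series ring\<close>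

abbreviation smul :: "(nat^'n::finite \<Rightarrow> 'k::field) \<Rightarrow> ('k, 'n) hdo \<Rightarrow> ('k, 'n) hdo" where
  "smul c P \<equiv> hdo_mult UNIV (hdo_series c) P"

definition xdivs :: "'n::finite mon \<Rightarrow> ((nat^'n) \<times> 'n mon) set" where
  "xdivs t = {(\<alpha>, s). xmon \<alpha> + s = t}"

lemma xdivs_slice: "xdivs (a, b, c) = (\<lambda>(\<alpha>, \<alpha>'). (\<alpha>, (\<alpha>', b, c))) ` {(\<alpha>, \<alpha>'). \<alpha> + \<alpha>' = a}"
  by (auto simp: xdivs_def xmon_def)

lemma finite_xdivs: "finite (xdivs t)"
  using finite_mi_splits[of "fst t"] by (cases t) (simp add: xdivs_slice mi_splits_def)

lemma smul_eq: "smul c P t = (\<Sum>(\<alpha>, s)\<in>xdivs t. c \<alpha> * P s)"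
proof -
  obtain a b k where t: "t = (a, b, k)" by (cases t)
  show ?thesis
    unfolding t hdo_series_mult xdivs_slice
    by (subst sum.reindex) (auto simp: inj_on_def intro!: sum.cong)
qed

lemma smul_nz:
  assumes "smul c P t \<noteq> 0"
  obtains \<alpha> s where "t = xmon \<alpha> + s" "c \<alpha> \<noteq> 0" "P s \<noteq> 0"
proof -
  obtain z where "z \<in> xdivs t" "(case z of (\<alpha>, s) \<Rightarrow> c \<alpha> * P s) \<noteq> 0"
    using assms unfolding smul_eq by (rule sum.not_neutral_contains_not_neutral)
  then show ?thesis by (intro that[of "fst z" "snd z"]) (auto simp: xdivs_def)
qed

lemma smul_add_right: "smul c (\<lambda>t. P t + Q t) t = smul c P t + smul c Q t"
  unfolding hdo_mult_add_right ..

lemma smul_monom: "smul c (hdo_monom e) (e + xmon \<alpha>) = c \<alpha>"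
proof -
  have "smul c (hdo_monom e) (e + xmon \<alpha>) = (\<Sum>z\<in>{(\<alpha>, e)}. case z of (\<alpha>, s) \<Rightarrow> c \<alpha> * hdo_monom e s)"
    unfolding smul_eq
  proof (rule sum.mono_neutral_right[OF finite_xdivs])
    show "{(\<alpha>, e)} \<subseteq> xdivs (e + xmon \<alpha>)" by (simp add: xdivs_def add.commute)
    show "\<forall>z\<in>xdivs (e + xmon \<alpha>) - {(\<alpha>, e)}. (case z of (\<alpha>, s) \<Rightarrow> c \<alpha> * hdo_monom e s) = 0"
    proof (rule ballI, rule ccontr)
      fix z assume "z \<in> xdivs (e + xmon \<alpha>) - {(\<alpha>, e)}" "(case z of (\<alpha>, s) \<Rightarrow> c \<alpha> * hdo_monom e s) \<noteq> 0"
      then obtain \<alpha>' s where *: "(\<alpha>', s) \<in> xdivs (e + xmon \<alpha>)" "(\<alpha>', s) \<noteq> (\<alpha>, e)" "c \<alpha>' * hdo_monom e s \<noteq> 0"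
        by (cases z) auto
      then have "s = e" by (auto simp: hdo_monom_def split: if_splits)
      then have "e + xmon \<alpha>' = e + xmon \<alpha>" using *(1) by (simp add: xdivs_def add.commute)
      then show False using *(2) \<open>s = e\<close> by (simp only: mon_add_cancel xmon_eq_iff)
    qed
  qed
  then show ?thesis by (simp add: hdo_monom_def)
qed

lemma smul_monom_nz:
  fixes c :: "nat^'n::finite \<Rightarrow> 'k::field"
  assumes "smul c (hdo_monom e) t \<noteq> 0"
  obtains \<alpha> where "t = e + xmon \<alpha>" "c \<alpha> \<noteq> 0"
proof -
  obtain \<alpha> s where "t = xmon \<alpha> + s" "c \<alpha> \<noteq> 0" "hdo_monom e s \<noteq> (0 :: 'k)" using assms by (rule smul_nz)
  then show ?thesis using that[of \<alpha>] by (auto simp: hdo_monom_def add.commute split: if_splits)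
qed

lemma smul_const:
  fixes P :: "('k::field, 'n::finite) hdo"
  shows "smul (\<lambda>\<alpha>. if \<alpha> = 0 then c else 0) P t = c * P t"
proof -
  have "smul (\<lambda>\<alpha>. if \<alpha> = 0 then c else 0) P t =
      (\<Sum>z\<in>{(0, t)}. case z of (\<alpha> :: nat^'n, s) \<Rightarrow> (if \<alpha> = 0 then c else 0) * P s)"
    unfolding smul_eq
    by (rule sum.mono_neutral_right[OF finite_xdivs]) (auto simp: xdivs_def split: if_splits)
  then show ?thesis by simp
qed

lemma smul_deg:
  assumes "\<And>t. P t \<noteq> 0 \<Longrightarrow> mdeg t = d" "smul c P t \<noteq> 0"
  shows "mdeg t = d"
proof -
  obtain \<alpha> s where "t = xmon \<alpha> + s" "P s \<noteq> 0" using assms(2) by (rule smul_nz)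
  then show ?thesis using assms(1)[of s] by simp
qed

text \<open>
  The quotient for the divisor with leading monomial \<open>e\<close>. A rule \<open>sel\<close> assigns to a monomial the divisor that
  eliminates it; \<open>F\<close> holds, for each monomial, the coefficient that is present when this monomial is reached.
\<close>

definition quot :: "('n::finite mon \<Rightarrow> 'n mon option) \<Rightarrow> ('k::field, 'n) hdo \<Rightarrow> 'n mon \<Rightarrow> nat^'n \<Rightarrow> 'k" where
  "quot sel F e = (\<lambda>\<alpha>. if sel (e + xmon \<alpha>) = Some e then F (e + xmon \<alpha>) else 0)"

text \<open>
  Divisors are normalised to the form \<open>e + r\<close> with leading monomial \<open>e\<close>.
\<close>

definition small_tail :: "nat \<Rightarrow> 'n::finite mon \<Rightarrow> ('k::field, 'n) hdo \<Rightarrow> bool" where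
  "small_tail d e r \<longleftrightarrow> mdeg e = d \<and> (\<forall>t. r t \<noteq> 0 \<longrightarrow> mdeg t = d \<and> theta t < theta e)"

lemma wf_theta: "wf {(s :: 'n::finite mon, t). mdeg s = mdeg t \<and> theta t < theta s}"
proof -
  let ?up = "\<lambda>t :: 'n mon. {s :: 'n mon. mdeg s = mdeg t \<and> theta t < theta s}"
  have "card (?up s) < card (?up t)" if "mdeg s = mdeg t" "theta t < theta s" for s t :: "'n mon"
  proof (rule psubset_card_mono)
    show "finite (?up t)" by (rule finite_subset[OF _ finite_theta_ge[of "mdeg t" "theta t"]]) auto
    show "?up s \<subset> ?up t" using that by (auto intro: exI[of _ s])
  qed
  then have "{(s :: 'n mon, t). mdeg s = mdeg t \<and> theta t < theta s} \<subseteq> inv_image less_than (\<lambda>t. card (?up t))" by auto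
  then show ?thesis by (rule wf_subset[OF wf_inv_image[OF wf_less_than]])
qed

text \<open>
  The coefficient of \<open>F\<close> at \<open>t\<close> only involves coefficients of \<open>F\<close> at monomials of larger weight, because each
  \<open>r e\<close> has smaller weight than \<open>e\<close>. So the equation can be solved by recursion along decreasing weight.
\<close>

lemma division_recursion:
  fixes f :: "('k::field, 'n::finite) hdo"
  assumes "\<And>e. e \<in> B \<Longrightarrow> small_tail d e (r e)" and f: "\<And>t. f t \<noteq> 0 \<Longrightarrow> mdeg t = d"
  obtains F where "\<And>t. F t = f t - (\<Sum>e\<in>B. smul (quot sel F e) (r e) t)" "\<And>t. F t \<noteq> 0 \<Longrightarrow> mdeg t = d"
proof -
  let ?R = "{(s :: 'n mon, t). mdeg s = mdeg t \<and> theta t < theta s}"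
  define \<Phi> where "\<Phi> = (\<lambda>F t. f t - (\<Sum>e\<in>B. smul (quot sel F e) (r e) t))"
  have loc: "\<Phi> F t = \<Phi> G t" if agree: "\<And>s. (s, t) \<in> ?R \<Longrightarrow> F s = G s" for F G t
  proof -
    have "smul (quot sel F e) (r e) t = smul (quot sel G e) (r e) t" if e: "e \<in> B" for e
      unfolding smul_eq
    proof (rule sum.cong[OF refl], clarify)
      fix \<alpha> s assume "(\<alpha>, s) \<in> xdivs t"
      then have t: "t = xmon \<alpha> + s" by (auto simp: xdivs_def)
      show "quot sel F e \<alpha> * r e s = quot sel G e \<alpha> * r e s"
      proof (cases "r e s = 0")
        case False
        then have "mdeg e = d" "mdeg s = d" "theta s < theta e" using assms(1)[OF e] by (auto simp: small_tail_def)
        then have "F (e + xmon \<alpha>) = G (e + xmon \<alpha>)" by (intro agree) (simp add: t theta_add)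
        then show ?thesis by (simp add: quot_def)
      qed simp
    qed
    then show ?thesis by (simp add: \<Phi>_def)
  qed
  define F where "F = wfrec ?R \<Phi>"
  have F: "F t = \<Phi> F t" for t
  proof -
    have "adm_wf ?R \<Phi>" unfolding adm_wf_def by (intro allI impI loc) blast
    note * = wfrec_fixpoint[OF wf_theta this]
    show ?thesis unfolding F_def by (subst *) (rule refl)
  qed
  moreover have "mdeg t = d" if "F t \<noteq> 0" for t
  proof (rule ccontr)
    assume "mdeg t \<noteq> d"
    have "smul (quot sel F e) (r e) t = 0" if "e \<in> B" for e
      using \<open>mdeg t \<noteq> d\<close> assms(1)[OF that] by (rule_tac ccontr, elim smul_nz) (auto simp: small_tail_def)
    then have "\<Phi> F t = 0" using f[of t] \<open>mdeg t \<noteq> d\<close> by (auto simp: \<Phi>_def)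
    then show False using F that by simp
  qed
  ultimately show ?thesis using that[of F] by (simp add: \<Phi>_def)
qed

lemma division_recursion_bound:
  fixes f :: "('k::field, 'n::finite) hdo"
  assumes tail: "\<And>e. e \<in> B \<Longrightarrow> small_tail d e (r e)"
    and F: "\<And>t. F t = f t - (\<Sum>e\<in>B. smul (quot sel F e) (r e) t)"
    and f: "\<And>t. f t \<noteq> 0 \<Longrightarrow> theta t \<le> K"
  shows "F t \<noteq> 0 \<Longrightarrow> theta t \<le> K"
proof (induction t rule: wf_induct_rule[OF wf_theta])
  case (1 t)
  show ?case
  proof (rule ccontr)
    assume K: "\<not> theta t \<le> K"
    have "smul (quot sel F e) (r e) t = 0" if e: "e \<in> B" for e
    proof (rule ccontr)
      assume "smul (quot sel F e) (r e) t \<noteq> 0"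
      then obtain \<alpha> s where t: "t = xmon \<alpha> + s" "quot sel F e \<alpha> \<noteq> 0" "r e s \<noteq> 0" by (rule smul_nz)
      have nz: "F (e + xmon \<alpha>) \<noteq> 0" using t(2) by (auto simp: quot_def split: if_splits)
      have "mdeg e = d" "mdeg s = d" "theta s < theta e" using tail[OF e] t(3) by (auto simp: small_tail_def)
      then have "theta (e + xmon \<alpha>) \<le> K" using nz by (intro "1.IH") (auto simp: t theta_add)
      then show False using K \<open>theta s < theta e\<close> by (simp add: t theta_add)
    qed
    then have "F t = f t" using F[of t] by simp
    then show False using f[of t] "1.prems" K by simp
  qed
qed

text \<open>
  What division needs to know about the class of operators. Only \<open>C_division\<close> is not a routine closure property:
  it says that division does not leave the class, which for convergent series needs an estimate.
\<close>

locale op_class =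
  fixes C :: "('k::field, 'n::finite) hdo set"
  assumes C_formal: "C \<subseteq> formal_ops"
    and C_add: "P \<in> C \<Longrightarrow> Q \<in> C \<Longrightarrow> (\<lambda>t. P t + Q t) \<in> C"
    and C_scale: "P \<in> C \<Longrightarrow> (\<lambda>t. c * P t) \<in> C"
    and C_restrict: "P \<in> C \<Longrightarrow> (\<lambda>t. if t \<in> S then P t else 0) \<in> C"
    and C_monom: "hdo_monom t \<in> C"
    and C_slice: "P \<in> C \<Longrightarrow> hdo_series (\<lambda>\<alpha>. if p \<alpha> then P (e + xmon \<alpha>) else 0) \<in> C"
    and C_smul: "hdo_series g \<in> C \<Longrightarrow> P \<in> C \<Longrightarrow> smul g P \<in> C"
    and C_division: "finite B \<Longrightarrow> (\<And>e. e \<in> B \<Longrightarrow> small_tail d e (r e) \<and> r e \<in> C) \<Longrightarrow>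
      f \<in> C \<Longrightarrow> (\<And>t. f t \<noteq> 0 \<Longrightarrow> mdeg t = d) \<Longrightarrow> (\<And>t. F t \<noteq> 0 \<Longrightarrow> mdeg t = d) \<Longrightarrow>
      (\<And>t. F t = f t - (\<Sum>e\<in>B. smul (quot sel F e) (r e) t)) \<Longrightarrow> F \<in> C"
begin

definition C_deg :: "nat \<Rightarrow> ('k, 'n) hdo set" where
  "C_deg d = {P \<in> C. \<forall>t. P t \<noteq> 0 \<longrightarrow> mdeg t = d}"

lemma C_zero: "(\<lambda>_. 0) \<in> C"
  using C_restrict[of "hdo_monom 0" "{}"] C_monom by simp

lemma fun_subspace_C: "fun_subspace C"
  by (auto simp: fun_subspace_def C_zero C_add C_scale)

lemma fun_subspace_C_deg: "fun_subspace (C_deg d)"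
  unfolding fun_subspace_def C_deg_def
  by (auto simp: C_zero C_add C_scale) (metis add.left_neutral)

lemma C_const: "hdo_series (\<lambda>\<alpha>. if \<alpha> = 0 then c else 0) \<in> C"
proof -
  have "hdo_series (\<lambda>\<alpha>. if \<alpha> = 0 then c else 0) = (\<lambda>t :: 'n mon. c * hdo_monom 0 t)"
    by (auto simp: fun_eq_iff hdo_series_def hdo_monom_def zero_prod_def split: prod.splits if_splits)
  then show ?thesis using C_scale[OF C_monom, of c 0] by simp
qed

text \<open>
  The submodules over the coefficient ring that are contained in one degree. In one degree the operators form a free
  module of finite rank over the power series.
\<close>

definition submod :: "nat \<Rightarrow> ('k, 'n) hdo set \<Rightarrow> bool" where
  "submod d H \<longleftrightarrow> H \<subseteq> C_deg d \<and> (\<lambda>_. 0) \<in> H \<and> (\<forall>P\<in>H. \<forall>Q\<in>H. (\<lambda>t. P t + Q t) \<in> H) \<and>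
     (\<forall>c. hdo_series c \<in> C \<longrightarrow> (\<forall>P\<in>H. smul c P \<in> H))"

lemma submod_subspace: "submod d H \<Longrightarrow> fun_subspace H"
  unfolding fun_subspace_def submod_def
proof (intro conjI allI ballI; (elim conjE)?)
  fix c x assume "\<forall>c. hdo_series c \<in> C \<longrightarrow> (\<forall>P\<in>H. smul c P \<in> H)" "x \<in> H"
  then have "smul (\<lambda>\<alpha>. if \<alpha> = 0 then c else 0) x \<in> H" using C_const by blast
  then show "(\<lambda>t. c * x t) \<in> H" by (simp add: smul_const[abs_def])
qed auto

lemma submodI:
  assumes "H \<subseteq> C_deg d" "fun_subspace H" "\<And>c P. hdo_series c \<in> C \<Longrightarrow> P \<in> H \<Longrightarrow> smul c P \<in> H"
  shows "submod d H"
  using assms fun_subspaceD[OF assms(2)] by (auto simp: submod_def)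

text \<open>
  Leading monomials are those of largest \<open>theta\<close>; by genericity they are unique within one degree.
\<close>

definition lead :: "('k, 'n) hdo \<Rightarrow> 'n mon \<Rightarrow> bool" where
  "lead P t \<longleftrightarrow> P t \<noteq> 0 \<and> (\<forall>s. P s \<noteq> 0 \<longrightarrow> s \<noteq> t \<longrightarrow> theta s < theta t)"

lemma lead_exists:
  assumes "P \<in> C_deg d" "P t0 \<noteq> 0"
  obtains t where "lead P t"
proof -
  let ?S = "{s. P s \<noteq> 0 \<and> theta t0 \<le> theta s}"
  have fin: "finite ?S"
    by (rule finite_subset[OF _ finite_theta_ge[of d "theta t0"]]) (use assms in \<open>auto simp: C_deg_def\<close>)
  have t0: "t0 \<in> ?S" using assms by simp
  obtain t where t: "t \<in> ?S" "theta t = Max (theta ` ?S)"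
    using Max_in[of "theta ` ?S"] fin t0 by (metis (mono_tags, lifting) empty_iff finite_imageI image_iff)
  have "theta s < theta t" if "P s \<noteq> 0" "s \<noteq> t" for s
  proof (cases "theta t0 \<le> theta s")
    case True
    then have "theta s \<le> theta t" using that fin unfolding t(2) by (intro Max_ge) auto
    moreover have "theta s \<noteq> theta t"
      using theta_inj[of s t] that t(1) assms(1) by (auto simp: C_deg_def)
    ultimately show ?thesis by simp
  next
    case False
    then show ?thesis using t(1) by simp
  qed
  then show ?thesis using that[of t] t(1) by (auto simp: lead_def)
qed

definition leads :: "('k, 'n) hdo set \<Rightarrow> 'n mon set" where
  "leads H = {t. \<exists>P\<in>H. lead P t}"

text \<open>
  The bound on the weights of the quotients in the last clause makes certain functionals depend on finitely many
  coefficients only.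
\<close>

abbreviation is_division :: "nat \<Rightarrow> ('k, 'n) hdo set \<Rightarrow> 'n mon set \<Rightarrow> ('n mon \<Rightarrow> ('k, 'n) hdo) \<Rightarrow>
    ('k, 'n) hdo \<Rightarrow> ('n mon \<Rightarrow> nat^'n \<Rightarrow> 'k) \<Rightarrow> ('k, 'n) hdo \<Rightarrow> bool" where
  "is_division d H B b f q rem \<equiv> (\<forall>e\<in>B. hdo_series (q e) \<in> C) \<and>
     f = (\<lambda>t. (\<Sum>e\<in>B. smul (q e) (b e) t) + rem t) \<and>
     rem \<in> C_deg d \<and> (\<forall>t. rem t \<noteq> 0 \<longrightarrow> t \<notin> leads H) \<and>
     (\<forall>K. (\<forall>t. f t \<noteq> 0 \<longrightarrow> theta t \<le> K) \<longrightarrow> (\<forall>e\<in>B. \<forall>\<alpha>. q e \<alpha> \<noteq> 0 \<longrightarrow> theta (e + xmon \<alpha>) \<le> K))"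

text \<open>
  Division by finitely many elements of \<open>H\<close> whose leading monomials generate all leading monomials of \<open>H\<close>, which
  exist by Dickson's lemma. The solution \<open>F\<close> of the recursion contains the quotients at the leading monomials of
  \<open>H\<close> and the remainder at the others.
\<close>

lemma division:
  assumes H: "submod d H"
  obtains B b where "finite B" "\<And>e. e \<in> B \<Longrightarrow> b e \<in> H"
    "\<And>f. f \<in> C_deg d \<Longrightarrow> \<exists>q rem. is_division d H B b f q rem"
proof -
  have HC: "H \<subseteq> C_deg d" using H by (simp add: submod_def)
  note sub = submod_subspace[OF H]
  have "leads H \<subseteq> {t. mdeg t = d}" using HC by (auto simp: leads_def lead_def C_deg_def)
  then obtain B where B: "finite B" "B \<subseteq> leads H" "\<forall>s\<in>leads H. \<exists>e\<in>B. \<exists>\<gamma>. s = e + xmon \<gamma>"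
    by (rule dickson_xmon[THEN exE]) (elim conjE)
  have "\<exists>P. P \<in> H \<and> lead P e \<and> P e = 1" if e: "e \<in> B" for e
  proof -
    obtain P where P: "P \<in> H" "lead P e" using B(2) e by (auto simp: leads_def)
    then show ?thesis
      using fun_subspaceD(3)[OF sub P(1), of "inverse (P e)"]
      by (intro exI[of _ "\<lambda>t. inverse (P e) * P t"]) (auto simp: lead_def)
  qed
  then obtain b where b: "\<And>e. e \<in> B \<Longrightarrow> b e \<in> H \<and> lead (b e) e \<and> b e e = 1" by metis
  define r where "r = (\<lambda>e t. if t = e then 0 else b e t)"
  have b_r: "b e = (\<lambda>t. hdo_monom e t + r e t)" if "e \<in> B" for e
    using b[OF that] by (auto simp: r_def hdo_monom_def fun_eq_iff)
  have r: "small_tail d e (r e) \<and> r e \<in> C" if "e \<in> B" for e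
  proof
    have bC: "b e \<in> C_deg d" "lead (b e) e" using b[OF that] HC by auto
    then show "small_tail d e (r e)" by (auto simp: small_tail_def r_def lead_def C_deg_def)
    show "r e \<in> C"
    proof -
      have "r e = (\<lambda>t. if t \<in> - {e} then b e t else 0)" by (auto simp: r_def)
      then show ?thesis using C_restrict[of "b e" "- {e}"] bC(1) by (simp add: C_deg_def)
    qed
  qed
  define sel where "sel = (\<lambda>t. if t \<in> leads H then Some (SOME e. e \<in> B \<and> (\<exists>\<gamma>. t = e + xmon \<gamma>)) else None)"
  have sel: "\<exists>e\<in>B. \<exists>\<gamma>. t = e + xmon \<gamma> \<and> sel t = Some e" if t: "t \<in> leads H" for t
  proof -
    have "\<exists>e. e \<in> B \<and> (\<exists>\<gamma>. t = e + xmon \<gamma>)" using B(3) t by blast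
    then have "(SOME e. e \<in> B \<and> (\<exists>\<gamma>. t = e + xmon \<gamma>)) \<in> B \<and>
      (\<exists>\<gamma>. t = (SOME e. e \<in> B \<and> (\<exists>\<gamma>. t = e + xmon \<gamma>)) + xmon \<gamma>)" by (rule someI_ex)
    then show ?thesis using t unfolding sel_def by auto
  qed
  show thesis
  proof (rule that[OF B(1)])
    show "b e \<in> H" if "e \<in> B" for e using b[OF that] by simp
    fix f assume f: "f \<in> C_deg d"
    then have fd: "f \<in> C" "\<And>t. f t \<noteq> 0 \<Longrightarrow> mdeg t = d" by (auto simp: C_deg_def)
    have r': "\<And>e. e \<in> B \<Longrightarrow> small_tail d e (r e)" using r by blast
    obtain F where F: "\<And>t. F t = f t - (\<Sum>e\<in>B. smul (quot sel F e) (r e) t)" "\<And>t. F t \<noteq> 0 \<Longrightarrow> mdeg t = d"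
      using division_recursion[of B d r f sel, OF r' fd(2)] by blast
    have FC: "F \<in> C" by (rule C_division[OF B(1) r fd F(2) F(1)])
    define rem where "rem = (\<lambda>t. if t \<in> - leads H then F t else 0)"
    have qC: "hdo_series (quot sel F e) \<in> C" for e
      unfolding quot_def by (rule C_slice[OF FC])
    have top: "(\<Sum>e\<in>B. smul (quot sel F e) (hdo_monom e) t) = (if t \<in> leads H then F t else 0)" for t
    proof (cases "t \<in> leads H")
      case True
      then obtain e \<gamma> where e: "e \<in> B" "t = e + xmon \<gamma>" "sel t = Some e" using sel by blast
      have "(\<Sum>e\<in>B. smul (quot sel F e) (hdo_monom e) t) = (\<Sum>e'\<in>{e}. smul (quot sel F e') (hdo_monom e') t)"
      proof (rule sum.mono_neutral_right[OF B(1)])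
        show "\<forall>i\<in>B - {e}. smul (quot sel F i) (hdo_monom i) t = 0"
          using e(3) by (rule_tac ballI, rule_tac ccontr, elim smul_monom_nz) (auto simp: quot_def split: if_splits)
      qed (use e in auto)
      also have "\<dots> = F t" unfolding e(2) using e(3) by (simp add: smul_monom quot_def e(2))
      finally show ?thesis using True by simp
    next
      case False
      then have "sel t = None" by (simp add: sel_def)
      then have "smul (quot sel F e) (hdo_monom e) t = 0" for e
        by (rule_tac ccontr, elim smul_monom_nz) (auto simp: quot_def split: if_splits)
      then show ?thesis using False by simp
    qed
    have eq: "f = (\<lambda>t. (\<Sum>e\<in>B. smul (quot sel F e) (b e) t) + rem t)"
    proof
      fix t
      have "(\<Sum>e\<in>B. smul (quot sel F e) (b e) t) =
          (\<Sum>e\<in>B. smul (quot sel F e) (hdo_monom e) t) + (\<Sum>e\<in>B. smul (quot sel F e) (r e) t)"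
        by (simp add: b_r smul_add_right sum.distrib)
      then show "f t = (\<Sum>e\<in>B. smul (quot sel F e) (b e) t) + rem t"
        using F(1)[of t] top[of t] by (simp add: rem_def)
    qed
    have "rem \<in> C_deg d"
      using C_restrict[OF FC, of "- leads H"] F(2) unfolding rem_def C_deg_def by auto
    moreover have "theta (e + xmon \<alpha>) \<le> K" if "\<forall>t. f t \<noteq> 0 \<longrightarrow> theta t \<le> K" "quot sel F e \<alpha> \<noteq> 0" for K e \<alpha>
      by (rule division_recursion_bound[of B d r F f sel K, OF r' F(1)])
         (use that in \<open>auto simp: quot_def split: if_splits\<close>)
    ultimately show "\<exists>q rem. is_division d H B b f q rem"
      using eq qC by (intro exI[of _ "quot sel F"] exI[of _ rem]) (auto simp: rem_def)
  qed
qed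

lemma combination_in_submod:
  assumes "submod d H" "finite B" "\<And>e. e \<in> B \<Longrightarrow> hdo_series (q e) \<in> C \<and> b e \<in> H"
  shows "(\<lambda>t. \<Sum>e\<in>B. smul (q e) (b e) t) \<in> H"
  using assms by (intro fun_subspace_sum[OF submod_subspace[OF assms(1)]]) (auto simp: submod_def)

text \<open>
  The remainder of \<open>f\<close> vanishes: otherwise an element of \<open>H\<close> that agrees with \<open>f\<close> on the finitely many monomials
  above the leading monomial \<open>u\<close> of the remainder would, after subtracting the combination of divisors, have \<open>u\<close> as
  its own leading monomial.
\<close>

lemma submod_closed:
  assumes H: "submod d H" and f: "f \<in> C_deg d"
    and approx: "\<And>F. finite F \<Longrightarrow> \<exists>s\<in>H. \<forall>t\<in>F. s t = f t"
  shows "f \<in> H"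
proof -
  note sub = submod_subspace[OF H]
  obtain B b where B: "finite B" "\<And>e. e \<in> B \<Longrightarrow> b e \<in> H" and
    div: "\<And>f. f \<in> C_deg d \<Longrightarrow> \<exists>q rem. is_division d H B b f q rem"
    using division[OF H] by blast
  obtain q rem where q: "\<forall>e\<in>B. hdo_series (q e) \<in> C" and eq: "f = (\<lambda>t. (\<Sum>e\<in>B. smul (q e) (b e) t) + rem t)"
    and rem: "rem \<in> C_deg d" "\<forall>t. rem t \<noteq> 0 \<longrightarrow> t \<notin> leads H"
    using div[OF f] by blast
  have comb: "(\<lambda>t. \<Sum>e\<in>B. smul (q e) (b e) t) \<in> H"
    by (rule combination_in_submod[OF H B(1)]) (use q B in auto)
  have "rem t = 0" for t
  proof (rule ccontr)
    assume "rem t \<noteq> 0"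
    then obtain u where u: "lead rem u" using lead_exists[OF rem(1)] by blast
    obtain s where s: "s \<in> H" "\<forall>t\<in>{t. mdeg t = d \<and> theta u \<le> theta t}. s t = f t"
      using approx[OF finite_theta_ge] by blast
    define P where "P = (\<lambda>t. s t - 1 * (\<Sum>e\<in>B. smul (q e) (b e) t))"
    have P: "P \<in> H" unfolding P_def by (rule fun_subspaceD(4)[OF sub s(1) comb])
    have agree: "P t = rem t" if "mdeg t = d" "theta u \<le> theta t" for t
      using s(2) that eq by (auto simp: P_def)
    have "mdeg t = d" if "P t \<noteq> 0" for t using P H that by (auto simp: submod_def C_deg_def)
    moreover have "mdeg u = d" using u rem(1) by (auto simp: lead_def C_deg_def)
    ultimately have "lead P u"
      using u agree unfolding lead_def by (metis linorder_not_less order_refl)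
    then show False using P u rem(2) by (auto simp: leads_def lead_def)
  qed
  then have "f = (\<lambda>t. \<Sum>e\<in>B. smul (q e) (b e) t)" using eq by simp
  then show ?thesis using comb by simp
qed

lemma submod_closed_annihilator:
  assumes H: "submod d H" and f: "f \<in> C_deg d"
    and ann: "\<And>F \<phi>. finite F \<Longrightarrow> (\<And>s. s \<in> H \<Longrightarrow> (\<Sum>t\<in>F. \<phi> t * s t) = 0) \<Longrightarrow> (\<Sum>t\<in>F. \<phi> t * f t) = 0"
  shows "f \<in> H"
  by (rule submod_closed[OF H f], rule agree_on_finite_of_annihilator[OF _ submod_subspace[OF H]])
     (auto intro: ann)

lemma submod_sum:
  assumes N1: "submod d N1" and N2: "submod d N2"
  shows "submod d {\<lambda>t. x t + y t | x y. x \<in> N1 \<and> y \<in> N2}" (is "submod d ?H")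
proof -
  have HI: "(\<lambda>t. x t + y t) \<in> ?H" if "x \<in> N1" "y \<in> N2" for x y using that by auto
  note s1 = submod_subspace[OF N1] and s2 = submod_subspace[OF N2]
  show ?thesis
    unfolding submod_def
  proof (intro conjI allI ballI impI)
    show "?H \<subseteq> C_deg d"
    proof
      fix P assume "P \<in> ?H"
      then obtain x y where *: "P = (\<lambda>t. x t + y t)" "x \<in> N1" "y \<in> N2" by auto
      have "x \<in> C_deg d" "y \<in> C_deg d" using N1 N2 *(2,3) by (auto simp: submod_def)
      then show "P \<in> C_deg d" unfolding *(1) by (rule fun_subspaceD(2)[OF fun_subspace_C_deg])
    qed
    show "(\<lambda>_. 0) \<in> ?H" using HI[OF fun_subspaceD(1)[OF s1] fun_subspaceD(1)[OF s2]] by simp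
  next
    fix P Q assume "P \<in> ?H" "Q \<in> ?H"
    then obtain x y x' y' where *: "P = (\<lambda>t. x t + y t)" "Q = (\<lambda>t. x' t + y' t)" "x \<in> N1" "x' \<in> N1" "y \<in> N2" "y' \<in> N2"
      by auto
    show "(\<lambda>t. P t + Q t) \<in> ?H"
      using HI[OF fun_subspaceD(2)[OF s1 *(3,4)] fun_subspaceD(2)[OF s2 *(5,6)]] by (simp only: * add_ac)
  next
    fix c P assume c: "hdo_series c \<in> C" and "P \<in> ?H"
    then obtain x y where *: "P = (\<lambda>t. x t + y t)" "x \<in> N1" "y \<in> N2" by auto
    have "(\<lambda>t. smul c x t + smul c y t) \<in> ?H"
      by (rule HI) (use N1 N2 c * in \<open>auto simp: submod_def\<close>)
    then show "smul c P \<in> ?H" by (simp only: * hdo_mult_add_right)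
  qed
qed

text \<open>
  On \<open>N1 + N2\<close> the assignment \<open>x + y \<mapsto> \<psi>(x)\<close> is well defined because \<open>\<psi>\<close> annihilates the intersection. It
  depends on finitely many coefficients only: if an element of \<open>N1 + N2\<close> has no terms of large weight, then its
  quotients with respect to fixed divisors \<open>x e + y e\<close> have small weight, and the part in \<open>N1\<close> has no terms in the
  support of \<open>\<psi>\<close>. So the assignment is given by coefficients on a finite set, and extends to all operators.
\<close>

lemma annihilator_of_intersection:
  assumes N1: "submod d N1" and N2: "submod d N2" and F0: "finite F0"
    and ann: "\<And>P. P \<in> N1 \<Longrightarrow> P \<in> N2 \<Longrightarrow> (\<Sum>t\<in>F0. \<psi> t * P t) = 0"
  shows "\<exists>F \<phi>. finite F \<and> (\<forall>P\<in>N2. (\<Sum>t\<in>F. \<phi> t * P t) = 0) \<and>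
     (\<forall>P\<in>N1. (\<Sum>t\<in>F. \<phi> t * P t) = (\<Sum>t\<in>F0. \<psi> t * P t))"
proof -
  define pr where "pr = (\<lambda>P :: ('k, 'n) hdo. \<Sum>t\<in>F0. \<psi> t * P t)"
  have pr_add: "pr (\<lambda>t. x t + y t) = pr x + pr y" and pr_scale: "pr (\<lambda>t. c * x t) = c * pr x"
    and pr_diff: "pr (\<lambda>t. x t - 1 * y t) = pr x - pr y" for x y c
    by (simp_all add: pr_def sum.distrib sum_subtractf algebra_simps sum_distrib_left)
  define H where "H = {\<lambda>t. x t + y t | x y. x \<in> N1 \<and> y \<in> N2}"
  note s1 = submod_subspace[OF N1] and s2 = submod_subspace[OF N2]
  have HI: "(\<lambda>t. x t + y t) \<in> H" if "x \<in> N1" "y \<in> N2" for x y using that by (auto simp: H_def)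
  have H: "submod d H" unfolding H_def by (rule submod_sum[OF N1 N2])
  note sH = submod_subspace[OF H]
  define \<Phi> where "\<Phi> = (\<lambda>z. pr (SOME x. x \<in> N1 \<and> (\<exists>y\<in>N2. z = (\<lambda>t. x t + y t))))"
  have \<Phi>: "\<Phi> (\<lambda>t. x t + y t) = pr x" if x: "x \<in> N1" and y: "y \<in> N2" for x y
  proof -
    define x' where "x' = (SOME x'. x' \<in> N1 \<and> (\<exists>y'\<in>N2. (\<lambda>t. x t + y t) = (\<lambda>t. x' t + y' t)))"
    have "x' \<in> N1 \<and> (\<exists>y'\<in>N2. (\<lambda>t. x t + y t) = (\<lambda>t. x' t + y' t))"
      unfolding x'_def by (rule someI[of _ x]) (use x y in blast)
    then obtain y' where y': "x' \<in> N1" "y' \<in> N2" "(\<lambda>t. x t + y t) = (\<lambda>t. x' t + y' t)" by blast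
    have "(\<lambda>t. x' t - 1 * x t) = (\<lambda>t. y t - 1 * y' t)"
      using y'(3) by (simp add: fun_eq_iff algebra_simps)
    then have "pr (\<lambda>t. x' t - 1 * x t) = 0"
      using ann[of "\<lambda>t. x' t - 1 * x t"] fun_subspaceD(4)[OF s1 y'(1) x, of 1] fun_subspaceD(4)[OF s2 y y'(2), of 1]
      unfolding pr_def by metis
    then have "pr x' = pr x" unfolding pr_diff by simp
    then show ?thesis by (simp add: \<Phi>_def x'_def)
  qed
  obtain B b where B: "finite B" "\<And>e. e \<in> B \<Longrightarrow> b e \<in> H" and
    div: "\<And>f. f \<in> C_deg d \<Longrightarrow> \<exists>q rem. is_division d H B b f q rem"
    using division[OF H] by blast
  have "\<exists>x y. x \<in> N1 \<and> y \<in> N2 \<and> b e = (\<lambda>t. x t + y t)" if "e \<in> B" for e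
    using B(2)[OF that] by (auto simp: H_def)
  then obtain x y where xy: "\<And>e. e \<in> B \<Longrightarrow> x e \<in> N1 \<and> y e \<in> N2 \<and> b e = (\<lambda>t. x e t + y e t)" by metis
  obtain M where M: "\<And>t :: 'n mon. mdeg t = d \<Longrightarrow> theta t \<le> M" using theta_bounded by blast
  \<comment> \<open>quotients of weight at most \<open>K - theta e\<close> cannot move a monomial of degree \<open>d\<close> into \<open>F0\<close>\<close>
  obtain K where K: "\<And>t e. t \<in> F0 \<Longrightarrow> e \<in> B \<Longrightarrow> K < theta t + theta e - M"
  proof -
    have "finite ((\<lambda>(t, e). theta t + theta e - M) ` (F0 \<times> B))" using F0 B(1) by simp
    then obtain K where "\<forall>v\<in>(\<lambda>(t, e). theta t + theta e - M) ` (F0 \<times> B). K < v"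
      using bdd_below_finite[THEN bdd_below.unfold[THEN iffD1]] by (meson gt_ex lt_ex order_less_le_trans)
    then show thesis using that by force
  qed
  let ?F = "{t :: 'n mon. mdeg t = d \<and> K \<le> theta t}"
  have kill: "\<Phi> z = 0" if z: "z \<in> H" "\<forall>t\<in>?F. z t = 0" for z
  proof -
    have zd: "z \<in> C_deg d" using H z(1) by (auto simp: submod_def)
    obtain q rem where q: "\<forall>e\<in>B. hdo_series (q e) \<in> C" and eq: "z = (\<lambda>t. (\<Sum>e\<in>B. smul (q e) (b e) t) + rem t)"
      and rem: "rem \<in> C_deg d" "\<forall>t. rem t \<noteq> 0 \<longrightarrow> t \<notin> leads H"
      and bound: "\<forall>K. (\<forall>t. z t \<noteq> 0 \<longrightarrow> theta t \<le> K) \<longrightarrow> (\<forall>e\<in>B. \<forall>\<alpha>. q e \<alpha> \<noteq> 0 \<longrightarrow> theta (e + xmon \<alpha>) \<le> K)"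
      using div[OF zd] by blast
    have "(\<lambda>t. \<Sum>e\<in>B. smul (q e) (b e) t) \<in> H"
      by (rule combination_in_submod[OF H B(1)]) (use q B in auto)
    then have "(\<lambda>t. z t - 1 * (\<Sum>e\<in>B. smul (q e) (b e) t)) \<in> H" using fun_subspaceD(4)[OF sH z(1)] by blast
    then have remH: "rem \<in> H" by (simp add: eq)
    have rem0: "rem t = 0" for t
    proof (rule ccontr)
      assume "rem t \<noteq> 0"
      then obtain u where u: "lead rem u" using lead_exists[OF rem(1)] by blast
      then have "u \<in> leads H" using remH unfolding leads_def by blast
      then show False using u rem(2) by (simp add: lead_def)
    qed
    have "theta t \<le> K" if "z t \<noteq> 0" for t
      using z(2) zd that by (force simp: C_deg_def)
    then have qK: "theta e + theta (xmon \<alpha>) \<le> K" if "e \<in> B" "q e \<alpha> \<noteq> 0" for e \<alpha>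
      using bound that by (auto simp: theta_add)
    have zxy: "z = (\<lambda>t. (\<Sum>e\<in>B. smul (q e) (x e) t) + (\<Sum>e\<in>B. smul (q e) (y e) t))"
    proof -
      have "smul (q e) (b e) t = smul (q e) (x e) t + smul (q e) (y e) t" if "e \<in> B" for e t
      proof -
        have "b e = (\<lambda>t. x e t + y e t)" using xy[OF that] by blast
        then show ?thesis by (simp only: smul_add_right)
      qed
      then show ?thesis unfolding eq by (simp add: rem0 fun_eq_iff sum.distrib)
    qed
    have "smul (q e) (x e) t = 0" if e: "e \<in> B" and t: "t \<in> F0" for e t
    proof (rule ccontr)
      assume "smul (q e) (x e) t \<noteq> 0"
      then obtain \<alpha> s where *: "t = xmon \<alpha> + s" "q e \<alpha> \<noteq> 0" "x e s \<noteq> 0" by (rule smul_nz)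
      have "mdeg s = d" using xy[OF e] N1 *(3) by (auto simp: submod_def C_deg_def)
      then show False using K[OF t e] qK[OF e *(2)] M[of s] by (simp add: *(1) theta_add)
    qed
    then have "pr (\<lambda>t. \<Sum>e\<in>B. smul (q e) (x e) t) = 0" by (simp add: pr_def)
    moreover have "(\<lambda>t. \<Sum>e\<in>B. smul (q e) (x e) t) \<in> N1" "(\<lambda>t. \<Sum>e\<in>B. smul (q e) (y e) t) \<in> N2"
      using combination_in_submod[OF N1 B(1), of q x] combination_in_submod[OF N2 B(1), of q y] q xy by auto
    ultimately show ?thesis unfolding zxy by (simp add: \<Phi>)
  qed
  have "\<exists>\<phi>. \<forall>z\<in>H. \<Phi> z = (\<Sum>t\<in>?F. \<phi> t * z t)"
  proof (rule functional_of_finite_support[OF finite_theta_ge sH])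
    fix z z' assume "z \<in> H" "z' \<in> H"
    then obtain x y x' y' where *: "z = (\<lambda>t. x t + y t)" "z' = (\<lambda>t. x' t + y' t)" "x \<in> N1" "x' \<in> N1" "y \<in> N2" "y' \<in> N2"
      by (auto simp: H_def)
    have "\<Phi> (\<lambda>t. (x t + x' t) + (y t + y' t)) = pr x + pr x'"
      using \<Phi>[OF fun_subspaceD(2)[OF s1 *(3,4)] fun_subspaceD(2)[OF s2 *(5,6)]] by (simp add: pr_add)
    then show "\<Phi> (\<lambda>t. z t + z' t) = \<Phi> z + \<Phi> z'" using \<Phi> * by (simp add: add_ac)
  next
    fix c z assume "z \<in> H"
    then obtain x y where *: "z = (\<lambda>t. x t + y t)" "x \<in> N1" "y \<in> N2" by (auto simp: H_def)
    have "\<Phi> (\<lambda>t. c * x t + c * y t) = c * pr x"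
      using \<Phi>[OF fun_subspaceD(3)[OF s1 *(2)] fun_subspaceD(3)[OF s2 *(3)]] by (simp add: pr_scale)
    then show "\<Phi> (\<lambda>t. c * z t) = c * \<Phi> z" using \<Phi> * by (simp add: distrib_left)
  qed (rule kill)
  then obtain \<phi> where \<phi>: "\<And>z. z \<in> H \<Longrightarrow> \<Phi> z = (\<Sum>t\<in>?F. \<phi> t * z t)" by blast
  have "(\<Sum>t\<in>?F. \<phi> t * P t) = 0" if P: "P \<in> N2" for P
    using \<Phi>[OF fun_subspaceD(1)[OF s1] P] \<phi>[OF HI[OF fun_subspaceD(1)[OF s1] P]] by (simp add: pr_def)
  moreover have "(\<Sum>t\<in>?F. \<phi> t * P t) = pr P" if P: "P \<in> N1" for P
    using \<Phi>[OF P fun_subspaceD(1)[OF s2]] \<phi>[OF HI[OF P fun_subspaceD(1)[OF s2]]] by simp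
  ultimately show ?thesis using finite_theta_ge unfolding pr_def by blast
qed

end

section \<open>Formal and convergent operators\<close>

interpretation formal: op_class "formal_ops :: ('k::field, 'n::finite) hdo set"
proof
  show "(formal_ops :: ('k, 'n) hdo set) \<subseteq> formal_ops" ..
next
  fix P Q :: "('k, 'n) hdo" assume "P \<in> formal_ops" "Q \<in> formal_ops"
  then show "(\<lambda>t. P t + Q t) \<in> formal_ops"
    unfolding formal_ops_def mem_Collect_eq
    by (rule_tac finite_subset[OF image_mono[OF Supp_add]]) (simp add: image_Un)
next
  fix P :: "('k, 'n) hdo" and c assume "P \<in> formal_ops"
  then show "(\<lambda>t. c * P t) \<in> formal_ops" by (rule formal_ops_subset) (auto simp: Supp_def)
next
  fix P :: "('k, 'n) hdo" and S assume "P \<in> formal_ops"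
  then show "(\<lambda>t. if t \<in> S then P t else 0) \<in> formal_ops" by (rule formal_ops_subset) (auto simp: Supp_def)
next
  fix t :: "'n mon"
  have "Supp (hdo_monom t :: ('k, 'n) hdo) \<subseteq> {t}" by (auto simp: Supp_def hdo_monom_def)
  then show "(hdo_monom t :: ('k, 'n) hdo) \<in> formal_ops"
    unfolding formal_ops_def mem_Collect_eq by (rule finite_subset[OF image_mono]) simp
next
  fix P :: "('k, 'n) hdo" and p e
  have "snd ` Supp (hdo_series (\<lambda>\<alpha>. if p \<alpha> then P (e + xmon \<alpha>) else 0) :: ('k, 'n) hdo) \<subseteq> {(0, 0)}"
    by (auto simp: Supp_def hdo_series_def split: if_splits)
  then show "hdo_series (\<lambda>\<alpha>. if p \<alpha> then P (e + xmon \<alpha>) else 0) \<in> (formal_ops :: ('k, 'n) hdo set)"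
    unfolding formal_ops_def mem_Collect_eq by (rule finite_subset) simp
next
  fix g and P :: "('k, 'n) hdo" assume "hdo_series g \<in> (formal_ops :: ('k, 'n) hdo set)" "P \<in> formal_ops"
  then show "smul g P \<in> formal_ops" by (rule hdo_mult_closed)
next
  fix F :: "('k, 'n) hdo" and d assume F: "\<And>t. F t \<noteq> 0 \<Longrightarrow> mdeg t = d"
  show "F \<in> formal_ops"
    unfolding formal_ops_def mem_Collect_eq
    by (rule finite_subset[OF image_mono finite_mdeg_slices[of d]]) (use F in \<open>auto simp: Supp_def\<close>)
qed

text \<open>
  Up to a constant for each \<open>\<beta>\<close> and \<open>k\<close> this is the sum of absolute values at the point with coordinates
  \<open>exp (- \<sigma> l\<^sub>i)\<close>, so large \<open>\<sigma>\<close> means a small polydisc. In the convergent case the same weight orders monomials and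
  measures size.
\<close>

abbreviation wsum :: "real \<Rightarrow> 'n::finite mon set \<Rightarrow> (complex, 'n) hdo \<Rightarrow> real" where
  "wsum \<sigma> X P \<equiv> (\<Sum>t\<in>X. norm (P t) * exp (\<sigma> * theta t))"

definition norm_bounded :: "real \<Rightarrow> (complex, 'n::finite) hdo \<Rightarrow> bool" where
  "norm_bounded \<sigma> P \<longleftrightarrow> (\<exists>M. \<forall>X. finite X \<longrightarrow> (wsum \<sigma> X P) \<le> M)"

definition series_bounded :: "real \<Rightarrow> (nat^'n::finite \<Rightarrow> complex) \<Rightarrow> bool" where
  "series_bounded \<sigma> c \<longleftrightarrow> (\<exists>M. \<forall>X. finite X \<longrightarrow> (\<Sum>\<alpha>\<in>X. norm (c \<alpha>) * exp (\<sigma> * theta (xmon \<alpha>))) \<le> M)"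

lemma bounded_sums_iff_abs_summable:
  fixes f :: "'a \<Rightarrow> complex"
  shows "(\<exists>M. \<forall>X. finite X \<longrightarrow> (\<Sum>x\<in>X. norm (f x)) \<le> M) \<longleftrightarrow> f summable_on UNIV"
  unfolding summable_on_iff_abs_summable_on_complex abs_summable_iff_bdd_above bdd_above_def
  by auto

lemma series_bounded_mono:
  assumes "series_bounded \<sigma> c" "\<sigma> \<le> \<sigma>'"
  shows "series_bounded \<sigma>' c"
proof -
  obtain M where M: "\<And>X. finite X \<Longrightarrow> (\<Sum>\<alpha>\<in>X. norm (c \<alpha>) * exp (\<sigma> * theta (xmon \<alpha>))) \<le> M"
    using assms(1) unfolding series_bounded_def by blast
  have "\<sigma>' * theta (xmon \<alpha> :: 'a mon) \<le> \<sigma> * theta (xmon \<alpha> :: 'a mon)" for \<alpha>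
    by (rule mult_right_mono_neg[OF assms(2) theta_xmon_nonpos])
  then have "(\<Sum>\<alpha>\<in>X. norm (c \<alpha>) * exp (\<sigma>' * theta (xmon \<alpha>))) \<le> (\<Sum>\<alpha>\<in>X. norm (c \<alpha>) * exp (\<sigma> * theta (xmon \<alpha>)))" for X
    by (intro sum_mono mult_left_mono) auto
  then show ?thesis using M unfolding series_bounded_def by (meson order_trans)
qed

lemma exp_theta_xmon: "exp (\<sigma> * theta (xmon \<alpha>)) = (\<Prod>i\<in>UNIV. exp (- \<sigma> * fst lam_mu i) ^ (\<alpha> $ i))"
  by (simp add: theta_xmon sum_distrib_left exp_sum[symmetric] exp_of_nat_mult[symmetric] sum_negf mult_ac)

lemma series_bounded_iff:
  fixes c :: "nat^'n::finite \<Rightarrow> complex"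
  shows "series_bounded \<sigma> c \<longleftrightarrow> (\<lambda>\<alpha>. c \<alpha> * (\<Prod>i\<in>UNIV. complex_of_real (exp (- \<sigma> * fst lam_mu i)) ^ (\<alpha> $ i))) summable_on UNIV"
proof -
  have "norm (c \<alpha> * (\<Prod>i\<in>UNIV. complex_of_real (exp (- \<sigma> * fst lam_mu i)) ^ (\<alpha> $ i))) =
    norm (c \<alpha>) * exp (\<sigma> * theta (xmon \<alpha>))" for \<alpha>
    unfolding exp_theta_xmon by (simp add: norm_mult norm_power prod_norm[symmetric])
  then show ?thesis unfolding bounded_sums_iff_abs_summable[symmetric] series_bounded_def by simp
qed

lemma convergent_series_iff: "convergent_series c \<longleftrightarrow> (\<exists>\<sigma>>0. series_bounded \<sigma> c)"
proof
  assume "convergent_series c"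
  then obtain r where r: "r > 0" and sum: "\<And>z :: complex^'a. (\<forall>i. norm (z $ i) < r) \<Longrightarrow>
      (\<lambda>\<alpha>. c \<alpha> * (\<Prod>i\<in>UNIV. (z $ i) ^ (\<alpha> $ i))) summable_on UNIV"
    unfolding convergent_series_def by blast
  define l where "l = Min (range (fst (lam_mu :: ('a \<Rightarrow> real) \<times> _)))"
  have l: "0 < l" "l \<le> fst lam_mu i" for i :: 'a
    unfolding l_def by (auto simp: lam_mu(1))
  \<comment> \<open>so large that the point with coordinates \<open>exp (- \<sigma> l\<^sub>i)\<close> lies in the polydisc of radius \<open>r\<close>\<close>
  define \<sigma> where "\<sigma> = max 1 (1 - ln r) / l + 1"
  have \<sigma>: "\<sigma> > 0" using l by (simp add: \<sigma>_def add_pos_nonneg)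
  have "exp (- \<sigma> * fst lam_mu i) < r" for i :: 'a
  proof -
    have "1 - ln r \<le> (\<sigma> - 1) * l" using l(1) by (simp add: \<sigma>_def)
    also have "\<dots> \<le> \<sigma> * l" using l(1) by simp
    also have "\<dots> \<le> \<sigma> * fst lam_mu i" using l \<sigma> by simp
    finally have "- \<sigma> * fst lam_mu i < ln r" by simp
    then have "exp (- \<sigma> * fst lam_mu i) < exp (ln r)" by (simp only: exp_less_cancel_iff)
    then show ?thesis using r by simp
  qed
  then have "series_bounded \<sigma> c"
    unfolding series_bounded_iff using sum[of "\<chi> i. complex_of_real (exp (- \<sigma> * fst lam_mu i))"] by simp
  then show "\<exists>\<sigma>>0. series_bounded \<sigma> c" using \<sigma> by blast
next
  assume "\<exists>\<sigma>>0. series_bounded \<sigma> c"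
  then obtain \<sigma> M where \<sigma>: "\<sigma> > 0" and M: "\<And>X. finite X \<Longrightarrow> (\<Sum>\<alpha>\<in>X. norm (c \<alpha>) * exp (\<sigma> * theta (xmon \<alpha>))) \<le> M"
    unfolding series_bounded_def by blast
  define r where "r = Min (range (\<lambda>i :: 'a. exp (- \<sigma> * fst lam_mu i)))"
  have r: "0 < r" "r \<le> exp (- \<sigma> * fst lam_mu i)" for i :: 'a
  proof -
    show "0 < r" unfolding r_def by (subst Min_gr_iff) auto
    show "r \<le> exp (- \<sigma> * fst lam_mu i)" unfolding r_def by (rule Min_le) auto
  qed
  have "(\<lambda>\<alpha>. c \<alpha> * (\<Prod>i\<in>UNIV. (z $ i) ^ (\<alpha> $ i))) summable_on UNIV"
    if z: "\<forall>i. norm (z $ i) < r" for z :: "complex^'a"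
  proof -
    have zr: "norm (z $ i) \<le> exp (- \<sigma> * fst lam_mu i)" for i
      using z[rule_format, of i] r(2)[of i] by linarith
    have le: "norm (c \<alpha> * (\<Prod>i\<in>UNIV. (z $ i) ^ (\<alpha> $ i))) \<le> norm (c \<alpha>) * exp (\<sigma> * theta (xmon \<alpha>))" for \<alpha>
      unfolding exp_theta_xmon norm_mult prod_norm[symmetric] norm_power
      by (intro mult_left_mono prod_mono conjI power_mono zr) auto
    have "(\<Sum>\<alpha>\<in>X. norm (c \<alpha> * (\<Prod>i\<in>UNIV. (z $ i) ^ (\<alpha> $ i)))) \<le> M" if "finite X" for X
      using sum_mono[of X, OF le] M[OF that] by (rule order_trans)
    then show ?thesis unfolding bounded_sums_iff_abs_summable[symmetric] by blast
  qed
  then show "convergent_series c" unfolding convergent_series_def using r(1) by blast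
qed

lemma norm_bounded_iff_slices:
  fixes P :: "(complex, 'n::finite) hdo"
  assumes "P \<in> formal_ops"
  shows "norm_bounded \<sigma> P \<longleftrightarrow> (\<forall>\<beta> k. series_bounded \<sigma> (\<lambda>\<alpha>. P (\<alpha>, \<beta>, k)))"
proof
  have split: "norm (P (\<alpha>, z)) * exp (\<sigma> * theta (\<alpha>, z)) = (norm (P (\<alpha>, z)) * exp (\<sigma> * theta (xmon \<alpha>))) * exp (\<sigma> * theta (0, z))"
    for \<alpha> z
    using theta_add[of "(0, z)" "xmon \<alpha>"] by (cases z) (simp add: xmon_def exp_add[symmetric] algebra_simps)
  {
    assume "norm_bounded \<sigma> P"
    then obtain M where M: "\<And>X. finite X \<Longrightarrow> (wsum \<sigma> X P) \<le> M" unfolding norm_bounded_def by blast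
    have "(\<Sum>\<alpha>\<in>X. norm (P (\<alpha>, \<beta>, k)) * exp (\<sigma> * theta (xmon \<alpha>))) \<le> M / exp (\<sigma> * theta (0, \<beta>, k))" if X: "finite X" for X \<beta> k
    proof -
      have "(\<Sum>t\<in>(\<lambda>\<alpha>. (\<alpha>, \<beta>, k)) ` X. norm (P t) * exp (\<sigma> * theta t)) =
          (\<Sum>\<alpha>\<in>X. norm (P (\<alpha>, \<beta>, k)) * exp (\<sigma> * theta (xmon \<alpha>))) * exp (\<sigma> * theta (0, \<beta>, k))"
        unfolding sum_distrib_right split[symmetric] by (subst sum.reindex) (auto simp: inj_on_def)
      then show ?thesis using M[of "(\<lambda>\<alpha>. (\<alpha>, \<beta>, k)) ` X"] X by (simp add: field_simps)
    qed
    then show "\<forall>\<beta> k. series_bounded \<sigma> (\<lambda>\<alpha>. P (\<alpha>, \<beta>, k))" unfolding series_bounded_def by blast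
  next
    assume "\<forall>\<beta> k. series_bounded \<sigma> (\<lambda>\<alpha>. P (\<alpha>, \<beta>, k))"
    then have "\<forall>z. \<exists>M. \<forall>X. finite X \<longrightarrow> (\<Sum>\<alpha>\<in>X. norm (P (\<alpha>, z)) * exp (\<sigma> * theta (xmon \<alpha>))) \<le> M"
      unfolding series_bounded_def split_paired_All .
    from choice[OF this] obtain M
      where M: "\<And>z X. finite X \<Longrightarrow> (\<Sum>\<alpha>\<in>X. norm (P (\<alpha>, z)) * exp (\<sigma> * theta (xmon \<alpha>))) \<le> M z"
      by blast
    define Z where "Z = snd ` Supp P"
    have Z: "finite Z" using assms by (simp add: Z_def formal_ops_def)
    have "(wsum \<sigma> X P) \<le> (\<Sum>z\<in>Z. M z * exp (\<sigma> * theta (0, z)))" if X: "finite X" for X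
    proof -
      have "(wsum \<sigma> X P) = (wsum \<sigma> (X \<inter> Supp P) P)"
        using X by (intro sum.mono_neutral_right) (auto simp: Supp_def)
      also have "\<dots> \<le> (\<Sum>t\<in>fst ` X \<times> Z. norm (P t) * exp (\<sigma> * theta t))"
      proof (rule sum_mono2)
        show "X \<inter> Supp P \<subseteq> fst ` X \<times> Z" by (force simp: Z_def)
      qed (use X Z in auto)
      also have "\<dots> = (\<Sum>z\<in>Z. \<Sum>\<alpha>\<in>fst ` X. norm (P (\<alpha>, z)) * exp (\<sigma> * theta (\<alpha>, z)))"
        by (subst sum.swap) (simp add: sum.cartesian_product)
      also have "\<dots> \<le> (\<Sum>z\<in>Z. M z * exp (\<sigma> * theta (0, z)))"
      proof (rule sum_mono)
        fix z assume "z \<in> Z"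
        have "(\<Sum>\<alpha>\<in>fst ` X. norm (P (\<alpha>, z)) * exp (\<sigma> * theta (\<alpha>, z))) =
          (\<Sum>\<alpha>\<in>fst ` X. norm (P (\<alpha>, z)) * exp (\<sigma> * theta (xmon \<alpha>))) * exp (\<sigma> * theta (0, z))"
          unfolding sum_distrib_right split[symmetric] ..
        also have "\<dots> \<le> M z * exp (\<sigma> * theta (0, z))" using M[of "fst ` X" z] X by simp
        finally show "(\<Sum>\<alpha>\<in>fst ` X. norm (P (\<alpha>, z)) * exp (\<sigma> * theta (\<alpha>, z))) \<le> M z * exp (\<sigma> * theta (0, z))" .
      qed
      finally show ?thesis .
    qed
    then show "norm_bounded \<sigma> P" unfolding norm_bounded_def by blast
  }
qed

lemma convergent_ops_iff: "P \<in> convergent_ops \<longleftrightarrow> P \<in> formal_ops \<and> (\<exists>\<sigma>>0. norm_bounded \<sigma> P)"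
proof (intro iffI conjI; (elim conjE)?)
  assume P: "P \<in> convergent_ops"
  then show f: "P \<in> formal_ops" by (simp add: convergent_ops_def)
  define Z where "Z = snd ` Supp P"
  have Z: "finite Z" using f by (simp add: Z_def formal_ops_def)
  have "\<exists>\<sigma>>0. series_bounded \<sigma> (\<lambda>\<alpha>. P (\<alpha>, z))" for z
    using P by (cases z) (simp add: convergent_ops_def convergent_series_iff)
  then obtain s where s: "\<And>z. s z > 0 \<and> series_bounded (s z) (\<lambda>\<alpha>. P (\<alpha>, z))" by metis
  define \<sigma> where "\<sigma> = Max (insert 1 (s ` Z))"
  have "series_bounded \<sigma> (\<lambda>\<alpha>. P (\<alpha>, \<beta>, k))" for \<beta> k
  proof (cases "(\<beta>, k) \<in> Z")
    case True
    then have "s (\<beta>, k) \<le> \<sigma>" using Z by (simp add: \<sigma>_def)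
    then show ?thesis using s series_bounded_mono by blast
  next
    case False
    then have "P (\<alpha>, \<beta>, k) = 0" for \<alpha> by (force simp: Z_def Supp_def image_iff)
    then show ?thesis by (auto simp: series_bounded_def)
  qed
  moreover have "\<sigma> > 0" using Z by (simp add: \<sigma>_def Max_gr_iff)
  ultimately show "\<exists>\<sigma>>0. norm_bounded \<sigma> P" using norm_bounded_iff_slices[OF f] by blast
next
  assume "P \<in> formal_ops" "\<exists>\<sigma>>0. norm_bounded \<sigma> P"
  then show "P \<in> convergent_ops"
    using norm_bounded_iff_slices unfolding convergent_ops_def convergent_series_iff by blast
qed

lemma norm_bounded_mono: "P \<in> formal_ops \<Longrightarrow> norm_bounded \<sigma> P \<Longrightarrow> \<sigma> \<le> \<sigma>' \<Longrightarrow> norm_bounded \<sigma>' P"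
  using norm_bounded_iff_slices series_bounded_mono by blast

lemma norm_smul_sum_le:
  fixes b :: "(complex, 'n::finite) hdo"
  assumes X: "finite X" and A: "finite A"
    and AX: "\<And>t \<alpha> s. t \<in> X \<Longrightarrow> t = xmon \<alpha> + s \<Longrightarrow> q \<alpha> \<noteq> 0 \<Longrightarrow> b s \<noteq> 0 \<Longrightarrow> \<alpha> \<in> A"
    and M: "\<And>X. finite X \<Longrightarrow> (wsum \<sigma> X b) \<le> M"
  shows "(wsum \<sigma> X (smul q b)) \<le> (\<Sum>\<alpha>\<in>A. norm (q \<alpha>) * exp (\<sigma> * theta (xmon \<alpha>))) * M"
proof -
  define g where "g = (\<lambda>(\<alpha>, s). (norm (q \<alpha>) * exp (\<sigma> * theta (xmon \<alpha>))) * (norm (b s) * exp (\<sigma> * theta s)))"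
  have g0: "0 \<le> g z" for z by (auto simp: g_def split: prod.splits)
  define Z where "Z = (\<Union>t\<in>X. xdivs t)"
  have Z: "finite Z" using X by (simp add: Z_def finite_xdivs)
  have "(wsum \<sigma> X (smul q b)) \<le> (\<Sum>t\<in>X. \<Sum>z\<in>xdivs t. g z)"
  proof (rule sum_mono)
    fix t
    have "norm (smul q b t) \<le> (\<Sum>z\<in>xdivs t. norm (case z of (\<alpha>, s) \<Rightarrow> q \<alpha> * b s))"
      unfolding smul_eq by (rule norm_sum)
    then have "norm (smul q b t) * exp (\<sigma> * theta t) \<le> (\<Sum>z\<in>xdivs t. norm (case z of (\<alpha>, s) \<Rightarrow> q \<alpha> * b s) * exp (\<sigma> * theta t))"
      by (simp add: sum_distrib_right[symmetric])
    also have "\<dots> = (\<Sum>z\<in>xdivs t. g z)"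
    proof (rule sum.cong[OF refl])
      fix z assume z: "z \<in> xdivs t"
      obtain \<alpha> s where zs: "z = (\<alpha>, s)" by (cases z)
      have "exp (\<sigma> * theta t) = exp (\<sigma> * theta (xmon \<alpha>)) * exp (\<sigma> * theta s)"
        using z by (auto simp: zs xdivs_def theta_add distrib_left exp_add)
      then show "norm (case z of (\<alpha>, s) \<Rightarrow> q \<alpha> * b s) * exp (\<sigma> * theta t) = g z"
        by (simp add: g_def zs norm_mult mult_ac)
    qed
    finally show "norm (smul q b t) * exp (\<sigma> * theta t) \<le> (\<Sum>z\<in>xdivs t. g z)" .
  qed
  also have "\<dots> = (\<Sum>z\<in>Z. g z)"
    unfolding Z_def
    by (rule sum.UNION_disjoint[symmetric]) (use X in \<open>auto simp: finite_xdivs\<close>, auto simp: xdivs_def)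
  also have "\<dots> = (\<Sum>z\<in>{z\<in>Z. g z \<noteq> 0}. g z)" using Z by (intro sum.mono_neutral_right) auto
  also have "\<dots> \<le> (\<Sum>z\<in>A \<times> snd ` Z. g z)"
  proof (rule sum_mono2)
    show "{z\<in>Z. g z \<noteq> 0} \<subseteq> A \<times> snd ` Z"
    proof
      fix z assume z: "z \<in> {z\<in>Z. g z \<noteq> 0}"
      obtain \<alpha> s where zs: "z = (\<alpha>, s)" by (cases z)
      obtain t where "t \<in> X" "t = xmon \<alpha> + s" using z by (auto simp: Z_def xdivs_def zs)
      moreover have "q \<alpha> \<noteq> 0" "b s \<noteq> 0" using z by (auto simp: g_def zs)
      ultimately have "\<alpha> \<in> A" by (rule AX)
      then show "z \<in> A \<times> snd ` Z" using z by (force simp: zs)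
    qed
  qed (use A Z g0 in auto)
  also have "\<dots> = (\<Sum>\<alpha>\<in>A. norm (q \<alpha>) * exp (\<sigma> * theta (xmon \<alpha>))) * (\<Sum>s\<in>snd ` Z. norm (b s) * exp (\<sigma> * theta s))"
    unfolding sum_product by (simp add: sum.cartesian_product g_def)
  also have "\<dots> \<le> (\<Sum>\<alpha>\<in>A. norm (q \<alpha>) * exp (\<sigma> * theta (xmon \<alpha>))) * M"
    using Z by (intro mult_left_mono M sum_nonneg) auto
  finally show ?thesis .
qed

text \<open>
  The tail has a gap \<open>\<delta> > 0\<close> below \<open>theta e\<close>, because only finitely many monomials have weight at least
  \<open>theta e - 1\<close>. Relative to \<open>exp (\<sigma> theta e)\<close> its norm therefore decays like \<open>exp (- \<sigma> \<delta>)\<close>.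
\<close>

lemma small_tail_norm_small:
  fixes r :: "(complex, 'n::finite) hdo"
  assumes r: "small_tail d e r" "norm_bounded \<sigma>0 r" and \<epsilon>: "0 < \<epsilon>"
  shows "\<exists>\<sigma>1. \<forall>\<sigma>\<ge>\<sigma>1. \<forall>X. finite X \<longrightarrow> (wsum \<sigma> X r) \<le> \<epsilon> * exp (\<sigma> * theta e)"
proof -
  obtain M where M: "\<And>X. finite X \<Longrightarrow> (wsum \<sigma>0 X r) \<le> M"
    using r(2) unfolding norm_bounded_def by blast
  have M0: "0 \<le> M" using M[of "{}"] by simp
  define N where "N = M / exp (\<sigma>0 * theta e)"
  have N0: "0 \<le> N" using M0 by (simp add: N_def)
  have "finite {t :: 'n mon. mdeg t = d \<and> theta e - 1 \<le> theta t}" by (rule finite_theta_ge)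
  then have fin: "finite ((\<lambda>t. theta e - theta t) ` {t. r t \<noteq> 0 \<and> theta e - 1 \<le> theta t})"
    by (rule_tac finite_imageI, rule_tac finite_subset) (use r(1) in \<open>auto simp: small_tail_def\<close>)
  define \<delta> where "\<delta> = Min (insert 1 ((\<lambda>t. theta e - theta t) ` {t. r t \<noteq> 0 \<and> theta e - 1 \<le> theta t}))"
  have \<delta>: "0 < \<delta>" unfolding \<delta>_def using fin r(1) by (subst Min_gr_iff) (auto simp: small_tail_def)
  have gap: "theta t - theta e \<le> - \<delta>" if "r t \<noteq> 0" for t
  proof (cases "theta e - 1 \<le> theta t")
    case True
    then have "\<delta> \<le> theta e - theta t" unfolding \<delta>_def using fin that by (intro Min_le) auto
    then show ?thesis by simp
  next
    case False
    have "\<delta> \<le> 1" unfolding \<delta>_def using fin by (intro Min_le) auto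
    then show ?thesis using False by simp
  qed
  have main: "(wsum \<sigma> X r) \<le> \<epsilon> * exp (\<sigma> * theta e)"
    if \<sigma>: "\<sigma>0 + N / (\<epsilon> * \<delta>) \<le> \<sigma>" and X: "finite X" for \<sigma> X
  proof -
    have s0: "0 \<le> \<sigma> - \<sigma>0" using \<sigma> N0 \<epsilon> \<delta> by (smt (verit) divide_nonneg_pos mult_pos_pos)
    have "norm (r t) * exp (\<sigma> * theta t) \<le> (norm (r t) * exp (\<sigma>0 * theta t)) * (exp ((\<sigma> - \<sigma>0) * theta e) * exp (- (\<sigma> - \<sigma>0) * \<delta>))" for t
    proof (cases "r t = 0")
      case False
      have "(\<sigma> - \<sigma>0) * (theta t - theta e) \<le> (\<sigma> - \<sigma>0) * - \<delta>" by (rule mult_left_mono[OF gap[OF False] s0])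
      then have "\<sigma> * theta t \<le> \<sigma>0 * theta t + ((\<sigma> - \<sigma>0) * theta e + - (\<sigma> - \<sigma>0) * \<delta>)" by (simp add: algebra_simps)
      then have "exp (\<sigma> * theta t) \<le> exp (\<sigma>0 * theta t) * (exp ((\<sigma> - \<sigma>0) * theta e) * exp (- (\<sigma> - \<sigma>0) * \<delta>))"
        by (simp add: exp_add[symmetric])
      then show ?thesis by (simp add: mult.assoc mult_left_mono)
    qed simp
    then have "(wsum \<sigma> X r) \<le>
        (wsum \<sigma>0 X r) * (exp ((\<sigma> - \<sigma>0) * theta e) * exp (- (\<sigma> - \<sigma>0) * \<delta>))"
      unfolding sum_distrib_right by (intro sum_mono)
    also have "\<dots> \<le> M * (exp ((\<sigma> - \<sigma>0) * theta e) * exp (- (\<sigma> - \<sigma>0) * \<delta>))"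
      using M[OF X] by (intro mult_right_mono) auto
    also have "\<dots> = N * exp (\<sigma> * theta e) * exp (- (\<sigma> - \<sigma>0) * \<delta>)"
      by (simp add: N_def left_diff_distrib exp_diff)
    also have "\<dots> \<le> \<epsilon> * exp (\<sigma> * theta e)"
    proof -
      have "N / \<epsilon> \<le> (\<sigma> - \<sigma>0) * \<delta>" using \<sigma> \<epsilon> \<delta> by (simp add: field_simps)
      also have "\<dots> \<le> exp ((\<sigma> - \<sigma>0) * \<delta>)" using exp_ge_add_one_self[of "(\<sigma> - \<sigma>0) * \<delta>"] by linarith
      finally have "N \<le> \<epsilon> * exp ((\<sigma> - \<sigma>0) * \<delta>)" using \<epsilon> by (simp add: field_simps)
      then have "N * exp (- ((\<sigma> - \<sigma>0) * \<delta>)) \<le> \<epsilon> * exp ((\<sigma> - \<sigma>0) * \<delta>) * exp (- ((\<sigma> - \<sigma>0) * \<delta>))"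
        by (rule mult_right_mono) simp
      then have "N * exp (- ((\<sigma> - \<sigma>0) * \<delta>)) \<le> \<epsilon>" by (simp add: mult.assoc exp_add[symmetric])
      then have "N * exp (- (\<sigma> - \<sigma>0) * \<delta>) \<le> \<epsilon>" by (simp only: mult_minus_left)
      then have "N * exp (- (\<sigma> - \<sigma>0) * \<delta>) * exp (\<sigma> * theta e) \<le> \<epsilon> * exp (\<sigma> * theta e)"
        by (rule mult_right_mono) simp
      then show ?thesis by (simp only: mult_ac)
    qed
    finally show ?thesis .
  qed
  then show ?thesis by blast
qed

text \<open>
  Let \<open>S\<close> be the norm of \<open>F\<close> restricted to the finitely many monomials of weight at least \<open>K\<close>. The recursion gives
  \<open>S \<le> M + card B * \<epsilon> * S \<le> M + S / 2\<close>, so \<open>S \<le> 2 M\<close> for every \<open>K\<close>.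
\<close>

lemma division_bound:
  fixes F :: "(complex, 'n::finite) hdo"
  assumes B: "finite B" and r: "\<And>e. e \<in> B \<Longrightarrow> small_tail d e (r e)"
    and f: "\<And>X. finite X \<Longrightarrow> (wsum \<sigma> X f) \<le> M"
    and Fd: "\<And>t. F t \<noteq> 0 \<Longrightarrow> mdeg t = d"
    and F: "\<And>t. F t = f t - (\<Sum>e\<in>B. smul (quot sel F e) (r e) t)"
    and small: "\<And>e X. e \<in> B \<Longrightarrow> finite X \<Longrightarrow>
      (wsum \<sigma> X (r e)) \<le> \<epsilon> * exp (\<sigma> * theta e)"
    and \<epsilon>: "0 \<le> \<epsilon>" "real (card B) * \<epsilon> \<le> 1 / 2"
  shows "norm_bounded \<sigma> F"
proof -
  let ?T = "\<lambda>K. {t :: 'n mon. mdeg t = d \<and> K \<le> theta t}"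
  have "(wsum \<sigma> (?T K) F) \<le> 2 * M" for K
  proof -
    define S where "S = (wsum \<sigma> (?T K) F)"
    have S0: "0 \<le> S" by (auto simp: S_def intro!: sum_nonneg)
    have part: "(wsum \<sigma> (?T K) (smul (quot sel F e) (r e))) \<le> \<epsilon> * S" if e: "e \<in> B" for e
    proof -
      define A where "A = {\<alpha>. e + xmon \<alpha> \<in> ?T K}"
      have inj: "inj_on (\<lambda>\<alpha>. e + xmon \<alpha>) A" by (auto simp: inj_on_def)
      have A: "finite A"
        by (rule finite_imageD[OF _ inj], rule finite_subset[OF _ finite_theta_ge[of d K]]) (auto simp: A_def)
      have "(wsum \<sigma> (?T K) (smul (quot sel F e) (r e))) \<le>
          (\<Sum>\<alpha>\<in>A. norm (quot sel F e \<alpha>) * exp (\<sigma> * theta (xmon \<alpha>))) * (\<epsilon> * exp (\<sigma> * theta e))"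
      proof (rule norm_smul_sum_le[OF finite_theta_ge A])
        fix t \<alpha> s assume "t \<in> ?T K" "t = xmon \<alpha> + s" "quot sel F e \<alpha> \<noteq> 0" "r e s \<noteq> 0"
        then have "mdeg (xmon \<alpha> + s) = d" "K \<le> theta (xmon \<alpha>) + theta s" "mdeg e = d" "theta s < theta e"
          using r[OF e] by (auto simp: small_tail_def theta_add)
        then show "\<alpha> \<in> A" by (auto simp: A_def theta_add)
      next
        fix X :: "'n mon set" assume "finite X"
        then show "(wsum \<sigma> X (r e)) \<le> \<epsilon> * exp (\<sigma> * theta e)"
          using small[OF e] by blast
      qed
      also have "\<dots> = \<epsilon> * (\<Sum>\<alpha>\<in>A. norm (quot sel F e \<alpha>) * exp (\<sigma> * theta (e + xmon \<alpha>)))"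
        unfolding sum_distrib_left sum_distrib_right theta_add distrib_left exp_add by (simp only: mult_ac)
      also have "\<dots> \<le> \<epsilon> * (\<Sum>\<alpha>\<in>A. norm (F (e + xmon \<alpha>)) * exp (\<sigma> * theta (e + xmon \<alpha>)))"
        by (intro mult_left_mono sum_mono mult_right_mono) (auto simp: quot_def \<epsilon>(1))
      also have "(\<Sum>\<alpha>\<in>A. norm (F (e + xmon \<alpha>)) * exp (\<sigma> * theta (e + xmon \<alpha>))) =
          (\<Sum>t\<in>(\<lambda>\<alpha>. e + xmon \<alpha>) ` A. norm (F t) * exp (\<sigma> * theta t))"
        by (simp add: sum.reindex[OF inj])
      also have "\<dots> \<le> S"
        unfolding S_def by (rule sum_mono2[OF finite_theta_ge]) (auto simp: A_def)
      finally show ?thesis using \<epsilon>(1) by (simp add: mult_left_mono)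
    qed
    have "S \<le> (\<Sum>t\<in>?T K. norm (f t) * exp (\<sigma> * theta t) + (\<Sum>e\<in>B. norm (smul (quot sel F e) (r e) t) * exp (\<sigma> * theta t)))"
      unfolding S_def
    proof (rule sum_mono)
      fix t
      have "norm (F t) \<le> norm (f t) + norm (\<Sum>e\<in>B. smul (quot sel F e) (r e) t)"
        unfolding F[of t] by (rule norm_triangle_ineq4)
      also have "\<dots> \<le> norm (f t) + (\<Sum>e\<in>B. norm (smul (quot sel F e) (r e) t))"
        using norm_sum by (intro add_left_mono)
      finally have "norm (F t) * exp (\<sigma> * theta t) \<le> (norm (f t) + (\<Sum>e\<in>B. norm (smul (quot sel F e) (r e) t))) * exp (\<sigma> * theta t)"
        by (rule mult_right_mono) simp
      then show "norm (F t) * exp (\<sigma> * theta t) \<le> norm (f t) * exp (\<sigma> * theta t) + (\<Sum>e\<in>B. norm (smul (quot sel F e) (r e) t) * exp (\<sigma> * theta t))"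
        by (simp add: distrib_right sum_distrib_right)
    qed
    also have "\<dots> = (wsum \<sigma> (?T K) f) + (\<Sum>e\<in>B. \<Sum>t\<in>?T K. norm (smul (quot sel F e) (r e) t) * exp (\<sigma> * theta t))"
      by (simp add: sum.distrib) (rule sum.swap)
    also have "\<dots> \<le> M + (\<Sum>e\<in>B. \<epsilon> * S)"
      using f[OF finite_theta_ge] part by (intro add_mono sum_mono) auto
    also have "(\<Sum>e\<in>B. \<epsilon> * S) \<le> S / 2"
      using mult_right_mono[OF \<epsilon>(2) S0] by (simp add: mult.assoc)
    finally show ?thesis unfolding S_def by simp
  qed note bound = this
  have "(wsum \<sigma> X F) \<le> 2 * M" if X: "finite X" for X
  proof -
    define K where "K = Min (insert 0 (theta ` X))"
    have "(wsum \<sigma> X F) = (wsum \<sigma> {t\<in>X. F t \<noteq> 0} F)"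
      using X by (intro sum.mono_neutral_right) auto
    also have "\<dots> \<le> (wsum \<sigma> (?T K) F)"
      by (rule sum_mono2[OF finite_theta_ge]) (use X Fd in \<open>auto simp: K_def\<close>)
    finally show ?thesis using bound[of K] by simp
  qed
  then show ?thesis unfolding norm_bounded_def by blast
qed

interpretation convergent: op_class "convergent_ops :: (complex, 'n::finite) hdo set"
proof
  show "(convergent_ops :: (complex, 'n) hdo set) \<subseteq> formal_ops" by (auto simp: convergent_ops_def)
next
  fix P Q :: "(complex, 'n) hdo" assume P: "P \<in> convergent_ops" and Q: "Q \<in> convergent_ops"
  obtain s s' where s: "s > 0" "norm_bounded s P" "s' > 0" "norm_bounded s' Q" using P Q convergent_ops_iff by blast
  define \<sigma> where "\<sigma> = max s s'"
  have b: "norm_bounded \<sigma> P" "norm_bounded \<sigma> Q"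
    using norm_bounded_mono[OF _ s(2), of \<sigma>] norm_bounded_mono[OF _ s(4), of \<sigma>] P Q by (auto simp: \<sigma>_def convergent_ops_def)
  obtain M where M: "\<And>X. finite X \<Longrightarrow> (wsum \<sigma> X P) \<le> M"
    using b(1) unfolding norm_bounded_def by blast
  obtain M' where M': "\<And>X. finite X \<Longrightarrow> (wsum \<sigma> X Q) \<le> M'"
    using b(2) unfolding norm_bounded_def by blast
  have "(\<Sum>t\<in>X. norm (P t + Q t) * exp (\<sigma> * theta t)) \<le> M + M'" if X: "finite X" for X
  proof -
    have "(\<Sum>t\<in>X. norm (P t + Q t) * exp (\<sigma> * theta t)) \<le> (\<Sum>t\<in>X. norm (P t) * exp (\<sigma> * theta t) + norm (Q t) * exp (\<sigma> * theta t))"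
      by (intro sum_mono) (simp add: distrib_right[symmetric] norm_triangle_ineq)
    then show ?thesis using M[OF X] M'[OF X] by (simp add: sum.distrib)
  qed
  then have "norm_bounded \<sigma> (\<lambda>t. P t + Q t)" unfolding norm_bounded_def by blast
  moreover have "\<sigma> > 0" using s by (simp add: \<sigma>_def)
  ultimately show "(\<lambda>t. P t + Q t) \<in> convergent_ops"
    using formal.C_add[of P Q] P Q unfolding convergent_ops_iff by blast
next
  fix P :: "(complex, 'n) hdo" and c assume P: "P \<in> convergent_ops"
  obtain s M where s: "s > 0" and M: "\<And>X. finite X \<Longrightarrow> (wsum s X P) \<le> M"
    using P unfolding convergent_ops_iff norm_bounded_def by blast
  have "(\<Sum>t\<in>X. norm (c * P t) * exp (s * theta t)) \<le> norm c * M" if "finite X" for X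
    using mult_left_mono[OF M[OF that], of "norm c"] by (simp add: norm_mult sum_distrib_left mult.assoc)
  then have "norm_bounded s (\<lambda>t. c * P t)" unfolding norm_bounded_def by blast
  then show "(\<lambda>t. c * P t) \<in> convergent_ops"
    using formal.C_scale[of P c] P s unfolding convergent_ops_iff by blast
next
  fix P :: "(complex, 'n) hdo" and S assume P: "P \<in> convergent_ops"
  have "convergent_series (\<lambda>\<alpha>. if (\<alpha>, \<beta>, k) \<in> S then P (\<alpha>, \<beta>, k) else 0)" for \<beta> k
    using convergent_series_restrict[of "\<lambda>\<alpha>. P (\<alpha>, \<beta>, k)" "{\<alpha>. (\<alpha>, \<beta>, k) \<in> S}"] P by (simp add: convergent_ops_def)
  then show "(\<lambda>t. if t \<in> S then P t else 0) \<in> convergent_ops"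
    using formal.C_restrict[of P S] P by (simp add: convergent_ops_def)
next
  fix u :: "'n mon"
  have "(\<Sum>t\<in>X. norm (hdo_monom u t :: complex) * exp (1 * theta t)) \<le> exp (theta u)" if "finite X" for X
  proof -
    have "(\<Sum>t\<in>X. norm (hdo_monom u t :: complex) * exp (1 * theta t)) = (\<Sum>t\<in>X. if t = u then exp (theta u) else 0)"
      by (rule sum.cong) (auto simp: hdo_monom_def)
    then show ?thesis using that by simp
  qed
  then have "norm_bounded 1 (hdo_monom u)" unfolding norm_bounded_def by blast
  then show "(hdo_monom u :: (complex, 'n) hdo) \<in> convergent_ops"
    unfolding convergent_ops_iff using formal.C_monom zero_less_one by blast
next
  fix P :: "(complex, 'n) hdo" and p e assume P: "P \<in> convergent_ops"
  define f where "f = (\<lambda>\<alpha>. if p \<alpha> then P (e + xmon \<alpha>) else 0)"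
  have ff: "hdo_series f \<in> formal_ops"
    unfolding f_def by (rule formal.C_slice) (use P in \<open>simp add: convergent_ops_def\<close>)
  obtain s M where s: "s > 0" and M: "\<And>X. finite X \<Longrightarrow> (wsum s X P) \<le> M"
    using P unfolding convergent_ops_iff norm_bounded_def by blast
  have fb: "(\<Sum>\<alpha>\<in>X. norm (f \<alpha>) * exp (s * theta (xmon \<alpha>))) \<le> M / exp (s * theta e)" if X: "finite X" for X
  proof -
    have "(\<Sum>\<alpha>\<in>X. norm (f \<alpha>) * exp (s * theta (xmon \<alpha>))) * exp (s * theta e) \<le>
        (\<Sum>\<alpha>\<in>X. norm (P (e + xmon \<alpha>)) * exp (s * theta (e + xmon \<alpha>)))"
      unfolding sum_distrib_right by (intro sum_mono) (auto simp: f_def theta_add distrib_left exp_add)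
    also have "\<dots> = (\<Sum>t\<in>(\<lambda>\<alpha>. e + xmon \<alpha>) ` X. norm (P t) * exp (s * theta t))"
      by (subst sum.reindex) (auto simp: inj_on_def)
    also have "\<dots> \<le> M" using X by (intro M) simp
    finally show ?thesis by (simp add: field_simps)
  qed
  have "series_bounded s f" unfolding series_bounded_def using fb by blast
  then have "convergent_series f" unfolding convergent_series_iff using s by blast
  moreover have "convergent_series (\<lambda>_ :: nat^'n. 0)"
    unfolding convergent_series_iff series_bounded_def by (intro exI[of _ 1]) auto
  ultimately have "convergent_series (\<lambda>\<alpha>. hdo_series f (\<alpha>, \<beta>, k))" for \<beta> k
    by (cases "\<beta> = 0 \<and> k = 0") (auto simp: hdo_series_def)
  then show "hdo_series (\<lambda>\<alpha>. if p \<alpha> then P (e + xmon \<alpha>) else 0) \<in> convergent_ops"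
    using ff unfolding f_def[symmetric] convergent_ops_def by simp
next
  fix g :: "nat^'n \<Rightarrow> complex" and P :: "(complex, 'n) hdo"
  assume g: "hdo_series g \<in> convergent_ops" and P: "P \<in> convergent_ops"
  have "convergent_series (\<lambda>\<alpha>. hdo_series g (\<alpha>, 0, 0))" using g by (simp add: convergent_ops_def)
  then obtain s where s: "s > 0" "series_bounded s g" unfolding convergent_series_iff hdo_series_def by auto
  obtain s' where s': "s' > 0" "norm_bounded s' P" using P convergent_ops_iff by blast
  define \<sigma> where "\<sigma> = max s s'"
  have "series_bounded \<sigma> g" "norm_bounded \<sigma> P"
    using series_bounded_mono[OF s(2)] norm_bounded_mono[OF _ s'(2)] P by (auto simp: \<sigma>_def convergent_ops_def)
  then obtain M M' where M: "\<And>X. finite X \<Longrightarrow> (\<Sum>\<alpha>\<in>X. norm (g \<alpha>) * exp (\<sigma> * theta (xmon \<alpha>))) \<le> M"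
    and M': "\<And>X. finite X \<Longrightarrow> (wsum \<sigma> X P) \<le> M'" unfolding norm_bounded_def series_bounded_def by blast
  have M'0: "0 \<le> M'" using M'[of "{}"] by simp
  have "(wsum \<sigma> X (smul g P)) \<le> M * M'" if X: "finite X" for X
  proof -
    let ?A = "fst ` (\<Union>t\<in>X. xdivs t)"
    have A: "finite ?A" using X by (auto simp: finite_xdivs)
    have "(wsum \<sigma> X (smul g P)) \<le> (\<Sum>\<alpha>\<in>?A. norm (g \<alpha>) * exp (\<sigma> * theta (xmon \<alpha>))) * M'"
      by (rule norm_smul_sum_le[OF X A _ M']) (force simp: xdivs_def)+
    also have "\<dots> \<le> M * M'" by (rule mult_right_mono[OF M[OF A] M'0])
    finally show ?thesis .
  qed
  then have "norm_bounded \<sigma> (smul g P)" unfolding norm_bounded_def by blast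
  moreover have "\<sigma> > 0" using s by (simp add: \<sigma>_def)
  ultimately show "smul g P \<in> convergent_ops"
    using formal.C_smul[of g P] g P unfolding convergent_ops_iff by blast
next
  fix B :: "'n mon set" and d and r :: "'n mon \<Rightarrow> (complex, 'n) hdo" and f F :: "(complex, 'n) hdo" and sel
  assume B: "finite B" and r: "\<And>e. e \<in> B \<Longrightarrow> small_tail d e (r e) \<and> r e \<in> convergent_ops"
    and f: "f \<in> convergent_ops" and fd: "\<And>t. f t \<noteq> 0 \<Longrightarrow> mdeg t = d" and Fd: "\<And>t. F t \<noteq> 0 \<Longrightarrow> mdeg t = d"
    and F: "\<And>t. F t = f t - (\<Sum>e\<in>B. smul (quot sel F e) (r e) t)"
  \<comment> \<open>all tails together contract by the factor 1/2; the summand 1 covers the case without divisors\<close>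
  define \<epsilon> where "\<epsilon> = 1 / (2 * (real (card B) + 1))"
  have \<epsilon>: "0 < \<epsilon>" "real (card B) * \<epsilon> \<le> 1 / 2" by (simp_all add: \<epsilon>_def field_simps)
  have ex: "\<exists>\<sigma>1. \<forall>\<sigma>\<ge>\<sigma>1. \<forall>X. finite X \<longrightarrow> (wsum \<sigma> X (r e)) \<le> \<epsilon> * exp (\<sigma> * theta e)"
    if "e \<in> B" for e
  proof -
    obtain s where "norm_bounded s (r e)" using r[OF \<open>e \<in> B\<close>] convergent_ops_iff by blast
    then show ?thesis using r[OF that] \<epsilon>(1) by (intro small_tail_norm_small) auto
  qed
  obtain s where s: "\<And>e \<sigma> X. e \<in> B \<Longrightarrow> s e \<le> \<sigma> \<Longrightarrow> finite X \<Longrightarrow>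
      (wsum \<sigma> X (r e)) \<le> \<epsilon> * exp (\<sigma> * theta e)"
    using bchoice[of B "\<lambda>e \<sigma>1. \<forall>\<sigma>\<ge>\<sigma>1. \<forall>X. finite X \<longrightarrow> (wsum \<sigma> X (r e)) \<le> \<epsilon> * exp (\<sigma> * theta e)"] ex
    by blast
  obtain s0 where s0: "s0 > 0" "norm_bounded s0 f" using f convergent_ops_iff by blast
  define \<sigma> where "\<sigma> = Max (insert s0 (s ` B))"
  have \<sigma>: "s0 \<le> \<sigma>" "\<And>e. e \<in> B \<Longrightarrow> s e \<le> \<sigma>" using B by (auto simp: \<sigma>_def)
  have "norm_bounded \<sigma> f" using norm_bounded_mono[OF _ s0(2) \<sigma>(1)] f by (simp add: convergent_ops_def)
  then obtain M where M: "\<And>X. finite X \<Longrightarrow> (wsum \<sigma> X f) \<le> M" unfolding norm_bounded_def by blast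
  have "norm_bounded \<sigma> F"
    by (rule division_bound[OF B _ M Fd F s[OF _ \<sigma>(2)]]) (use r \<epsilon> in auto)
  moreover have "F \<in> formal_ops"
    by (rule formal.C_division[of B d r f F sel, OF B _ _ fd Fd F]) (use r f in \<open>auto simp: convergent_ops_def\<close>)
  moreover have "\<sigma> > 0" using s0(1) \<sigma>(1) by simp
  ultimately show "F \<in> convergent_ops" unfolding convergent_ops_iff by blast
qed

section \<open>Admissible orders\<close>

text \<open>
  Orders are only total within one degree. The last two conditions mirror the inequalities \<open>u\<^sub>i \<le> 0\<close> and
  \<open>u\<^sub>i + v\<^sub>i \<ge> 0\<close> of \<open>W_loc\<close>; refining the order by such a weight preserves them.
\<close>

definition admissible :: "('n::finite mon \<Rightarrow> 'n mon \<Rightarrow> bool) \<Rightarrow> bool" where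
  "admissible R \<longleftrightarrow> (\<forall>t. \<not> R t t) \<and> (\<forall>r s t. R r s \<longrightarrow> R s t \<longrightarrow> R r t) \<and>
     (\<forall>s t. mdeg s = mdeg t \<longrightarrow> s \<noteq> t \<longrightarrow> R s t \<or> R t s) \<and>
     (\<forall>r s t. R s t \<longrightarrow> R (s + r) (t + r)) \<and>
     (\<forall>t \<gamma>. \<gamma> \<noteq> 0 \<longrightarrow> R (t + xmon \<gamma>) t) \<and>
     (\<forall>t \<gamma>. \<gamma> \<noteq> 0 \<longrightarrow> R (t + (0, 0, msize \<gamma>)) (t + (\<gamma>, \<gamma>, 0)))"

lemma admissibleD:
  assumes "admissible R"
  shows "\<not> R t t" "R r s \<Longrightarrow> R s t \<Longrightarrow> R r t" "mdeg s = mdeg t \<Longrightarrow> s \<noteq> t \<Longrightarrow> R s t \<or> R t s"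
    "R s t \<Longrightarrow> R (s + r) (t + r)" "\<gamma> \<noteq> 0 \<Longrightarrow> R (t + xmon \<gamma>) t"
    "\<gamma> \<noteq> 0 \<Longrightarrow> R (t + (0, 0, msize \<gamma>)) (t + (\<gamma>, \<gamma>, 0))"
proof -
  note * = assms[unfolded admissible_def]
  show "\<not> R t t" using * by (elim conjE) (erule allE)
  show "R r s \<Longrightarrow> R s t \<Longrightarrow> R r t" using *[THEN conjunct2, THEN conjunct1] by iprover
  show "mdeg s = mdeg t \<Longrightarrow> s \<noteq> t \<Longrightarrow> R s t \<or> R t s"
    using *[THEN conjunct2, THEN conjunct2, THEN conjunct1] by iprover
  show "R s t \<Longrightarrow> R (s + r) (t + r)"
    using *[THEN conjunct2, THEN conjunct2, THEN conjunct2, THEN conjunct1] by iprover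
  show "\<gamma> \<noteq> 0 \<Longrightarrow> R (t + xmon \<gamma>) t"
    using *[THEN conjunct2, THEN conjunct2, THEN conjunct2, THEN conjunct2, THEN conjunct1] by iprover
  show "\<gamma> \<noteq> 0 \<Longrightarrow> R (t + (0, 0, msize \<gamma>)) (t + (\<gamma>, \<gamma>, 0))"
    using *[THEN conjunct2, THEN conjunct2, THEN conjunct2, THEN conjunct2, THEN conjunct2] by iprover
qed

lemma wt_add: "wt w (s + t) = wt w s + wt w t"
  by (cases w; cases s; cases t) (simp add: wt_def distrib_left sum.distrib)

lemma wt_xmon_nonpos: "w \<in> W_loc \<Longrightarrow> wt w (xmon \<gamma>) \<le> 0"
  by (cases w) (auto simp: wt_def xmon_def W_loc_def intro!: sum_nonpos mult_nonpos_nonneg)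

lemma wt_xd_nonneg:
  assumes "w \<in> W_loc"
  shows "0 \<le> wt w (\<gamma>, \<gamma>, 0)"
proof -
  obtain u v where w: "w = (u, v)" by (cases w)
  have "wt w (\<gamma>, \<gamma>, 0) = (\<Sum>i\<in>UNIV. (u $ i + v $ i) * \<gamma> $ i)"
    by (simp add: w wt_def distrib_right sum.distrib)
  also have "0 \<le> \<dots>" using assms by (intro sum_nonneg) (auto simp: w W_loc_def)
  finally show ?thesis .
qed

lemma wt_h: "wt w (0, 0, k) = 0"
  by (cases w) (simp add: wt_def)

lemma smul_wt:
  assumes w: "w \<in> W_loc" and "smul c P t \<noteq> 0"
  obtains s where "P s \<noteq> 0" "wt w t \<le> wt w s"
proof -
  obtain \<alpha> s where "t = xmon \<alpha> + s" "P s \<noteq> 0" using assms(2) by (rule smul_nz)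
  then show thesis using that[of s] wt_xmon_nonpos[OF w, of \<alpha>] by (simp add: wt_add)
qed

definition theta_less :: "'n::finite mon \<Rightarrow> 'n mon \<Rightarrow> bool" where
  "theta_less s t \<longleftrightarrow> theta s < theta t"

definition refine_by :: "'n::finite weight \<Rightarrow> ('n mon \<Rightarrow> 'n mon \<Rightarrow> bool) \<Rightarrow> 'n mon \<Rightarrow> 'n mon \<Rightarrow> bool" where
  "refine_by w R s t \<longleftrightarrow> wt w s < wt w t \<or> wt w s = wt w t \<and> R s t"

lemma admissible_theta_less: "admissible (theta_less :: 'n::finite mon \<Rightarrow> _)"
proof -
  have "theta (0, 0, msize \<gamma>) < theta (\<gamma>, \<gamma>, 0)" if "\<gamma> \<noteq> 0" for \<gamma> :: "nat^'n"
  proof -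
    obtain i where i: "\<gamma> $ i \<noteq> 0" using \<open>\<gamma> \<noteq> 0\<close> by (auto simp: vec_eq_iff)
    have "(\<Sum>i\<in>UNIV. fst lam_mu i * real (\<gamma> $ i)) < (\<Sum>i\<in>UNIV. snd lam_mu i * real (\<gamma> $ i))"
    proof (rule sum_strict_mono_ex1)
      show "\<exists>j\<in>UNIV. fst lam_mu j * real (\<gamma> $ j) < snd lam_mu j * real (\<gamma> $ j)"
        using i lam_mu(2)[of i] by (intro bexI[of _ i]) auto
    qed (auto simp: lam_mu(2) mult_right_mono less_imp_le)
    then show ?thesis by (simp add: theta_def)
  qed
  then show ?thesis
    unfolding admissible_def theta_less_def
  proof (intro conjI allI impI)
    fix s t :: "'n mon" assume "mdeg s = mdeg t" "s \<noteq> t"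
    then show "theta s < theta t \<or> theta t < theta s" using theta_inj[of s t] by linarith
  qed (auto simp: theta_add theta_xmon_neg)
qed

lemma admissible_refine_by:
  assumes "w \<in> W_loc" "admissible R"
  shows "admissible (refine_by w R)"
  unfolding admissible_def
proof (intro conjI allI impI)
  fix t \<gamma> assume "\<gamma> \<noteq> (0 :: nat^'a)"
  then show "refine_by w R (t + xmon \<gamma>) t"
    using admissibleD(5)[OF assms(2), of \<gamma> t] wt_xmon_nonpos[OF assms(1), of \<gamma>] by (auto simp: refine_by_def wt_add)
  show "refine_by w R (t + (0, 0, msize \<gamma>)) (t + (\<gamma>, \<gamma>, 0))"
    using \<open>\<gamma> \<noteq> 0\<close> admissibleD(6)[OF assms(2), of \<gamma> t] wt_xd_nonneg[OF assms(1), of \<gamma>]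
    by (auto simp: refine_by_def wt_add wt_h)
next
  fix r s t assume "refine_by w R r s" "refine_by w R s t"
  then show "refine_by w R r t" using admissibleD(2)[OF assms(2), of r s t] by (auto simp: refine_by_def)
next
  fix s t :: "'a mon" assume "mdeg s = mdeg t" "s \<noteq> t"
  then show "refine_by w R s t \<or> refine_by w R t s" using admissibleD(3)[OF assms(2), of s t] by (auto simp: refine_by_def)
qed (use assms(2) in \<open>auto simp: refine_by_def wt_add intro: admissibleD(4)[OF assms(2)] dest: admissibleD(1)[OF assms(2), THEN notE]\<close>)

text \<open>
  Of two terms of a rising chain the later would be a multiple of the earlier by Dickson's lemma, in equal degree by
  a power of \<open>x\<close>; but such multiples are smaller.
\<close>

lemma wf_admissible_up:
  assumes R: "admissible R"
  shows "wf {(s, t). mdeg s = mdeg t \<and> R t s}"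
  unfolding wf_iff_no_infinite_down_chain
proof
  assume "\<exists>f. \<forall>i. (f (Suc i), f i) \<in> {(s, t). mdeg s = mdeg t \<and> R t s}"
  then obtain f where f: "\<And>i. mdeg (f (Suc i)) = mdeg (f i)" "\<And>i. R (f i) (f (Suc i))" by auto
  have lt: "mdeg (f j) = mdeg (f i) \<and> R (f i) (f j)" if "i < j" for i j
    using that by (induction j) (auto simp: f less_Suc_eq intro: admissibleD(2)[OF R])
  obtain i j r where ij: "i < j" "f j = f i + r" using dickson_mon by blast
  then have "mdeg r = 0" using lt[OF ij(1)] by simp
  then obtain \<gamma> where r: "r = xmon \<gamma>" unfolding mdeg_eq_0_iff by (elim exE)
  have "R (f i) (f i)"
  proof (cases "\<gamma> = 0")
    case True
    then show ?thesis using lt[OF ij(1)] ij(2) r by simp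
  next
    case False
    then show ?thesis using admissibleD(5)[OF R False, of "f i"] lt[OF ij(1)] ij(2) r admissibleD(2)[OF R] by metis
  qed
  then show False using admissibleD(1)[OF R] by simp
qed

definition is_min :: "('n::finite mon \<Rightarrow> 'n mon \<Rightarrow> bool) \<Rightarrow> ('k::field, 'n) hdo \<Rightarrow> 'n mon \<Rightarrow> bool" where
  "is_min R l t \<longleftrightarrow> l t \<noteq> 0 \<and> (\<forall>s. l s \<noteq> 0 \<longrightarrow> s \<noteq> t \<longrightarrow> R t s)"

definition is_max :: "('n::finite mon \<Rightarrow> 'n mon \<Rightarrow> bool) \<Rightarrow> ('k::field, 'n) hdo \<Rightarrow> 'n mon \<Rightarrow> bool" where
  "is_max R P t \<longleftrightarrow> P t \<noteq> 0 \<and> (\<forall>s. P s \<noteq> 0 \<longrightarrow> s \<noteq> t \<longrightarrow> R s t)"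

lemma finite_extremal:
  assumes "\<And>r s t. S r s \<Longrightarrow> S s t \<Longrightarrow> S r t" "finite X" "X \<noteq> {}"
    and "\<And>s t. s \<in> X \<Longrightarrow> t \<in> X \<Longrightarrow> s \<noteq> t \<Longrightarrow> S s t \<or> S t s"
  shows "\<exists>t\<in>X. \<forall>s\<in>X. s \<noteq> t \<longrightarrow> S t s"
  using assms(2-4)
proof (induction X rule: finite_ne_induct)
  case (singleton x)
  then show ?case by simp
next
  case (insert x X)
  then obtain t where t: "t \<in> X" "\<forall>s\<in>X. s \<noteq> t \<longrightarrow> S t s" by auto
  then consider "S x t" | "S t x" using insert by blast
  then show ?case
  proof cases
    case 1
    then show ?thesis using t assms(1)[OF 1] by (intro bexI[of _ x]) auto
  next
    case 2
    then show ?thesis using t by (intro bexI[of _ t]) auto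
  qed
qed

text \<open>
  The support may be infinite, but all its elements are multiples by powers of \<open>x\<close> of finitely many ones, which are
  larger. The set \<open>M\<close> does not depend on the order.
\<close>

lemma is_max_exists:
  fixes P :: "('k::field, 'n::finite) hdo"
  assumes M: "finite M" "M \<subseteq> {t. P t \<noteq> 0}" "\<And>s. P s \<noteq> 0 \<Longrightarrow> \<exists>b\<in>M. \<exists>\<gamma>. s = b + xmon \<gamma>"
    and R: "admissible R" and P: "\<And>t. P t \<noteq> 0 \<Longrightarrow> mdeg t = d" "P t0 \<noteq> 0"
  shows "\<exists>t\<in>M. is_max R P t"
proof -
  have "M \<noteq> {}" using M(3)[OF P(2)] by blast
  have "\<exists>t\<in>M. \<forall>s\<in>M. s \<noteq> t \<longrightarrow> R s t"
  proof (rule finite_extremal[where S="\<lambda>s t. R t s", OF _ M(1) \<open>M \<noteq> {}\<close>])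
    fix s t assume "s \<in> M" "t \<in> M" "s \<noteq> t"
    moreover have "P s \<noteq> 0" "P t \<noteq> 0" using calculation(1,2) M(2) by blast+
    moreover from this have "mdeg s = mdeg t" using P(1) by simp
    ultimately show "R t s \<or> R s t" using admissibleD(3)[OF R] by blast
  qed (blast intro: admissibleD(2)[OF R])
  then obtain t where t: "t \<in> M" "\<forall>s\<in>M. s \<noteq> t \<longrightarrow> R s t" by blast
  have "R s t" if s: "P s \<noteq> 0" "s \<noteq> t" for s
  proof -
    obtain b \<gamma> where b: "b \<in> M" "s = b + xmon \<gamma>" using M(3)[OF s(1)] by blast
    show ?thesis
    proof (cases "\<gamma> = 0")
      case True then show ?thesis using b t s by auto
    next
      case False
      then have "R s b" using admissibleD(5)[OF R False] b(2) by simp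
      then show ?thesis using t(2) b(1) admissibleD(2)[OF R] by (cases "b = t") auto
    qed
  qed
  then show ?thesis using t M(2) by (auto simp: is_max_def)
qed

text \<open>
  The summand of the product; \<open>\<gamma>\<close> records how often the derivations act on the coefficient.
\<close>

abbreviation leibniz_term :: "('k::field, 'n::finite) hdo \<Rightarrow> ('k, 'n) hdo \<Rightarrow> (nat^'n) \<times> 'n mon \<times> 'n mon \<Rightarrow> 'k" where
  "leibniz_term P Q z \<equiv> (case z of (\<gamma>, t, t') \<Rightarrow>
     of_nat (leibniz_coeff (fst (snd t)) (fst t') \<gamma>) * P t * Q t')"

lemma contrib_monom_sum:
  assumes "(\<gamma>, t, t') \<in> contrib J s"
  shows "s + (\<gamma>, \<gamma>, 0) = (t + t') + (0, 0, msize \<gamma>)"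
  using assms by (cases s; cases t; cases t') (auto simp: contrib_def)

lemma mdeg_xd: "mdeg (\<gamma>, \<gamma>, 0) = msize \<gamma>" "mdeg (0, 0, k) = k"
  by (simp_all add: mdeg_def)

lemma contrib_mdeg: "(\<gamma>, t, t') \<in> contrib J s \<Longrightarrow> mdeg t + mdeg t' = mdeg s"
proof -
  assume c: "(\<gamma>, t, t') \<in> contrib J s"
  have "mdeg (s + (\<gamma>, \<gamma>, 0)) = mdeg ((t + t') + (0, 0, msize \<gamma>))" using contrib_monom_sum[OF c] by simp
  then show ?thesis by (simp add: mdeg_xd)
qed

text \<open>
  Each derivation that acts on a coefficient replaces a factor \<open>x\<^sub>i \<partial>\<^sub>i\<close> by \<open>h\<close>, which lowers the monomial. Consequently
  leading monomials are multiplicative in spite of noncommutativity.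
\<close>

lemma contrib_less:
  assumes R: "admissible R" and c: "(\<gamma>, t, t') \<in> contrib J s" and "\<gamma> \<noteq> 0"
  shows "R s (t + t')"
proof -
  have "R ((t + t') + (0, 0, msize \<gamma>)) ((t + t') + (\<gamma>, \<gamma>, 0))" by (rule admissibleD(6)[OF R assms(3)])
  then have *: "R (s + (\<gamma>, \<gamma>, 0)) ((t + t') + (\<gamma>, \<gamma>, 0))" using contrib_monom_sum[OF c] by simp
  show ?thesis
  proof (rule ccontr)
    assume n: "\<not> R s (t + t')"
    have "s \<noteq> t + t'"
    proof
      assume "s = t + t'"
      then show False using * admissibleD(1)[OF R] by blast
    qed
    moreover have "mdeg s = mdeg (t + t')" using contrib_mdeg[OF c] by simp
    ultimately have "R (t + t') s" using n admissibleD(3)[OF R] by blast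
    then have "R ((t + t') + (\<gamma>, \<gamma>, 0)) (s + (\<gamma>, \<gamma>, 0))" by (rule admissibleD(4)[OF R])
    then show False using * admissibleD(1,2)[OF R] by blast
  qed
qed

lemma hdo_mult_mdeg:
  assumes "\<And>t. P t \<noteq> 0 \<Longrightarrow> mdeg t = d" "\<And>t. Q t \<noteq> 0 \<Longrightarrow> mdeg t = e" "hdo_mult J P Q s \<noteq> 0"
  shows "mdeg s = d + e"
  using assms(3) by (rule hdo_mult_nz) (use assms(1,2) contrib_mdeg in fastforce)

lemma is_max_monom_mult:
  fixes P :: "('k::field, 'n::finite) hdo"
  assumes R: "admissible R" and P: "is_max R P s"
  shows "is_max R (hdo_mult UNIV (hdo_monom r) P) (r + s)"
  unfolding is_max_def
proof (intro conjI allI impI)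
  have "hdo_mult UNIV (hdo_monom r) P (r + s) = (\<Sum>z\<in>{(0, r, s)}. leibniz_term (hdo_monom r) P z)"
    unfolding hdo_mult_alt
  proof (rule sum.mono_neutral_right[OF finite_contrib])
    show "{(0, r, s)} \<subseteq> contrib UNIV (r + s)"
      by (cases r; cases s) (auto simp: contrib_def)
    show "\<forall>z\<in>contrib UNIV (r + s) - {(0, r, s)}. (leibniz_term (hdo_monom r) P z) = 0"
    proof (rule ballI, rule ccontr)
      fix z assume z: "z \<in> contrib UNIV (r + s) - {(0, r, s)}" "(leibniz_term (hdo_monom r) P z) \<noteq> 0"
      obtain \<gamma> t t' where zz: "z = (\<gamma>, t, t')" by (cases z)
      have t: "t = r" "P t' \<noteq> 0" using z(2) by (auto simp: zz hdo_monom_def split: if_splits)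
      have c: "(\<gamma>, r, t') \<in> contrib UNIV (r + s)" using z(1) zz t by simp
      show False
      proof (cases "\<gamma> = 0")
        case True
        then have "t' = s" using contrib_monom_sum[OF c] by (simp add: zero_prod_def[symmetric])
        then show ?thesis using z(1) zz t True by simp
      next
        case False
        then have lt: "R (r + s) (r + t')" using contrib_less[OF R c] by simp
        then have "t' \<noteq> s" using admissibleD(1)[OF R] by blast
        then have "R t' s" using P t(2) by (simp add: is_max_def)
        then have "R (t' + r) (s + r)" by (rule admissibleD(4)[OF R])
        then have "R (r + t') (r + s)" by (simp only: add.commute)
        then show ?thesis using lt admissibleD(1,2)[OF R] by blast
      qed
    qed
  qed
  then show "hdo_mult UNIV (hdo_monom r) P (r + s) \<noteq> 0" using P by (simp add: hdo_monom_def is_max_def)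
next
  fix u assume u: "hdo_mult UNIV (hdo_monom r) P u \<noteq> 0" "u \<noteq> r + s"
  obtain \<gamma> t t' where c: "(\<gamma>, t, t') \<in> contrib UNIV u" "hdo_monom r t \<noteq> (0 :: 'k)" "P t' \<noteq> 0"
    using u(1) by (rule hdo_mult_nz)
  have t: "t = r" using c(2) by (auto simp: hdo_monom_def split: if_splits)
  have le: "t' = s \<or> R (r + t') (r + s)"
    using P c(3) admissibleD(4)[OF R, of t' s r] by (auto simp: is_max_def add.commute)
  show "R u (r + s)"
  proof (cases "\<gamma> = 0")
    case True
    then have "u = r + t'" using contrib_monom_sum[OF c(1)] t by (simp add: zero_prod_def[symmetric])
    then show ?thesis using le u(2) by auto
  next
    case False
    then have "R u (r + t')" using contrib_less[OF R c(1)] t by simp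
    then show ?thesis using le admissibleD(2)[OF R] by blast
  qed
qed

section \<open>Reduced bases of the dual of an ideal\<close>

definition pairing :: "('k::field, 'n::finite) hdo \<Rightarrow> ('k, 'n) hdo \<Rightarrow> 'k" where
  "pairing l P = (\<Sum>t\<in>Supp l. l t * P t)"

lemma pairing_eq: "finite F \<Longrightarrow> Supp l \<subseteq> F \<Longrightarrow> pairing l P = (\<Sum>t\<in>F. l t * P t)"
  unfolding pairing_def by (rule sum.mono_neutral_left) (auto simp: Supp_def)

text \<open>
  The spaces \<open>L d\<close> play the role of annihilators of an ideal, and this is all the combinatorics needs: \<open>L_mult\<close> says
  that the set of operators annihilated by \<open>L\<close> is closed under multiplication by monomials from the left.
\<close>

locale dual_ideal =
  fixes L :: "nat \<Rightarrow> ('k::field, 'n::finite) hdo set"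
  assumes L_fin: "l \<in> L d \<Longrightarrow> finite (Supp l)"
    and L_deg: "l \<in> L d \<Longrightarrow> l t \<noteq> 0 \<Longrightarrow> mdeg t = d"
    and L_sub: "fun_subspace (L d)"
    and L_mult: "(\<And>t. P t \<noteq> 0 \<Longrightarrow> mdeg t = d) \<Longrightarrow> (\<And>l. l \<in> L d \<Longrightarrow> pairing l P = 0) \<Longrightarrow>
       l \<in> L (mdeg r + d) \<Longrightarrow> pairing l (hdo_mult UNIV (hdo_monom r) P) = 0"
begin

text \<open>
  The complement of this set corresponds to the leading monomials of the ideal.
\<close>

definition mins :: "('n mon \<Rightarrow> 'n mon \<Rightarrow> bool) \<Rightarrow> 'n mon set" where
  "mins R = {t. \<exists>l\<in>L (mdeg t). is_min R l t}"

lemma is_min_exists: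
  assumes R: "admissible R" and l: "l \<in> L d" "l t0 \<noteq> 0"
  obtains t where "is_min R l t" "t \<in> mins R"
proof -
  have "\<exists>t\<in>Supp l. \<forall>s\<in>Supp l. s \<noteq> t \<longrightarrow> R t s"
  proof (rule finite_extremal[OF _ L_fin[OF l(1)]])
    show "Supp l \<noteq> {}" using l(2) by (auto simp: Supp_def)
    fix s t assume "s \<in> Supp l" "t \<in> Supp l" "s \<noteq> t"
    moreover have "mdeg s = mdeg t" using calculation(1,2) L_deg[OF l(1)] by (auto simp: Supp_def)
    ultimately show "R s t \<or> R t s" using admissibleD(3)[OF R] by blast
  qed (blast intro: admissibleD(2)[OF R])
  then obtain t where t: "is_min R l t" by (auto simp: is_min_def Supp_def)
  then have "mdeg t = d" using L_deg[OF l(1)] by (auto simp: is_min_def)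
  then have "t \<in> mins R" using t l(1) by (auto simp: mins_def)
  with t show ?thesis by (rule that)
qed

lemma no_mins_imp_zero:
  assumes "admissible R" "l \<in> L d" "\<And>t. t \<in> mins R \<Longrightarrow> l t = 0"
  shows "l t = 0"
  using is_min_exists[OF assms(1,2), of t] assms(3) by (auto simp: is_min_def)

text \<open>
  Starting with a functional that has lowest monomial \<open>t\<close>, the other monomials in \<open>mins R\<close> are cleared with the reduced
  functionals that belong to them. These monomials are larger than \<open>t\<close>, so the induction goes upwards.
\<close>

lemma reduced_exists:
  assumes R: "admissible R"
  shows "t \<in> mins R \<Longrightarrow> \<exists>l\<in>L (mdeg t). l t = 1 \<and> (\<forall>s. l s \<noteq> 0 \<longrightarrow> s \<noteq> t \<longrightarrow> R t s \<and> s \<notin> mins R)"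
proof (induction t rule: wf_induct_rule[OF wf_admissible_up[OF R]])
  case (1 t)
  obtain l0 where l0: "l0 \<in> L (mdeg t)" "is_min R l0 t" using "1.prems" by (auto simp: mins_def)
  define l where "l = (\<lambda>s. inverse (l0 t) * l0 s)"
  have l: "l \<in> L (mdeg t)" "l t = 1" "\<And>s. l s \<noteq> 0 \<Longrightarrow> s \<noteq> t \<Longrightarrow> R t s"
    using fun_subspaceD(3)[OF L_sub l0(1)] l0(2) by (auto simp: l_def is_min_def)
  define X where "X = {s. l s \<noteq> 0 \<and> s \<noteq> t \<and> s \<in> mins R}"
  have X: "finite X" using L_fin[OF l(1)] by (rule finite_subset[rotated]) (auto simp: X_def Supp_def)
  have "\<exists>m\<in>L (mdeg s). m s = 1 \<and> (\<forall>u. m u \<noteq> 0 \<longrightarrow> u \<noteq> s \<longrightarrow> R s u \<and> u \<notin> mins R)" if "s \<in> X" for s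
    using that l(3) L_deg[OF l(1)] by (intro "1.IH") (auto simp: X_def)
  then obtain m where m: "\<And>s. s \<in> X \<Longrightarrow> m s \<in> L (mdeg s) \<and> m s s = 1 \<and> (\<forall>u. m s u \<noteq> 0 \<longrightarrow> u \<noteq> s \<longrightarrow> R s u \<and> u \<notin> mins R)"
    by metis
  have sX: "mdeg s = mdeg t \<and> R t s \<and> s \<noteq> t \<and> s \<in> mins R" if "s \<in> X" for s
    using that l(3) L_deg[OF l(1)] by (auto simp: X_def)
  define k where "k = (\<lambda>u. l u - 1 * (\<Sum>s\<in>X. l s * m s u))"
  have "(\<lambda>u. \<Sum>s\<in>X. l s * m s u) \<in> L (mdeg t)"
    using m sX by (intro fun_subspace_sum[OF L_sub X] fun_subspaceD(3)[OF L_sub]) metis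
  then have kL: "k \<in> L (mdeg t)" unfolding k_def by (rule fun_subspaceD(4)[OF L_sub l(1)])
  have m0: "m s u = 0" if "s \<in> X" "u \<in> mins R" "u \<noteq> s" for s u
    using m[OF that(1)] that(2,3) by blast
  have kt: "k t = 1"
  proof -
    have "(\<Sum>s\<in>X. l s * m s t) = 0"
      using m0[OF _ "1.prems"] sX by (intro sum.neutral ballI) (metis mult_zero_right)
    then show ?thesis by (simp add: k_def l(2))
  qed
  have "R t u \<and> u \<notin> mins R" if u: "k u \<noteq> 0" "u \<noteq> t" for u
  proof
    show "R t u"
    proof (cases "l u = 0")
      case False
      then show ?thesis using l(3) u(2) by blast
    next
      case True
      then have "(\<Sum>s\<in>X. l s * m s u) \<noteq> 0" using u(1) by (simp add: k_def)
      then obtain s where s: "s \<in> X" "m s u \<noteq> 0" by (metis (no_types, lifting) mult_zero_right sum.neutral)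
      then show ?thesis using m[OF s(1)] sX[OF s(1)] admissibleD(2)[OF R, of t s u] by (cases "u = s") auto
    qed
    show "u \<notin> mins R"
    proof
      assume mu: "u \<in> mins R"
      have "(\<Sum>s\<in>X. l s * m s u) = l u"
      proof (cases "u \<in> X")
        case True
        have "(\<Sum>s\<in>X. l s * m s u) = (\<Sum>s\<in>{u}. l s * m s u)"
          using True X m0[OF _ mu] by (intro sum.mono_neutral_right) auto
        then show ?thesis using m[OF True] by simp
      next
        case False
        then have "l u = 0" using u(2) mu by (auto simp: X_def)
        moreover have "(\<Sum>s\<in>X. l s * m s u) = 0" using False m0[OF _ mu] by (intro sum.neutral) auto
        ultimately show ?thesis by simp
      qed
      then show False using u(1) by (simp add: k_def)
    qed
  qed
  then show ?case using kL kt by blast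
qed

definition reduced :: "('n mon \<Rightarrow> 'n mon \<Rightarrow> bool) \<Rightarrow> 'n mon \<Rightarrow> ('k, 'n) hdo" where
  "reduced R t = (SOME l. l \<in> L (mdeg t) \<and> l t = 1 \<and> (\<forall>s. l s \<noteq> 0 \<longrightarrow> s \<noteq> t \<longrightarrow> R t s \<and> s \<notin> mins R))"

lemma reduced:
  assumes "admissible R" "t \<in> mins R"
  shows "reduced R t \<in> L (mdeg t)" "reduced R t t = 1"
    "reduced R t s \<noteq> 0 \<Longrightarrow> s \<noteq> t \<Longrightarrow> R t s" "reduced R t s \<noteq> 0 \<Longrightarrow> s \<noteq> t \<Longrightarrow> s \<notin> mins R"
    "reduced R t s \<noteq> 0 \<Longrightarrow> mdeg s = mdeg t"
proof -
  have *: "reduced R t \<in> L (mdeg t) \<and> reduced R t t = 1 \<and> (\<forall>s. reduced R t s \<noteq> 0 \<longrightarrow> s \<noteq> t \<longrightarrow> R t s \<and> s \<notin> mins R)"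
    unfolding reduced_def by (rule someI_ex[OF reduced_exists[OF assms, unfolded Bex_def]])
  then show "reduced R t \<in> L (mdeg t)" "reduced R t t = 1"
    "reduced R t s \<noteq> 0 \<Longrightarrow> s \<noteq> t \<Longrightarrow> R t s" "reduced R t s \<noteq> 0 \<Longrightarrow> s \<noteq> t \<Longrightarrow> s \<notin> mins R" by auto
  show "reduced R t s \<noteq> 0 \<Longrightarrow> mdeg s = mdeg t" using * L_deg by blast
qed

lemma reduced_at_mins:
  assumes "admissible R" "t \<in> mins R" "s \<in> mins R"
  shows "reduced R t s = (if s = t then 1 else 0)"
  using reduced(2)[OF assms(1,2)] reduced(4)[OF assms(1,2), of s] assms(3) by auto

lemma reduced_expansion:
  assumes R: "admissible R" and l: "l \<in> L d"
  shows "l u = (\<Sum>t\<in>{t. l t \<noteq> 0 \<and> t \<in> mins R}. l t * reduced R t u)"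
proof -
  let ?X = "{t. l t \<noteq> 0 \<and> t \<in> mins R}"
  have X: "finite ?X" using L_fin[OF l] by (rule finite_subset[rotated]) (auto simp: Supp_def)
  have "(\<lambda>u. \<Sum>t\<in>?X. l t * reduced R t u) \<in> L d"
  proof (intro fun_subspace_sum[OF L_sub X] fun_subspaceD(3)[OF L_sub])
    fix t assume "t \<in> ?X"
    then show "reduced R t \<in> L d" using reduced(1)[OF R, of t] L_deg[OF l, of t] by simp
  qed
  then have "(\<lambda>u. l u - 1 * (\<Sum>t\<in>?X. l t * reduced R t u)) \<in> L d" by (rule fun_subspaceD(4)[OF L_sub l])
  then have "l u - 1 * (\<Sum>t\<in>?X. l t * reduced R t u) = 0"
  proof (rule no_mins_imp_zero[OF R])
    fix s assume s: "s \<in> mins R"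
    have "(\<Sum>t\<in>?X. l t * reduced R t s) = (\<Sum>t\<in>?X. if t = s then l s else 0)"
      by (rule sum.cong) (auto simp: reduced_at_mins[OF R _ s])
    then show "l s - 1 * (\<Sum>t\<in>?X. l t * reduced R t s) = 0" using X s by simp
  qed
  then show ?thesis by simp
qed

text \<open>
  The order enters the reduced basis only through the set of lowest monomials: the difference of two candidates has no
  coefficient there.
\<close>

lemma reduced_cong:
  assumes R: "admissible R" and R': "admissible R'" and eq: "mins R = mins R'" and t: "t \<in> mins R"
  shows "reduced R t = reduced R' t"
proof
  fix s
  have t': "t \<in> mins R'" using eq t by simp
  have "(\<lambda>s. reduced R t s - 1 * reduced R' t s) \<in> L (mdeg t)"
    by (rule fun_subspaceD(4)[OF L_sub reduced(1)[OF R t] reduced(1)[OF R' t']])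
  then have "reduced R t s - 1 * reduced R' t s = 0"
    by (rule no_mins_imp_zero[OF R]) (use reduced_at_mins R R' t t' eq in auto)
  then show "reduced R t s = reduced R' t s" by simp
qed

text \<open>
  If \<open>t\<close> were both the highest monomial of \<open>Q\<close> and the lowest of \<open>l\<close>, then \<open>t\<close> would be their only common monomial
  and the pairing would not vanish.
\<close>

lemma is_max_not_mins:
  assumes R: "admissible R" and Q: "is_max R Q t" and orth: "\<And>l. l \<in> L (mdeg t) \<Longrightarrow> pairing l Q = 0"
  shows "t \<notin> mins R"
proof
  assume "t \<in> mins R"
  then obtain l where l: "l \<in> L (mdeg t)" "is_min R l t" by (auto simp: mins_def)
  have "pairing l Q = (\<Sum>s\<in>{t}. l s * Q s)"
    unfolding pairing_def
  proof (rule sum.mono_neutral_right[OF L_fin[OF l(1)]])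
    show "{t} \<subseteq> Supp l" using l(2) by (simp add: is_min_def Supp_def)
    show "\<forall>s\<in>Supp l - {t}. l s * Q s = 0"
    proof (rule ballI, rule ccontr)
      fix s assume s: "s \<in> Supp l - {t}" "l s * Q s \<noteq> 0"
      then have "R t s" "R s t" using l(2) Q by (auto simp: is_min_def is_max_def)
      then show False using admissibleD(1,2)[OF R] by blast
    qed
  qed
  then show False using orth[OF l(1)] l(2) Q by (simp add: is_min_def is_max_def)
qed

text \<open>
  The element of the reduced standard basis with leading monomial \<open>s\<close>, read off from the reduced functionals; its
  support may be infinite.
\<close>

definition standard :: "('n mon \<Rightarrow> 'n mon \<Rightarrow> bool) \<Rightarrow> 'n mon \<Rightarrow> ('k, 'n) hdo" where
  "standard R s = (\<lambda>u. if u = s then 1 else if u \<in> mins R \<and> mdeg u = mdeg s then - reduced R u s else 0)"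

lemma standard_deg: "standard R s u \<noteq> 0 \<Longrightarrow> mdeg u = mdeg s"
  by (auto simp: standard_def split: if_splits)

lemma standard_supp:
  assumes "standard R s u \<noteq> 0" "u \<noteq> s"
  shows "u \<in> mins R" "reduced R u s \<noteq> 0"
  using assms by (auto simp: standard_def split: if_splits)

lemma standard_orth:
  assumes R: "admissible R" and s: "s \<notin> mins R" and l: "l \<in> L (mdeg s)"
  shows "pairing l (standard R s) = 0"
proof -
  let ?X = "{t. l t \<noteq> 0 \<and> t \<in> mins R}"
  have fin: "finite (insert s (Supp l))" using L_fin[OF l] by simp
  have X: "finite ?X" using fin by (rule finite_subset[rotated]) (auto simp: Supp_def)
  have "pairing l (standard R s) = (\<Sum>u\<in>insert s (Supp l). l u * standard R s u)"
    by (rule pairing_eq[OF fin]) auto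
  also have "\<dots> = (\<Sum>u\<in>insert s ?X. l u * standard R s u)"
    using fin by (rule sum.mono_neutral_right) (auto simp: Supp_def standard_def)
  also have "\<dots> = l s + (\<Sum>u\<in>?X. l u * standard R s u)"
    using X s by (subst sum.insert) (auto simp: standard_def)
  also have "(\<Sum>u\<in>?X. l u * standard R s u) = - (\<Sum>u\<in>?X. l u * reduced R u s)"
    unfolding sum_negf[symmetric] using s L_deg[OF l] by (intro sum.cong) (auto simp: standard_def)
  finally show ?thesis using reduced_expansion[OF R l, of s] by simp
qed

lemma standard_is_max:
  assumes R: "admissible R"
  shows "is_max R (standard R s) s"
  unfolding is_max_def
proof (intro conjI allI impI)
  fix u assume u: "standard R s u \<noteq> 0" "u \<noteq> s"
  note * = standard_supp[OF u]
  show "R u s" by (rule reduced(3)[OF R *(1) *(2)]) (use u(2) in simp)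
qed (simp add: standard_def)

lemma not_mins_add:
  assumes R: "admissible R" and P: "\<And>t. P t \<noteq> 0 \<Longrightarrow> mdeg t = mdeg s" "\<And>l. l \<in> L (mdeg s) \<Longrightarrow> pairing l P = 0"
    and max: "is_max R P s"
  shows "r + s \<notin> mins R"
  by (rule is_max_not_mins[OF R is_max_monom_mult[OF R max]]) (use L_mult[OF P] in simp)

definition nonmins :: "('n mon \<Rightarrow> 'n mon \<Rightarrow> bool) \<Rightarrow> 'n mon set" where
  "nonmins R = - mins R"

lemma nonmins_up: "admissible R \<Longrightarrow> s \<in> nonmins R \<Longrightarrow> s + r \<in> nonmins R"
  using not_mins_add[of R "standard R s" s r] standard_deg standard_orth standard_is_max
  by (auto simp: nonmins_def add.commute)

definition up_closed :: "'n mon set \<Rightarrow> bool" where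
  "up_closed U \<longleftrightarrow> (\<forall>s\<in>U. \<forall>r. s + r \<in> U)"

lemma wf_up_closed: "wf {(V, U). up_closed U \<and> up_closed V \<and> U \<subset> V}"
  unfolding wf_iff_no_infinite_down_chain
proof
  assume "\<exists>f. \<forall>i. (f (Suc i), f i) \<in> {(V, U). up_closed U \<and> up_closed V \<and> U \<subset> V}"
  then obtain f where "\<forall>i. (f (Suc i), f i) \<in> {(V, U). up_closed U \<and> up_closed V \<and> U \<subset> V}" by (elim exE)
  then have "\<forall>i. up_closed (f i) \<and> f i \<subset> f (Suc i)" by blast
  then have f: "\<And>i. up_closed (f i)" "\<And>i. f i \<subset> f (Suc i)" by blast+
  then have "\<exists>x. x \<in> f (Suc i) - f i" for i by blast
  then obtain x where x: "\<And>i. x i \<in> f (Suc i) - f i" by metis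
  have mono: "f i \<subseteq> f j" if "i \<le> j" for i j
    using lift_Suc_mono_le[of f] f(2) that by blast
  obtain i j r where ij: "i < j" "x j = x i + r" using dickson_mon by blast
  have "x i \<in> f j" using x[of i] mono[of "Suc i" j] ij(1) by auto
  then have "x j \<in> f j" using f(1) ij(2) by (auto simp: up_closed_def)
  then show False using x[of j] by blast
qed

text \<open>
  Noetherian induction on an upward closed set \<open>U\<close> that is contained in all the sets under consideration. If one of
  them, for the order \<open>R1\<close>, contains a further monomial \<open>s\<close>, then the operator \<open>g = standard R1 s\<close> is annihilated by
  all functionals, and its support avoids \<open>U\<close>. For each order, the highest monomial of \<open>g\<close> is not lowest in any
  functional and is one of finitely many, so \<open>U\<close> can be enlarged in finitely many ways that cover all cases.
\<close>

lemma finite_nonmins: "finite {nonmins R | R. admissible R}"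
proof -
  have "finite {E \<in> {nonmins R | R. admissible R}. U \<subseteq> E}" if "up_closed U" for U
    using that
  proof (induction U rule: wf_induct_rule[OF wf_up_closed])
    case (1 U)
    let ?\<E> = "\<lambda>U. {E \<in> {nonmins R | R. admissible R}. U \<subseteq> E}"
    show ?case
    proof (cases "?\<E> U \<subseteq> {U}")
      case True
      then show ?thesis by (rule finite_subset) simp
    next
      case False
      then obtain R1 s where R1: "admissible R1" "U \<subseteq> nonmins R1" and s: "s \<in> nonmins R1" "s \<notin> U" by blast
      define g where "g = standard R1 s"
      have gU: "u \<notin> U" if "g u \<noteq> 0" for u
      proof (cases "u = s")
        case False
        then have "u \<in> mins R1" using that standard_supp(1) by (simp add: g_def)
        then show ?thesis using R1(2) by (auto simp: nonmins_def)
      qed (use s in simp)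
      have "{u. g u \<noteq> 0} \<subseteq> {t. mdeg t = mdeg s}" unfolding g_def by (intro Collect_mono impI standard_deg)
      then obtain M where M: "finite M" "M \<subseteq> {u. g u \<noteq> 0}" "\<forall>u\<in>{u. g u \<noteq> 0}. \<exists>b\<in>M. \<exists>\<gamma>. u = b + xmon \<gamma>"
        by (rule dickson_xmon[THEN exE]) (elim conjE)
      let ?up = "\<lambda>m. U \<union> range (\<lambda>r. m + r)"
      have "?\<E> U \<subseteq> (\<Union>m\<in>M. ?\<E> (?up m))"
      proof
        fix E assume "E \<in> ?\<E> U"
        then obtain R where R: "admissible R" "E = nonmins R" "U \<subseteq> E" by blast
        have "\<exists>m\<in>M. is_max R g m"
        proof (rule is_max_exists[OF M(1,2) _ R(1)])
          show "g s \<noteq> 0" by (simp add: g_def standard_def)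
        qed (use M(3) standard_deg in \<open>auto simp: g_def\<close>)
        then obtain m where m: "m \<in> M" "is_max R g m" by blast
        have md: "mdeg m = mdeg s" using m(2) standard_deg[of R1 s m] by (simp add: g_def is_max_def)
        have "m \<notin> mins R"
          by (rule is_max_not_mins[OF R(1) m(2)])
             (use standard_orth[OF R1(1)] s(1) md in \<open>auto simp: g_def nonmins_def\<close>)
        then have "m \<in> nonmins R" by (simp add: nonmins_def)
        then have "range (\<lambda>r. m + r) \<subseteq> E" unfolding R(2) by (intro image_subsetI nonmins_up[OF R(1)])
        then have "?up m \<subseteq> E" using R(3) by (rule Un_least[rotated])
        then show "E \<in> (\<Union>m\<in>M. ?\<E> (?up m))" using m(1) R by blast
      qed
      moreover have "finite (?\<E> (?up m))" if m: "m \<in> M" for m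
      proof (rule "1.IH")
        have "m \<in> ?up m" by (auto intro: range_eqI[of _ _ 0])
        moreover have "m \<notin> U" using gU M(2) m by blast
        moreover have up: "up_closed (?up m)"
          using "1.prems" by (auto simp: up_closed_def add.assoc)
        ultimately show "(?up m, U) \<in> {(V, U). up_closed U \<and> up_closed V \<and> U \<subset> V}"
          using "1.prems" by blast
        show "up_closed (?up m)" by (rule up)
      qed
      ultimately show ?thesis using M(1) by (meson finite_UN_I finite_subset)
    qed
  qed
  from this[of "{}"] show ?thesis by (simp add: up_closed_def)
qed

text \<open>
  A closed condition under which refining \<open>R\<close> by \<open>w\<close> does not change the lowest monomials.
\<close>

definition cone_of :: "('n mon \<Rightarrow> 'n mon \<Rightarrow> bool) \<Rightarrow> 'n weight set" where
  "cone_of R = {w \<in> W_loc. \<forall>t\<in>mins R. \<forall>s. reduced R t s \<noteq> 0 \<longrightarrow> wt w t \<le> wt w s}"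

lemma cone_of_refine_by:
  assumes "admissible R" "w \<in> W_loc"
  shows "w \<in> cone_of (refine_by w R)"
  unfolding cone_of_def
proof (intro CollectI conjI ballI allI impI assms(2))
  fix t s assume t: "t \<in> mins (refine_by w R)" and s: "reduced (refine_by w R) t s \<noteq> 0"
  show "wt w t \<le> wt w s"
    using reduced(3)[OF admissible_refine_by[OF assms(2,1)] t s] by (cases "s = t") (auto simp: refine_by_def)
qed

text \<open>
  One order is chosen for each of the finitely many sets \<open>nonmins R\<close>. The weight \<open>w\<close> lies in the cone of the order
  that compares by \<open>w\<close> first, and hence in the cone of the chosen order with the same set.
\<close>

lemma finitely_many_cones:
  obtains \<R> where "finite \<R>" "\<And>R. R \<in> \<R> \<Longrightarrow> admissible R" "\<And>w. w \<in> W_loc \<Longrightarrow> \<exists>R\<in>\<R>. w \<in> cone_of R"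
proof -
  let ?\<E> = "{nonmins R | R. admissible R}"
  define \<rho> where "\<rho> E = (SOME R. admissible R \<and> nonmins R = E)" for E
  have \<rho>: "admissible (\<rho> E) \<and> nonmins (\<rho> E) = E" if "E \<in> ?\<E>" for E
  proof -
    have "\<exists>R. admissible R \<and> nonmins R = E" using that by blast
    then show ?thesis unfolding \<rho>_def by (rule someI_ex)
  qed
  show ?thesis
  proof (rule that[of "\<rho> ` ?\<E>"])
    fix w :: "'n weight" assume w: "w \<in> W_loc"
    let ?R = "refine_by w theta_less"
    have R: "admissible ?R" by (rule admissible_refine_by[OF w admissible_theta_less])
    then have E: "nonmins ?R \<in> ?\<E>" by blast
    have eq: "mins (\<rho> (nonmins ?R)) = mins ?R" using \<rho>[OF E] by (auto simp: nonmins_def)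
    have "reduced (\<rho> (nonmins ?R)) t = reduced ?R t" if "t \<in> mins ?R" for t
      using \<rho>[OF E] that eq by (intro reduced_cong[OF _ R eq]) auto
    then have "w \<in> cone_of (\<rho> (nonmins ?R))"
      using cone_of_refine_by[OF admissible_theta_less w] unfolding cone_of_def eq
      by (simp cong: ball_cong)
    then show "\<exists>R\<in>\<rho> ` ?\<E>. w \<in> cone_of R" using E by blast
  qed (use finite_nonmins \<rho> in auto)
qed

text \<open>
  Let \<open>e\<close> run through finitely many generators of \<open>nonmins R\<close> and compare \<open>e\<close> with finitely many monomials of
  \<open>standard R e\<close> that generate the others by powers of \<open>x\<close>. If these inequalities hold for \<open>w\<close>, then \<open>e\<close> remains
  the highest monomial of \<open>standard R e\<close> for the order \<open>R\<close> refined by \<open>w\<close>. So no monomial of \<open>nonmins R\<close> becomes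
  lowest in a functional, and the lowest monomial of a reduced functional for the refined order can only be \<open>t\<close>.
\<close>

lemma cone_of_finitely_many_inequalities:
  assumes R: "admissible R"
  obtains D where "finite D" "\<And>s t. (s, t) \<in> D \<Longrightarrow> t \<in> mins R \<and> reduced R t s \<noteq> 0"
    "\<And>w. w \<in> W_loc \<Longrightarrow> (\<And>s t. (s, t) \<in> D \<Longrightarrow> wt w t \<le> wt w s) \<Longrightarrow> w \<in> cone_of R"
proof -
  have "\<exists>B. finite B \<and> B \<subseteq> nonmins R \<and> (\<forall>s\<in>nonmins R. \<exists>b\<in>B. \<exists>r. s = b + r)"
    by (rule finite_basis_of_good_sequences) (use dickson_mon in blast)
  then obtain B where B: "finite B" "B \<subseteq> nonmins R" "\<And>s. s \<in> nonmins R \<Longrightarrow> \<exists>b\<in>B. \<exists>r. s = b + r" by blast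
  have "\<exists>M. finite M \<and> M \<subseteq> {u. standard R e u \<noteq> 0 \<and> u \<noteq> e} \<and>
      (\<forall>u\<in>{u. standard R e u \<noteq> 0 \<and> u \<noteq> e}. \<exists>b\<in>M. \<exists>\<gamma>. u = b + xmon \<gamma>)" for e
    by (rule dickson_xmon[of _ "mdeg e"]) (intro Collect_mono impI, elim conjE, rule standard_deg)
  then have "\<forall>e. \<exists>M. finite M \<and> M \<subseteq> {u. standard R e u \<noteq> 0 \<and> u \<noteq> e} \<and>
      (\<forall>u\<in>{u. standard R e u \<noteq> 0 \<and> u \<noteq> e}. \<exists>b\<in>M. \<exists>\<gamma>. u = b + xmon \<gamma>)" by blast
  from choice[OF this] obtain M where Mall: "\<forall>e. finite (M e) \<and> M e \<subseteq> {u. standard R e u \<noteq> 0 \<and> u \<noteq> e} \<and>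
      (\<forall>u\<in>{u. standard R e u \<noteq> 0 \<and> u \<noteq> e}. \<exists>b\<in>M e. \<exists>\<gamma>. u = b + xmon \<gamma>)" by (elim exE)
  have M: "finite (M e)" "M e \<subseteq> {u. standard R e u \<noteq> 0 \<and> u \<noteq> e}"
    "standard R e u \<noteq> 0 \<Longrightarrow> u \<noteq> e \<Longrightarrow> \<exists>b\<in>M e. \<exists>\<gamma>. u = b + xmon \<gamma>" for e u
    using spec[OF Mall, of e] by simp_all
  define D where "D = (SIGMA e:B. M e)"
  show ?thesis
  proof (rule that[of D])
    show "finite D" using B(1) M(1) by (simp add: D_def)
    show "t \<in> mins R \<and> reduced R t s \<noteq> 0" if "(s, t) \<in> D" for s t
      using that M(2)[of s] standard_supp[of R s t] by (auto simp: D_def)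
    fix w :: "'n weight" assume w: "w \<in> W_loc" and le: "\<And>s t. (s, t) \<in> D \<Longrightarrow> wt w t \<le> wt w s"
    let ?R = "refine_by w R"
    have R': "admissible ?R" by (rule admissible_refine_by[OF w R])
    have max: "is_max ?R (standard R e) e" if e: "e \<in> B" for e
      unfolding is_max_def
    proof (intro conjI allI impI)
      fix u assume u: "standard R e u \<noteq> 0" "u \<noteq> e"
      obtain b \<gamma> where b: "b \<in> M e" "u = b + xmon \<gamma>" using M(3)[OF u] by blast
      have "wt w u \<le> wt w b" using wt_xmon_nonpos[OF w, of \<gamma>] b(2) by (simp add: wt_add)
      also have "\<dots> \<le> wt w e" using le b(1) e by (auto simp: D_def)
      finally show "?R u e" using standard_is_max[OF R, of e] u by (auto simp: is_max_def refine_by_def)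
    qed (simp add: standard_def)
    have "nonmins R \<subseteq> nonmins ?R"
    proof
      fix s assume "s \<in> nonmins R"
      then obtain e r where e: "e \<in> B" "s = e + r" using B(3) by blast
      have "e \<notin> mins R" using B(2) e(1) by (auto simp: nonmins_def)
      then have "r + e \<notin> mins ?R"
        by (intro not_mins_add[OF R' _ _ max[OF e(1)]] standard_deg standard_orth[OF R])
      then show "s \<in> nonmins ?R" by (simp add: e(2) nonmins_def add.commute)
    qed
    then have sub: "mins ?R \<subseteq> mins R" by (auto simp: nonmins_def)
    show "w \<in> cone_of R"
      unfolding cone_of_def
    proof (intro CollectI conjI ballI allI impI w)
      fix t s assume t: "t \<in> mins R" and s: "reduced R t s \<noteq> 0"
      obtain t' where t': "is_min ?R (reduced R t) t'" "t' \<in> mins ?R"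
        by (rule is_min_exists[OF R' reduced(1)[OF R t] s])
      have "t' = t" using reduced_at_mins[OF R t, of t'] t' sub by (auto simp: is_min_def split: if_splits)
      then show "wt w t \<le> wt w s" using t'(1) s by (cases "s = t") (auto simp: is_min_def refine_by_def)
    qed
  qed
qed

end

section \<open>Initial ideals and their duals\<close>

lemma inv_add_monoid_hdo_ring:
  fixes x :: "('k::field, 'n::finite) hdo"
  assumes "x \<in> C" "(\<lambda>t. - x t) \<in> C"
  shows "inv\<^bsub>add_monoid (hdo_ring J C)\<^esub> x = (\<lambda>t. - x t)"
  unfolding m_inv_def
  by (rule the_equality) (use assms in \<open>auto simp: hdo_ring_def fun_eq_iff eq_neg_iff_add_eq_0 add.commute\<close>)

lemma left_idealI:
  assumes "H \<subseteq> C" "fun_subspace H" "\<And>P Q. P \<in> C \<Longrightarrow> Q \<in> H \<Longrightarrow> hdo_mult J P Q \<in> H"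
  shows "left_ideal H (hdo_ring J C)"
proof -
  have neg: "(\<lambda>t. - x t) \<in> H" if "x \<in> H" for x
    using fun_subspaceD(3)[OF assms(2) that, of "- 1"] by simp
  have "subgroup H (add_monoid (hdo_ring J C))"
  proof
    fix x assume "x \<in> H"
    then show "inv\<^bsub>add_monoid (hdo_ring J C)\<^esub> x \<in> H"
      using neg assms(1) by (subst inv_add_monoid_hdo_ring) auto
  qed (use assms fun_subspaceD[OF assms(2)] in \<open>auto simp: hdo_ring_def\<close>)
  then show ?thesis
    using assms(3) by (auto simp: left_ideal_def additive_subgroup_def hdo_ring_def)
qed

lemma left_idealD:
  assumes "left_ideal H (hdo_ring J C)"
  shows "H \<subseteq> C" "(\<lambda>_. 0) \<in> H" "P \<in> H \<Longrightarrow> Q \<in> H \<Longrightarrow> (\<lambda>t. P t + Q t) \<in> H"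
    "P \<in> C \<Longrightarrow> Q \<in> H \<Longrightarrow> hdo_mult J P Q \<in> H"
proof -
  have sg: "subgroup H (add_monoid (hdo_ring J C))"
    using assms by (auto simp: left_ideal_def additive_subgroup_def)
  show "H \<subseteq> C" using subgroup.subset[OF sg] by (simp add: hdo_ring_def)
  show "(\<lambda>_. 0) \<in> H" using subgroup.one_closed[OF sg] by (simp add: hdo_ring_def)
  show "P \<in> H \<Longrightarrow> Q \<in> H \<Longrightarrow> (\<lambda>t. P t + Q t) \<in> H"
    using subgroup.m_closed[OF sg, of P Q] by (simp add: hdo_ring_def)
  show "P \<in> C \<Longrightarrow> Q \<in> H \<Longrightarrow> hdo_mult J P Q \<in> H"
    using assms by (auto simp: left_ideal_def hdo_ring_def)
qed

definition hpart :: "nat \<Rightarrow> ('k::field, 'n::finite) hdo \<Rightarrow> ('k, 'n) hdo" where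
  "hpart d P = (\<lambda>t. if mdeg t = d then P t else 0)"

lemma hpart_add: "hpart d (\<lambda>t. P t + Q t) = (\<lambda>t. hpart d P t + hpart d Q t)"
  by (auto simp: hpart_def)

lemma symb_add: "symb w m (\<lambda>t. P t + Q t) = (\<lambda>t. symb w m P t + symb w m Q t)"
  by (auto simp: symb_def)

lemma hpart_mult:
  "hpart d (hdo_mult J Q P) = (\<lambda>s. \<Sum>i\<in>{..d}. hdo_mult J (hpart i Q) (hpart (d - i) P) s)"
proof
  fix s
  show "hpart d (hdo_mult J Q P) s = (\<Sum>i\<in>{..d}. hdo_mult J (hpart i Q) (hpart (d - i) P) s)"
  proof (cases "mdeg s = d")
    case True
    have "(\<Sum>i\<in>{..d}. hdo_mult J (hpart i Q) (hpart (d - i) P) s) =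
      (\<Sum>z\<in>contrib J s. \<Sum>i\<in>{..d}. leibniz_term (hpart i Q) (hpart (d - i) P) z)"
      unfolding hdo_mult_alt by (rule sum.swap)
    also have "\<dots> = hdo_mult J Q P s"
      unfolding hdo_mult_alt
    proof (rule sum.cong[OF refl])
      fix z assume z: "z \<in> contrib J s"
      obtain \<gamma> t t' where zz: "z = (\<gamma>, t, t')" by (cases z)
      have deg: "mdeg t + mdeg t' = d" using contrib_mdeg[of \<gamma> t t' J s] z True by (simp add: zz)
      have "(\<Sum>i\<in>{..d}. of_nat (leibniz_coeff (fst (snd t)) (fst t') \<gamma>) * hpart i Q t * hpart (d - i) P t') =
        (\<Sum>i\<in>{mdeg t}. of_nat (leibniz_coeff (fst (snd t)) (fst t') \<gamma>) * hpart i Q t * hpart (d - i) P t')"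
        using deg by (intro sum.mono_neutral_right) (auto simp: hpart_def)
      then show "(\<Sum>i\<in>{..d}. leibniz_term (hpart i Q) (hpart (d - i) P) z) =
         (leibniz_term Q P z)"
        using deg by (auto simp: zz hpart_def)
    qed
    finally show ?thesis using True by (simp add: hpart_def)
  next
    case False
    have "hdo_mult J (hpart i Q) (hpart (d - i) P) s = 0" if "i \<le> d" for i
    proof (rule ccontr)
      assume "hdo_mult J (hpart i Q) (hpart (d - i) P) s \<noteq> 0"
      then have "mdeg s = i + (d - i)" by (rule hdo_mult_mdeg[rotated 2]) (auto simp: hpart_def split: if_splits)
      then show False using False that by simp
    qed
    then show ?thesis using False by (simp add: hpart_def)
  qed
qed

lemma wt_contrib_eq:
  assumes "w \<in> W_loc" "(\<gamma>, t, t') \<in> contrib (- P_set w) s"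
  shows "wt w t + wt w t' = wt w s"
proof -
  obtain u v where w: "w = (u, v)" by (cases w)
  have "(u $ i + v $ i) * real (\<gamma> $ i) = 0" for i
  proof (cases "i \<in> P_set w")
    case True
    then show ?thesis using assms(2) by (cases s) (auto simp: contrib_def)
  next
    case False
    have "0 \<le> u $ i + v $ i" using assms(1) by (auto simp: w W_loc_def)
    then show ?thesis using False by (auto simp: w P_set_def)
  qed
  then have "(\<Sum>i\<in>UNIV. (u $ i + v $ i) * real (\<gamma> $ i)) = 0" by (intro sum.neutral ballI)
  then show ?thesis using wt_contrib[OF assms(2), of u v] by (simp add: w)
qed

lemma wt_contrib_ge:
  assumes "w \<in> W_loc" "(\<gamma>, t, t') \<in> contrib J s"
  shows "wt w s \<le> wt w t + wt w t'"
proof -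
  obtain u v where w: "w = (u, v)" by (cases w)
  have "0 \<le> (\<Sum>i\<in>UNIV. (u $ i + v $ i) * real (\<gamma> $ i))"
    using assms(1) by (intro sum_nonneg) (auto simp: w W_loc_def)
  then show ?thesis using wt_contrib[OF assms(2), of u v] by (simp add: w)
qed

lemma symb_mult_expand:
  assumes w: "w \<in> W_loc" and M: "finite M" "\<And>t. Q t \<noteq> 0 \<Longrightarrow> wt w t \<in> M"
  shows "symb w m (hdo_mult (- P_set w) Q f) =
    (\<lambda>s. \<Sum>a\<in>M. hdo_mult (- P_set w) (symb w a Q) (symb w (m - a) f) s)"
proof
  fix s
  let ?J = "- P_set w"
  show "symb w m (hdo_mult ?J Q f) s = (\<Sum>a\<in>M. hdo_mult ?J (symb w a Q) (symb w (m - a) f) s)"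
  proof (cases "wt w s = m")
    case True
    have "(\<Sum>a\<in>M. hdo_mult ?J (symb w a Q) (symb w (m - a) f) s) =
      (\<Sum>z\<in>contrib ?J s. \<Sum>a\<in>M. leibniz_term (symb w a Q) (symb w (m - a) f) z)"
      unfolding hdo_mult_alt by (rule sum.swap)
    also have "\<dots> = hdo_mult ?J Q f s"
      unfolding hdo_mult_alt
    proof (rule sum.cong[OF refl])
      fix z assume z: "z \<in> contrib ?J s"
      obtain \<gamma> t t' where zz: "z = (\<gamma>, t, t')" by (cases z)
      have wt: "wt w t + wt w t' = m" using wt_contrib_eq[OF w, of \<gamma> t t' s] z True by (simp add: zz)
      show "(\<Sum>a\<in>M. leibniz_term (symb w a Q) (symb w (m - a) f) z) =
         (leibniz_term Q f z)"
      proof (cases "Q t = 0")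
        case True
        then have "symb w a Q t = 0" for a by (simp add: symb_def)
        then show ?thesis using True by (simp add: zz)
      next
        case False
        have "(\<Sum>a\<in>M. of_nat (leibniz_coeff (fst (snd t)) (fst t') \<gamma>) * symb w a Q t * symb w (m - a) f t') =
          (\<Sum>a\<in>{wt w t}. of_nat (leibniz_coeff (fst (snd t)) (fst t') \<gamma>) * symb w a Q t * symb w (m - a) f t')"
          using M(1) M(2)[OF False] by (intro sum.mono_neutral_right) (auto simp: symb_def)
        then show ?thesis using wt by (auto simp: zz symb_def)
      qed
    qed
    finally show ?thesis using True by (simp add: symb_def)
  next
    case False
    have "hdo_mult ?J (symb w a Q) (symb w (m - a) f) s = 0" for a
    proof (rule ccontr)
      assume "hdo_mult ?J (symb w a Q) (symb w (m - a) f) s \<noteq> 0"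
      then obtain \<gamma> t t' where "(\<gamma>, t, t') \<in> contrib ?J s" "symb w a Q t \<noteq> 0" "symb w (m - a) f t' \<noteq> 0"
        by (rule hdo_mult_nz)
      then have "wt w t + wt w t' = wt w s" "wt w t = a" "wt w t' = m - a"
        using wt_contrib_eq[OF w] by (auto simp: symb_def split: if_splits)
      then show False using False by simp
    qed
    then show ?thesis using False by (simp add: symb_def)
  qed
qed

locale hom_ideal = op_class C for C :: "('k::field, 'n::finite) hdo set" +
  fixes A :: "('k, 'n) hdo ring" and I :: "('k, 'n) hdo set"
  assumes A_eq: "A = hdo_ring UNIV C" and homogeneous: "homogeneous_ideal I A"
begin

lemma carrier_A [simp]: "carrier A = C"
  by (simp add: A_eq hdo_ring_def)

lemma left_ideal_I: "left_ideal I (hdo_ring UNIV C)"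
  using homogeneous by (simp add: homogeneous_ideal_def A_eq)

lemmas I_sub = left_idealD(1)[OF left_ideal_I]
  and I_mult = left_idealD(4)[OF left_ideal_I]

lemma smul_I: "hdo_series c \<in> C \<Longrightarrow> P \<in> I \<Longrightarrow> smul c P \<in> I"
  by (rule I_mult)

lemma fun_subspace_I: "fun_subspace I"
  unfolding fun_subspace_def
proof (intro conjI ballI allI left_idealD(2,3)[OF left_ideal_I])
  fix c P assume "P \<in> I"
  then show "(\<lambda>t. c * P t) \<in> I" using smul_I[OF C_const] by (simp add: smul_const[abs_def])
qed

lemma hpart_C: "P \<in> C \<Longrightarrow> hpart d P \<in> C"
  using C_restrict[of P "{t. mdeg t = d}"] by (simp add: hpart_def)

lemma symb_C: "P \<in> C \<Longrightarrow> symb w m P \<in> C"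
  using C_restrict[of P "{t. wt w t = m}"] by (simp add: symb_def)

text \<open>
  The elements of \<open>I\<close> all of whose homogeneous parts lie in \<open>I\<close> form an ideal that contains the generators.
\<close>

lemma hpart_I:
  assumes "P \<in> I"
  shows "hpart d P \<in> I"
proof -
  obtain G where G: "G \<subseteq> C" "\<And>P. P \<in> G \<Longrightarrow> homogeneous_op P" "I = gen_left_ideal A G"
    using homogeneous by (auto simp: homogeneous_ideal_def)
  define H where "H = {P \<in> I. \<forall>d. hpart d P \<in> I}"
  have "left_ideal H (hdo_ring UNIV C)"
  proof (rule left_idealI)
    show "H \<subseteq> C" using I_sub by (auto simp: H_def)
    have "(\<lambda>t. hpart d P t + hpart d Q t) \<in> I" if "hpart d P \<in> I" "hpart d Q \<in> I" for d P Q
      by (rule fun_subspaceD(2)[OF fun_subspace_I that])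
    moreover have "hpart d (\<lambda>t. c * P t) \<in> I" if "hpart d P \<in> I" for c d P
      using fun_subspaceD(3)[OF fun_subspace_I that, of c] by (simp add: hpart_def if_distrib cong: if_cong)
    moreover have "hpart d (\<lambda>_. 0) \<in> I" for d
      using fun_subspaceD(1)[OF fun_subspace_I] by (simp add: hpart_def)
    ultimately show "fun_subspace H"
      unfolding fun_subspace_def H_def by (auto simp: hpart_add fun_subspaceD[OF fun_subspace_I])
    fix Q P assume Q: "Q \<in> C" and P: "P \<in> H"
    have "hpart d (hdo_mult UNIV Q P) \<in> I" for d
      unfolding hpart_mult
      by (intro fun_subspace_sum[OF fun_subspace_I] I_mult hpart_C Q) (use P in \<open>auto simp: H_def\<close>)
    then show "hdo_mult UNIV Q P \<in> H" using I_mult[OF Q] P by (simp add: H_def)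
  qed
  moreover have "G \<subseteq> H"
  proof
    fix P assume P: "P \<in> G"
    have PI: "P \<in> I" using P unfolding G(3) gen_left_ideal_def by blast
    obtain e where e: "\<forall>(\<alpha>, \<beta>, k)\<in>Supp P. msize \<beta> + k = e" using G(2)[OF P] by (auto simp: homogeneous_op_def)
    then have e: "mdeg t = e" if "P t \<noteq> 0" for t using that by (cases t) (auto simp: Supp_def mdeg_def)
    have "hpart d P = P \<or> hpart d P = (\<lambda>_. 0)" for d
    proof (cases "d = e")
      case True then show ?thesis using e by (auto simp: hpart_def fun_eq_iff)
    next
      case False
      then have "hpart d P t = 0" for t using e[of t] by (auto simp: hpart_def)
      then show ?thesis by auto
    qed
    then have "hpart d P \<in> I" for d using PI fun_subspaceD(1)[OF fun_subspace_I] by metis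
    then show "P \<in> H" using PI by (simp add: H_def)
  qed
  ultimately have "I \<subseteq> H" unfolding G(3) gen_left_ideal_def A_eq by blast
  then show ?thesis using assms by (auto simp: H_def)
qed

text \<open>
  The image of \<open>I \<inter> F(m)\<close> in the graded piece \<open>F(m) / F(< m)\<close>.
\<close>

definition symbols :: "'n weight \<Rightarrow> real \<Rightarrow> ('k, 'n) hdo set" where
  "symbols w m = {symb w m P | P. P \<in> I \<and> (\<forall>t. P t \<noteq> 0 \<longrightarrow> wt w t \<le> m)}"

lemma symbols_C: "f \<in> symbols w m \<Longrightarrow> f \<in> C"
  using I_sub by (auto simp: symbols_def intro: symb_C)

lemma symbols_wt: "f \<in> symbols w m \<Longrightarrow> f t \<noteq> 0 \<Longrightarrow> wt w t = m"
  by (auto simp: symbols_def symb_def split: if_splits)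

lemma fun_subspace_symbols: "fun_subspace (symbols w m)"
  unfolding fun_subspace_def
proof (intro conjI ballI allI)
  show "(\<lambda>_. 0) \<in> symbols w m"
    using fun_subspaceD(1)[OF fun_subspace_I] by (auto simp: symbols_def symb_def intro!: exI[of _ "\<lambda>_. 0"])
next
  fix f g assume "f \<in> symbols w m" "g \<in> symbols w m"
  then obtain P Q where *: "f = symb w m P" "P \<in> I" "\<forall>t. P t \<noteq> 0 \<longrightarrow> wt w t \<le> m"
    "g = symb w m Q" "Q \<in> I" "\<forall>t. Q t \<noteq> 0 \<longrightarrow> wt w t \<le> m" by (auto simp: symbols_def)
  have "\<forall>t. P t + Q t \<noteq> 0 \<longrightarrow> wt w t \<le> m" using *(3,6) by (metis add.right_neutral add.left_neutral)
  then show "(\<lambda>t. f t + g t) \<in> symbols w m"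
    using fun_subspaceD(2)[OF fun_subspace_I *(2,5)]
    by (auto simp: symbols_def * symb_add intro!: exI[of _ "\<lambda>t. P t + Q t"])
next
  fix c f assume "f \<in> symbols w m"
  then obtain P where *: "f = symb w m P" "P \<in> I" "\<forall>t. P t \<noteq> 0 \<longrightarrow> wt w t \<le> m" by (auto simp: symbols_def)
  then show "(\<lambda>t. c * f t) \<in> symbols w m"
    using fun_subspaceD(3)[OF fun_subspace_I *(2), of c]
    by (auto simp: symbols_def symb_def fun_eq_iff intro!: exI[of _ "\<lambda>t. c * P t"])
qed

lemma gr_eq: "gr w A = hdo_ring (- P_set w) (carrier (gr w A))"
  by (simp add: gr_def hdo_ring_def)

lemma gr_iff: "w \<in> W_loc \<Longrightarrow> P \<in> carrier (gr w A) \<longleftrightarrow> P \<in> C \<and> finite (wt w ` Supp P)"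
  using gr_carrier_iff[of w A P] C_formal by simp

lemma symb_decomposition:
  assumes "finite (wt w ` Supp f)"
  shows "f = (\<lambda>t. \<Sum>m\<in>wt w ` Supp f. symb w m f t)"
proof
  fix t
  show "f t = (\<Sum>m\<in>wt w ` Supp f. symb w m f t)"
  proof (cases "f t = 0")
    case True
    then have "symb w m f t = 0" for m by (simp add: symb_def)
    then show ?thesis using True by simp
  next
    case False
    then have "wt w t \<in> wt w ` Supp f" by (auto simp: Supp_def)
    then have "(\<Sum>m\<in>wt w ` Supp f. symb w m f t) = (\<Sum>m\<in>{wt w t}. symb w m f t)"
      using assms by (intro sum.mono_neutral_right) (auto simp: symb_def)
    then show ?thesis by (simp add: symb_def)
  qed
qed

lemma symbols_mult:
  assumes w: "w \<in> W_loc" and Q: "Q \<in> C" and f: "f \<in> symbols w b"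
  shows "hdo_mult (- P_set w) (symb w a Q) f \<in> symbols w (a + b)"
proof -
  obtain P where P: "f = symb w b P" "P \<in> I" "\<forall>t. P t \<noteq> 0 \<longrightarrow> wt w t \<le> b" using f by (auto simp: symbols_def)
  let ?Q = "symb w a Q"
  have "symb w (a + b) (hdo_mult UNIV ?Q P) = hdo_mult (- P_set w) (symb w a ?Q) (symb w b P)"
    by (rule symb_mult[OF w, of _ A])
       (use P symb_C[OF Q] I_sub in \<open>auto simp: filt_def Supp_def symb_def split: if_splits\<close>)
  moreover have "symb w a ?Q = ?Q" by (auto simp: symb_def)
  moreover have "wt w s \<le> a + b" if "hdo_mult UNIV ?Q P s \<noteq> 0" for s
  proof -
    obtain \<gamma> t t' where c: "(\<gamma>, t, t') \<in> contrib UNIV s" "?Q t \<noteq> 0" "P t' \<noteq> 0"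
      using \<open>hdo_mult UNIV ?Q P s \<noteq> 0\<close> by (rule hdo_mult_nz)
    have "wt w s \<le> wt w t + wt w t'" by (rule wt_contrib_ge[OF w c(1)])
    moreover have "wt w t = a" using c(2) by (auto simp: symb_def split: if_splits)
    moreover have "wt w t' \<le> b" using P(3) c(3) by blast
    ultimately have "wt w s \<le> wt w t + wt w t'" "wt w t = a" "wt w t' \<le> b" by blast+
    then show ?thesis by simp
  qed
  moreover have "hdo_mult UNIV ?Q P \<in> I" by (rule I_mult[OF symb_C[OF Q] P(2)])
  ultimately show ?thesis
    unfolding P(1) symbols_def by (intro CollectI exI[of _ "hdo_mult UNIV ?Q P"]) simp
qed

lemma symbols_symb: "f \<in> symbols w b \<Longrightarrow> symb w m f \<in> symbols w m"
proof -
  assume f: "f \<in> symbols w b"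
  show ?thesis
  proof (cases "m = b")
    case True
    have "symb w m f t = f t" for t using symbols_wt[OF f, of t] True by (auto simp: symb_def)
    then have "symb w m f = f" by (rule ext)
    then show ?thesis using f True by simp
  next
    case False
    then have "symb w m f t = 0" for t using symbols_wt[OF f, of t] by (auto simp: symb_def)
    then have "symb w m f = (\<lambda>_. 0)" by (rule ext)
    then show ?thesis using fun_subspaceD(1)[OF fun_subspace_symbols, of w m] by simp
  qed
qed

text \<open>
  The graded pieces of \<open>in\<^sub>w(I)\<close> consist of symbols of elements of \<open>I\<close>, and no sums or multiples have to be added: the
  symbols of one weight form a subspace, and by \<open>symbols_mult\<close> they are closed under multiplication by homogeneous
  elements.
\<close>

lemma initial_ideal_iff:
  assumes w: "w \<in> W_loc"
  shows "f \<in> initial_ideal A w I \<longleftrightarrow> f \<in> carrier (gr w A) \<and> (\<forall>m. symb w m f \<in> symbols w m)"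
proof
  define T where "T = {f \<in> carrier (gr w A). \<forall>m. symb w m f \<in> symbols w m}"
  have sumI: "(\<lambda>t. \<Sum>m\<in>M. g m t) \<in> C" if "finite M" "\<And>m. m \<in> M \<Longrightarrow> g m \<in> C" for M and g :: "real \<Rightarrow> ('k, 'n) hdo"
    by (rule fun_subspace_sum[OF fun_subspace_C that])
  have "left_ideal T (hdo_ring (- P_set w) (carrier (gr w A)))"
  proof (rule left_idealI)
    show "T \<subseteq> carrier (gr w A)" by (auto simp: T_def)
    show "fun_subspace T"
      unfolding fun_subspace_def
    proof (intro conjI ballI allI)
      show "(\<lambda>_. 0) \<in> T"
        using fun_subspaceD(1)[OF fun_subspace_symbols] C_zero by (simp add: T_def gr_iff[OF w] symb_def Supp_def)
    next
      fix f g assume "f \<in> T" "g \<in> T"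
      moreover have "finite (wt w ` Supp (\<lambda>t. f t + g t))" if "finite (wt w ` Supp f)" "finite (wt w ` Supp g)"
        by (rule finite_subset[OF image_mono[OF Supp_add]]) (use that in \<open>simp add: image_Un\<close>)
      ultimately show "(\<lambda>t. f t + g t) \<in> T"
        by (auto simp: T_def gr_iff[OF w] symb_add C_add fun_subspaceD(2)[OF fun_subspace_symbols])
    next
      fix c f assume "f \<in> T"
      moreover have "finite (wt w ` Supp (\<lambda>t. c * f t))" if "finite (wt w ` Supp f)"
        by (rule finite_subset[OF image_mono that]) (auto simp: Supp_def)
      moreover have "symb w m (\<lambda>t. c * f t) = (\<lambda>t. c * symb w m f t)" for m by (auto simp: symb_def)
      ultimately show "(\<lambda>t. c * f t) \<in> T"
        by (auto simp: T_def gr_iff[OF w] C_scale fun_subspaceD(3)[OF fun_subspace_symbols])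
    qed
    fix Q f assume Q: "Q \<in> carrier (gr w A)" and f: "f \<in> T"
    let ?p = "hdo_mult (- P_set w) Q f"
    have QC: "Q \<in> C" "finite (wt w ` Supp Q)" and fT: "finite (wt w ` Supp f)" "\<And>m. symb w m f \<in> symbols w m"
      using Q f by (auto simp: gr_iff[OF w] T_def)
    have "symb w m ?p \<in> symbols w m" for m
    proof -
      have "symb w m ?p = (\<lambda>s. \<Sum>a\<in>wt w ` Supp Q. hdo_mult (- P_set w) (symb w a Q) (symb w (m - a) f) s)"
        by (rule symb_mult_expand[OF w QC(2)]) (auto simp: Supp_def)
      also have "\<dots> \<in> symbols w m"
      proof (rule fun_subspace_sum[OF fun_subspace_symbols QC(2)])
        fix a
        show "hdo_mult (- P_set w) (symb w a Q) (symb w (m - a) f) \<in> symbols w m"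
          using symbols_mult[OF w QC(1) fT(2), of a "m - a"] by simp
      qed
      finally show ?thesis .
    qed
    moreover have fin: "finite (wt w ` Supp ?p)"
    proof (rule finite_subset)
      show "wt w ` Supp ?p \<subseteq> (\<lambda>(a, b). a + b) ` (wt w ` Supp Q \<times> wt w ` Supp f)"
      proof
        fix m assume "m \<in> wt w ` Supp ?p"
        then obtain s where s: "m = wt w s" "?p s \<noteq> 0" by (auto simp: Supp_def)
        obtain \<gamma> t t' where "(\<gamma>, t, t') \<in> contrib (- P_set w) s" "Q t \<noteq> 0" "f t' \<noteq> 0" using s(2) by (rule hdo_mult_nz)
        then show "m \<in> (\<lambda>(a, b). a + b) ` (wt w ` Supp Q \<times> wt w ` Supp f)"
          using wt_contrib_eq[OF w, of \<gamma> t t' s] s(1)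
          by (intro image_eqI[of _ _ "(wt w t, wt w t')"]) (auto simp: Supp_def)
      qed
    qed (use QC fT in auto)
    moreover have "?p \<in> C"
      by (subst symb_decomposition[OF fin], rule sumI[OF fin]) (use calculation(1) symbols_C in blast)
    ultimately show "?p \<in> T" by (simp add: T_def gr_iff[OF w])
  qed
  moreover have "initial_form w ` I \<subseteq> T"
  proof
    fix f assume "f \<in> initial_form w ` I"
    then obtain P where P: "P \<in> I" "f = symb w (ord_w w P) P" by (auto simp: initial_form_def)
    have PC: "P \<in> C" using P(1) I_sub by blast
    have "f \<in> symbols w (ord_w w P)"
    proof (cases "P = (\<lambda>_. 0)")
      case True
      then show ?thesis using fun_subspaceD(1)[OF fun_subspace_symbols] by (simp add: P symb_def)
    next
      case False
      then have "wt w t \<le> ord_w w P" if "P t \<noteq> 0" for t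
        using ord_attained(2)[OF w _ False, of t] that PC C_formal by (auto simp: Supp_def)
      then show ?thesis using P by (auto simp: symbols_def)
    qed
    moreover have "finite (wt w ` Supp f)"
      by (rule finite_subset[of _ "{ord_w w P}"]) (auto simp: P symb_def Supp_def split: if_splits)
    ultimately show "f \<in> T" using symbols_C symbols_symb by (auto simp: T_def gr_iff[OF w])
  qed
  ultimately have "initial_ideal A w I \<subseteq> T"
    unfolding initial_ideal_def gen_left_ideal_def by (subst gr_eq) blast
  then show "f \<in> initial_ideal A w I \<Longrightarrow> f \<in> carrier (gr w A) \<and> (\<forall>m. symb w m f \<in> symbols w m)"
    by (auto simp: T_def)
next
  assume f: "f \<in> carrier (gr w A) \<and> (\<forall>m. symb w m f \<in> symbols w m)"
  then have fin: "finite (wt w ` Supp f)" by (simp add: gr_iff[OF w])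
  show "f \<in> initial_ideal A w I"
    unfolding initial_ideal_def gen_left_ideal_def
  proof (rule InterI)
    fix H assume "H \<in> {H. left_ideal H (gr w A) \<and> initial_form w ` I \<subseteq> H}"
    then have H: "left_ideal H (hdo_ring (- P_set w) (carrier (gr w A)))" "initial_form w ` I \<subseteq> H"
      using gr_eq by auto
    have "g \<in> H" if "g \<in> symbols w m" for g m
    proof -
      obtain P where P: "g = symb w m P" "P \<in> I" "\<forall>t. P t \<noteq> 0 \<longrightarrow> wt w t \<le> m"
        using \<open>g \<in> symbols w m\<close> by (auto simp: symbols_def)
      show ?thesis
      proof (cases "\<exists>t. P t \<noteq> 0 \<and> wt w t = m")
        case True
        then obtain t where t: "P t \<noteq> 0" "wt w t = m" by blast
        then have "ord_w w P = m"
          unfolding ord_w_def using P(3) by (intro cSup_eq_maximum) (auto simp: Supp_def)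
        then show ?thesis using H(2) P by (auto simp: initial_form_def)
      next
        case False
        then have "g t = 0" for t unfolding P(1) symb_def by auto
        then have "g = (\<lambda>_. 0)" by (rule ext)
        then show ?thesis using left_idealD(2)[OF H(1)] by simp
      qed
    qed
    then have symbH: "symb w m f \<in> H" for m using f by blast
    have sumH: "(\<lambda>t. \<Sum>m\<in>M. g m t) \<in> H" if "finite M" "\<And>m. g m \<in> H" for M and g :: "real \<Rightarrow> ('k, 'n) hdo"
      using that
    proof (induction M rule: finite_induct)
      case empty
      then show ?case using left_idealD(2)[OF H(1)] by simp
    next
      case (insert a M)
      have "(\<lambda>t. g a t + (\<Sum>m\<in>M. g m t)) \<in> H"
        by (rule left_idealD(3)[OF H(1) insert.prems insert.IH[OF insert.prems]])
      then show ?case using insert.hyps by simp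
    qed
    show "f \<in> H" by (subst symb_decomposition[OF fin]) (rule sumH[OF fin symbH])
  qed
qed

end

lemma pairing_add_left: "finite (Supp l) \<Longrightarrow> finite (Supp m) \<Longrightarrow> pairing (\<lambda>t. l t + m t) P = pairing l P + pairing m P"
proof -
  assume fin: "finite (Supp l)" "finite (Supp m)"
  let ?F = "Supp l \<union> Supp m"
  have F: "finite ?F" using fin by simp
  have "pairing (\<lambda>t. l t + m t) P = (\<Sum>t\<in>?F. (l t + m t) * P t)" by (rule pairing_eq[OF F Supp_add])
  also have "\<dots> = (\<Sum>t\<in>?F. l t * P t) + (\<Sum>t\<in>?F. m t * P t)" by (simp add: distrib_right sum.distrib)
  finally show ?thesis using pairing_eq[OF F, of l P] pairing_eq[OF F, of m P] by simp
qed

lemma pairing_scale_left: "finite (Supp l) \<Longrightarrow> pairing (\<lambda>t. c * l t) P = c * pairing l P"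
proof -
  assume fin: "finite (Supp l)"
  have "pairing (\<lambda>t. c * l t) P = (\<Sum>t\<in>Supp l. c * l t * P t)"
    by (rule pairing_eq[OF fin]) (auto simp: Supp_def)
  then show ?thesis by (simp add: pairing_def sum_distrib_left mult.assoc)
qed

definition annihilator :: "nat \<Rightarrow> ('k::field, 'n::finite) hdo set \<Rightarrow> ('k, 'n) hdo set" where
  "annihilator d X = {l. finite (Supp l) \<and> (\<forall>t. l t \<noteq> 0 \<longrightarrow> mdeg t = d) \<and> (\<forall>P\<in>X. pairing l P = 0)}"

lemma fun_subspace_annihilator: "fun_subspace (annihilator d X)"
  unfolding fun_subspace_def
proof (intro conjI ballI allI)
  show "(\<lambda>_. 0) \<in> annihilator d X"
    by (simp add: annihilator_def Supp_def pairing_def)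
next
  fix l m assume l: "l \<in> annihilator d X" and m: "m \<in> annihilator d X"
  have "mdeg t = d" if t: "l t + m t \<noteq> 0" for t
  proof (cases "l t = 0")
    case True
    then show ?thesis using t m unfolding annihilator_def by simp
  next
    case False
    then show ?thesis using l unfolding annihilator_def by simp
  qed
  moreover have "finite (Supp (\<lambda>t. l t + m t))"
    using l m by (intro finite_subset[OF Supp_add]) (simp add: annihilator_def)
  moreover have "pairing (\<lambda>t. l t + m t) P = 0" if "P \<in> X" for P
    using pairing_add_left[of l m P] l m that by (simp add: annihilator_def)
  ultimately show "(\<lambda>t. l t + m t) \<in> annihilator d X" by (simp add: annihilator_def)
next
  fix c l assume l: "l \<in> annihilator d X"
  have "Supp (\<lambda>t. c * l t) \<subseteq> Supp l" by (auto simp: Supp_def)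
  moreover have "finite (Supp l)" using l by (simp add: annihilator_def)
  ultimately have "finite (Supp (\<lambda>t. c * l t))" by (rule finite_subset)
  then show "(\<lambda>t. c * l t) \<in> annihilator d X"
    using l by (simp add: annihilator_def pairing_scale_left)
qed

context hom_ideal
begin

lemma symbols_in_initial_ideal:
  assumes w: "w \<in> W_loc" and f: "f \<in> symbols w m"
  shows "f \<in> initial_ideal A w I"
proof -
  have "finite (wt w ` Supp f)"
    by (rule finite_subset[of _ "{m}"]) (use symbols_wt[OF f] in \<open>auto simp: Supp_def\<close>)
  then show ?thesis using symbols_C[OF f] symbols_symb[OF f] by (simp add: initial_ideal_iff[OF w] gr_iff[OF w])
qed

definition dual :: "nat \<Rightarrow> ('k, 'n) hdo set" where
  "dual d = annihilator d I"

definition dual_initial :: "'n weight \<Rightarrow> nat \<Rightarrow> ('k, 'n) hdo set" where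
  "dual_initial w d = annihilator d (initial_ideal A w I)"

lemma fun_subspace_dual: "fun_subspace (dual d)"
  unfolding dual_def by (rule fun_subspace_annihilator)

lemma fun_subspace_dual_initial: "fun_subspace (dual_initial w d)"
  unfolding dual_initial_def by (rule fun_subspace_annihilator)

text \<open>
  A linear relation among finitely many coefficients that holds on \<open>I\<close> still holds on \<open>I\<close> after truncation to
  degree \<open>d\<close>, because \<open>I\<close> is homogeneous. The truncated relation belongs to \<open>dual d\<close>.
\<close>

lemma approximation_in_I:
  assumes P: "\<And>t. P t \<noteq> 0 \<Longrightarrow> mdeg t = d" "\<And>l. l \<in> dual d \<Longrightarrow> pairing l P = 0" and F: "finite F"
  shows "\<exists>P'\<in>I. \<forall>t\<in>F. P' t = P t"
proof (rule agree_on_finite_of_annihilator[OF F fun_subspace_I])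
  fix \<phi> assume \<phi>: "\<And>s. s \<in> I \<Longrightarrow> (\<Sum>t\<in>F. \<phi> t * s t) = 0"
  define l where "l = (\<lambda>t. if t \<in> F \<and> mdeg t = d then \<phi> t else 0)"
  have sub: "Supp l \<subseteq> F" by (auto simp: l_def Supp_def)
  have pair: "pairing l Q = (\<Sum>t\<in>F. \<phi> t * hpart d Q t)" for Q
    unfolding pairing_eq[OF F sub] by (rule sum.cong) (auto simp: l_def hpart_def)
  have "l \<in> dual d"
    unfolding dual_def annihilator_def
  proof (intro CollectI conjI ballI allI impI)
    show "finite (Supp l)" by (rule finite_subset[OF sub F])
    show "mdeg t = d" if "l t \<noteq> 0" for t using that by (auto simp: l_def split: if_splits)
    show "pairing l Q = 0" if "Q \<in> I" for Q unfolding pair by (rule \<phi>[OF hpart_I[OF that]])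
  qed
  then have "pairing l P = 0" by (rule P(2))
  moreover have "hpart d P = P"
  proof
    fix t show "hpart d P t = P t" using P(1)[of t] by (auto simp: hpart_def)
  qed
  ultimately show "(\<Sum>t\<in>F. \<phi> t * P t) = 0" by (simp add: pair)
qed

text \<open>
  If \<open>P\<close> is annihilated by all functionals, then so are its multiples: a functional involves only finitely many
  coefficients of the product, for which \<open>P\<close> may be replaced by an element of \<open>I\<close>.
\<close>

lemma dual_is_dual_ideal: "dual_ideal dual"
proof
  show "fun_subspace (dual d)" for d by (rule fun_subspace_dual)
  show "finite (Supp l)" if "l \<in> dual d" for l d using that by (simp add: dual_def annihilator_def)
  show "mdeg t = d" if "l \<in> dual d" "l t \<noteq> 0" for l d t using that by (simp add: dual_def annihilator_def)
  fix P :: "('k, 'n) hdo" and d and r :: "'n mon" and l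
  assume P: "\<And>t. P t \<noteq> 0 \<Longrightarrow> mdeg t = d" "\<And>l. l \<in> dual d \<Longrightarrow> pairing l P = 0" and l: "l \<in> dual (mdeg r + d)"
  let ?F = "\<Union>s\<in>Supp l. (\<lambda>(\<gamma>, t, t'). t') ` contrib UNIV s"
  have "finite ?F" using l by (auto simp: dual_def annihilator_def finite_contrib)
  then obtain P' where P': "P' \<in> I" "\<forall>t\<in>?F. P' t = P t" using approximation_in_I[OF P] by blast
  have "hdo_mult UNIV (hdo_monom r) P s = hdo_mult UNIV (hdo_monom r) P' s" if s: "s \<in> Supp l" for s :: "'n mon"
    unfolding hdo_mult_alt
  proof (rule sum.cong[OF refl])
    fix z assume z: "z \<in> contrib UNIV s"
    obtain \<gamma> t t' where zz: "z = (\<gamma>, t, t')" by (cases z)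
    have "t' \<in> (\<lambda>(\<gamma>, t, t'). t') ` contrib UNIV s" using z zz by force
    then have "t' \<in> ?F" using s by blast
    then have "P' t' = P t'" using P'(2) by blast
    then show "(leibniz_term (hdo_monom r) P z) =
      (leibniz_term (hdo_monom r) P' z)"
      by (simp add: zz)
  qed
  then have "pairing l (hdo_mult UNIV (hdo_monom r) P) = pairing l (hdo_mult UNIV (hdo_monom r) P')"
    unfolding pairing_def by (intro sum.cong) auto
  also have "\<dots> = 0" using l I_mult[OF C_monom P'(1)] by (simp add: dual_def annihilator_def)
  finally show "pairing l (hdo_mult UNIV (hdo_monom r) P) = 0" .
qed

sublocale dual_ideal dual
  by (rule dual_is_dual_ideal)

lemma dual_initial_iff:
  assumes w: "w \<in> W_loc"
  shows "l \<in> dual_initial w d \<longleftrightarrow>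
    finite (Supp l) \<and> (\<forall>t. l t \<noteq> 0 \<longrightarrow> mdeg t = d) \<and> (\<forall>m. \<forall>f\<in>symbols w m. pairing l f = 0)"
proof (intro iffI; (elim conjE)?)
  assume "l \<in> dual_initial w d"
  then show "finite (Supp l) \<and> (\<forall>t. l t \<noteq> 0 \<longrightarrow> mdeg t = d) \<and> (\<forall>m. \<forall>f\<in>symbols w m. pairing l f = 0)"
    using symbols_in_initial_ideal[OF w] by (auto simp: dual_initial_def annihilator_def)
next
  assume l: "finite (Supp l)" "\<forall>t. l t \<noteq> 0 \<longrightarrow> mdeg t = d" "\<forall>m. \<forall>f\<in>symbols w m. pairing l f = 0"
  have "pairing l f = 0" if f: "f \<in> initial_ideal A w I" for f
  proof -
    have fin: "finite (wt w ` Supp f)" and s: "\<And>m. symb w m f \<in> symbols w m"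
      using f by (auto simp: initial_ideal_iff[OF w] gr_iff[OF w])
    have "pairing l f = pairing l (\<lambda>t. \<Sum>m\<in>wt w ` Supp f. symb w m f t)"
      using symb_decomposition[OF fin] by metis
    also have "\<dots> = (\<Sum>m\<in>wt w ` Supp f. pairing l (symb w m f))"
      unfolding pairing_def sum_distrib_left by (rule sum.swap)
    also have "\<dots> = 0" using l(3) s by (intro sum.neutral ballI) blast
    finally show ?thesis .
  qed
  then show "l \<in> dual_initial w d" using l by (simp add: dual_initial_def annihilator_def)
qed

text \<open>
  Operators have initial forms of highest weight and functionals those of lowest weight. The pairing of the two initial
  parts is the full pairing, since only monomials of weight exactly \<open>m\<close> are common.
\<close>

lemma initial_part_in_dual_initial:
  assumes w: "w \<in> W_loc" and l: "l \<in> dual d" and m: "\<And>t. l t \<noteq> 0 \<Longrightarrow> m \<le> wt w t"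
  shows "symb w m l \<in> dual_initial w d"
proof -
  have sub: "Supp (symb w m l) \<subseteq> Supp l" by (auto simp: Supp_def symb_def)
  have fin: "finite (Supp l)" using l by (simp add: dual_def annihilator_def)
  have "pairing (symb w m l) f = 0" if f: "f \<in> symbols w a" for f a
  proof (cases "a = m")
    case True
    obtain P where P: "f = symb w m P" "P \<in> I" "\<forall>t. P t \<noteq> 0 \<longrightarrow> wt w t \<le> m" using f True by (auto simp: symbols_def)
    have "pairing (symb w m l) f = (\<Sum>t\<in>Supp l. symb w m l t * f t)" by (rule pairing_eq[OF fin sub])
    also have "\<dots> = (\<Sum>t\<in>Supp l. l t * P t)"
    proof (rule sum.cong[OF refl])
      fix t assume "t \<in> Supp l"
      then have "m \<le> wt w t" using m by (simp add: Supp_def)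
      then show "symb w m l t * f t = l t * P t" using P(3)[rule_format, of t] by (auto simp: P(1) symb_def)
    qed
    also have "\<dots> = 0" using l P(2) by (auto simp: dual_def annihilator_def pairing_def)
    finally show ?thesis .
  next
    case False
    have "symb w m l t * f t = 0" for t using symbols_wt[OF f, of t] False by (auto simp: symb_def)
    then show ?thesis unfolding pairing_def by (intro sum.neutral ballI)
  qed
  then show ?thesis
    using finite_subset[OF sub fin] l by (auto simp: dual_initial_iff[OF w] dual_def annihilator_def symb_def)
qed

lemma symb_dual_initial:
  assumes w: "w \<in> W_loc" and l: "l \<in> dual_initial w d"
  shows "symb w m l \<in> dual_initial w d"
proof -
  have sub: "Supp (symb w m l) \<subseteq> Supp l" by (auto simp: Supp_def symb_def)
  have fin: "finite (Supp l)" using l by (simp add: dual_initial_def annihilator_def)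
  have "pairing (symb w m l) f = 0" if f: "f \<in> symbols w a" for f a
  proof -
    have "pairing (symb w m l) f = pairing l (symb w m f)"
      unfolding pairing_eq[OF fin sub] pairing_eq[OF fin subset_refl] by (intro sum.cong) (auto simp: symb_def)
    moreover have "pairing l (symb w m f) = 0"
      using l symbols_symb[OF f, of m] unfolding dual_initial_iff[OF w] by blast
    ultimately show ?thesis by simp
  qed
  then show ?thesis
    using finite_subset[OF sub fin] l by (auto simp: dual_initial_iff[OF w] symb_def)
qed

definition I_deg :: "nat \<Rightarrow> ('k, 'n) hdo set" where
  "I_deg d = {P \<in> I. \<forall>t. P t \<noteq> 0 \<longrightarrow> mdeg t = d}"

lemma submod_I_deg: "submod d (I_deg d)"
proof (rule submodI)
  have eq: "I_deg d = I \<inter> {P. \<forall>t. P t \<noteq> 0 \<longrightarrow> mdeg t = d}" by (auto simp: I_deg_def)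
  show "fun_subspace (I_deg d)" unfolding eq by (intro fun_subspace_Int fun_subspace_I fun_subspace_support)
  show "I_deg d \<subseteq> C_deg d" using I_sub by (auto simp: I_deg_def C_deg_def)
  fix c P assume "hdo_series c \<in> C" "P \<in> I_deg d"
  then show "smul c P \<in> I_deg d" using smul_I smul_deg[of P d c] by (auto simp: I_deg_def)
qed

lemma submod_weight:
  assumes w: "w \<in> W_loc" and Q: "\<And>a b. a \<le> b \<Longrightarrow> Q b \<Longrightarrow> Q a"
  shows "submod d {P \<in> C_deg d. \<forall>t. P t \<noteq> 0 \<longrightarrow> Q (wt w t)}"
proof (rule submodI)
  have eq: "{P \<in> C_deg d. \<forall>t. P t \<noteq> 0 \<longrightarrow> Q (wt w t)} = C_deg d \<inter> {P. \<forall>t. P t \<noteq> 0 \<longrightarrow> Q (wt w t)}" by auto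
  show "fun_subspace {P \<in> C_deg d. \<forall>t. P t \<noteq> 0 \<longrightarrow> Q (wt w t)}"
    unfolding eq by (intro fun_subspace_Int fun_subspace_C_deg fun_subspace_support)
  fix c P assume c: "hdo_series c \<in> C" and P: "P \<in> {P \<in> C_deg d. \<forall>t. P t \<noteq> 0 \<longrightarrow> Q (wt w t)}"
  have "Q (wt w t)" if "smul c P t \<noteq> 0" for t
  proof -
    obtain s where "P s \<noteq> 0" "wt w t \<le> wt w s" using smul_wt[OF w \<open>smul c P t \<noteq> 0\<close>] by blast
    then show ?thesis using P Q by blast
  qed
  moreover have "smul c P \<in> C_deg d"
    using C_smul[OF c] P smul_deg[of P d c] by (auto simp: C_deg_def)
  ultimately show "smul c P \<in> {P \<in> C_deg d. \<forall>t. P t \<noteq> 0 \<longrightarrow> Q (wt w t)}" by simp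
qed auto

text \<open>
  The converse of the previous passage to initial parts. A functional of weight \<open>m\<close> that annihilates \<open>in\<^sub>w(I)\<close> annihilates
  the elements of \<open>I\<close> of weight at most \<open>m\<close>. It is therefore the sum of a functional annihilating \<open>I\<close> and of one that
  annihilates everything of weight at most \<open>m\<close>.
\<close>

lemma dual_initial_lift:
  assumes w: "w \<in> W_loc" and \<psi>: "\<psi> \<in> dual_initial w d" "\<And>t. \<psi> t \<noteq> 0 \<Longrightarrow> wt w t = m"
  obtains l where "l \<in> dual d" "\<And>t. wt w t \<le> m \<Longrightarrow> l t = \<psi> t"
proof -
  let ?N2 = "{P \<in> C_deg d. \<forall>t. P t \<noteq> 0 \<longrightarrow> wt w t \<le> m}"
  have fin: "finite (Supp \<psi>)" and deg: "\<And>t. \<psi> t \<noteq> 0 \<Longrightarrow> mdeg t = d" using \<psi>(1) by (auto simp: dual_initial_def annihilator_def)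
  have "(\<Sum>t\<in>Supp \<psi>. \<psi> t * P t) = 0" if P: "P \<in> I_deg d" "P \<in> ?N2" for P
  proof -
    have "symb w m P \<in> symbols w m" using P by (auto simp: I_deg_def symbols_def)
    then have "pairing \<psi> (symb w m P) = 0" using \<psi>(1) by (simp add: dual_initial_iff[OF w])
    moreover have "pairing \<psi> (symb w m P) = (\<Sum>t\<in>Supp \<psi>. \<psi> t * P t)"
      unfolding pairing_def by (rule sum.cong) (use \<psi>(2) in \<open>auto simp: symb_def Supp_def\<close>)
    ultimately show ?thesis by simp
  qed
  moreover have "submod d ?N2" by (rule submod_weight[OF w]) simp
  ultimately obtain F \<phi> where F: "finite F" and \<phi>2: "\<forall>P\<in>?N2. (\<Sum>t\<in>F. \<phi> t * P t) = 0"
    and \<phi>1: "\<forall>P\<in>I_deg d. (\<Sum>t\<in>F. \<phi> t * P t) = (\<Sum>t\<in>Supp \<psi>. \<psi> t * P t)"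
    using annihilator_of_intersection[OF submod_I_deg _ fin, of d ?N2 \<psi>] by blast
  define \<phi>' where "\<phi>' = (\<lambda>t. if t \<in> F \<and> mdeg t = d then \<phi> t else 0)"
  have sub: "Supp \<phi>' \<subseteq> F" by (auto simp: \<phi>'_def Supp_def)
  then have fin': "finite (Supp \<phi>')" using F finite_subset by blast
  have zero: "\<phi>' t = 0" if t: "wt w t \<le> m" for t
  proof (rule ccontr)
    assume "\<phi>' t \<noteq> 0"
    then have True: "t \<in> F" "mdeg t = d" "\<phi>' t = \<phi> t" by (auto simp: \<phi>'_def split: if_splits)
    have "hdo_monom t \<in> ?N2" using C_monom[of t] t True by (auto simp: C_deg_def hdo_monom_def)
    then have "(\<Sum>s\<in>F. \<phi> s * hdo_monom t s) = 0" using \<phi>2 by blast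
    moreover have "(\<Sum>s\<in>F. \<phi> s * hdo_monom t s) = (\<Sum>s\<in>F. if s = t then \<phi> t else 0)"
      by (rule sum.cong) (auto simp: hdo_monom_def)
    ultimately show False using True F \<open>\<phi>' t \<noteq> 0\<close> by simp
  qed
  define l where "l = (\<lambda>t. \<psi> t + (- 1) * \<phi>' t)"
  have "pairing l P = 0" if P: "P \<in> I" for P
  proof -
    have hP: "hpart d P \<in> I_deg d" using hpart_I[OF P] by (auto simp: I_deg_def hpart_def)
    have "finite (Supp (\<lambda>t. (- 1) * \<phi>' t))" using fin' by (rule finite_subset[rotated]) (auto simp: Supp_def)
    then have "pairing l P = pairing \<psi> P + (- 1) * pairing \<phi>' P"
      unfolding l_def pairing_scale_left[OF fin', symmetric] by (rule pairing_add_left[OF fin])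
    moreover have "pairing \<psi> P = (\<Sum>t\<in>Supp \<psi>. \<psi> t * hpart d P t)"
      unfolding pairing_def by (rule sum.cong) (use deg in \<open>auto simp: hpart_def Supp_def\<close>)
    moreover have "pairing \<phi>' P = (\<Sum>t\<in>F. \<phi> t * hpart d P t)"
      unfolding pairing_eq[OF F sub] by (rule sum.cong) (auto simp: hpart_def \<phi>'_def)
    ultimately show ?thesis using \<phi>1 hP by simp
  qed
  moreover have "finite (Supp l)"
    by (rule finite_subset[of _ "Supp \<psi> \<union> Supp \<phi>'"]) (use fin fin' in \<open>auto simp: l_def Supp_def\<close>)
  moreover have "mdeg t = d" if "l t \<noteq> 0" for t
    using that deg[of t] by (cases "\<psi> t = 0") (auto simp: l_def \<phi>'_def split: if_splits)
  ultimately have "l \<in> dual d" by (simp add: dual_def annihilator_def)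
  moreover have "l t = \<psi> t" if "wt w t \<le> m" for t using zero[OF that] by (simp add: l_def)
  ultimately show ?thesis by (rule that[of l])
qed

text \<open>
  The elements of \<open>I\<close> of degree \<open>d\<close> and weight at most \<open>m\<close>, plus all operators of smaller weight, form a submodule.
  As submodules are determined by their annihilators, so are the symbols.
\<close>

lemma symbols_closed:
  assumes w: "w \<in> W_loc" and f: "f \<in> C_deg d" "\<And>t. f t \<noteq> 0 \<Longrightarrow> wt w t = m"
    and orth: "\<And>l. l \<in> dual_initial w d \<Longrightarrow> pairing l f = 0"
  shows "f \<in> symbols w m"
proof -
  let ?P = "{P \<in> I_deg d. \<forall>t. P t \<noteq> 0 \<longrightarrow> wt w t \<le> m}"
  let ?N = "{P \<in> C_deg d. \<forall>t. P t \<noteq> 0 \<longrightarrow> wt w t < m}"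
  define H where "H = {\<lambda>t. x t + y t | x y. x \<in> ?P \<and> y \<in> ?N}"
  have HI: "(\<lambda>t. x t + y t) \<in> H" if "x \<in> ?P" "y \<in> ?N" for x y using that by (auto simp: H_def)
  have sP: "submod d ?P"
  proof -
    have sI: "submod d (I_deg d)" and sW: "submod d {P \<in> C_deg d. \<forall>t. P t \<noteq> 0 \<longrightarrow> wt w t \<le> m}"
      by (rule submod_I_deg) (rule submod_weight[OF w], simp)
    have eq: "?P = I_deg d \<inter> {P \<in> C_deg d. \<forall>t. P t \<noteq> 0 \<longrightarrow> wt w t \<le> m}"
      using sI by (auto simp: submod_def)
    show ?thesis using sI sW unfolding eq submod_def by blast
  qed
  have sN: "submod d ?N" by (rule submod_weight[OF w]) simp
  note s1 = submod_subspace[OF sP] and s2 = submod_subspace[OF sN]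
  have inH: "x \<in> H" if "x \<in> ?P" for x using HI[OF that fun_subspaceD(1)[OF s2]] by simp
  have inH': "y \<in> H" if "y \<in> ?N" for y using HI[OF fun_subspaceD(1)[OF s1] that] by simp
  have H: "submod d H" unfolding H_def by (rule submod_sum[OF sP sN])
  have "f \<in> H"
  proof (rule submod_closed_annihilator[OF H f(1)])
    fix F \<phi> assume F: "finite F" and \<phi>: "\<And>s. s \<in> H \<Longrightarrow> (\<Sum>t\<in>F. \<phi> t * s t) = 0"
    define \<psi> where "\<psi> = (\<lambda>t. if t \<in> F \<and> mdeg t = d \<and> wt w t = m then \<phi> t else 0)"
    have sub: "Supp \<psi> \<subseteq> F" by (auto simp: \<psi>_def Supp_def)
    have "pairing \<psi> g = 0" if g: "g \<in> symbols w a" for g a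
    proof (cases "a = m")
      case False
      have "\<psi> t * g t = 0" for t using symbols_wt[OF g, of t] False by (auto simp: \<psi>_def)
      then show ?thesis unfolding pairing_def by (intro sum.neutral ballI)
    next
      case True
      obtain P where P: "g = symb w m P" "P \<in> I" "\<forall>t. P t \<noteq> 0 \<longrightarrow> wt w t \<le> m" using g True by (auto simp: symbols_def)
      define Q where "Q = hpart d P"
      define Q' where "Q' = (\<lambda>t. if wt w t < m then Q t else 0)"
      have QI: "Q \<in> ?P" using hpart_I[OF P(2)] P(3) by (auto simp: Q_def I_deg_def hpart_def)
      then have "Q \<in> C_deg d" using sP unfolding submod_def by blast
      then have "Q' \<in> ?N" using C_restrict[of Q "{t. wt w t < m}"] by (auto simp: Q'_def C_deg_def)
      then have "(\<Sum>t\<in>F. \<phi> t * Q' t) = 0" "(\<Sum>t\<in>F. \<phi> t * Q t) = 0" using \<phi> inH inH' QI by blast+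
      moreover have "pairing \<psi> g = (\<Sum>t\<in>F. \<phi> t * Q t - \<phi> t * Q' t)"
        unfolding pairing_eq[OF F sub]
      proof (rule sum.cong[OF refl])
        fix t assume "t \<in> F"
        then show "\<psi> t * g t = \<phi> t * Q t - \<phi> t * Q' t"
          using P(3)[rule_format, of t] by (auto simp: \<psi>_def Q_def Q'_def P(1) symb_def hpart_def)
      qed
      ultimately show ?thesis by (simp add: sum_subtractf)
    qed
    then have "\<psi> \<in> dual_initial w d"
      using finite_subset[OF sub F] by (auto simp: dual_initial_iff[OF w] \<psi>_def)
    then have "pairing \<psi> f = 0" by (rule orth)
    moreover have "pairing \<psi> f = (\<Sum>t\<in>F. \<phi> t * f t)"
      unfolding pairing_eq[OF F sub]
    proof (rule sum.cong[OF refl])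
      fix t assume "t \<in> F"
      moreover have "mdeg t = d" if "f t \<noteq> 0" using f(1) that by (simp add: C_deg_def)
      ultimately show "\<psi> t * f t = \<phi> t * f t" using f(2)[of t] by (auto simp: \<psi>_def)
    qed
    ultimately show "(\<Sum>t\<in>F. \<phi> t * f t) = 0" by simp
  qed
  then obtain x y where xy: "f = (\<lambda>t. x t + y t)" "x \<in> ?P" "y \<in> ?N"
    unfolding H_def by (elim CollectE[of f] exE conjE)
  have "f t = symb w m x t" for t
  proof (cases "wt w t = m")
    case True
    then have "y t = 0" using xy(3) by auto
    then show ?thesis using True by (simp add: xy(1) symb_def)
  next
    case False
    then have "f t = 0" using f(2) by blast
    then show ?thesis using False by (simp add: symb_def)
  qed
  then have "f = symb w m x" by (rule ext)
  then show ?thesis using xy(2) by (auto simp: symbols_def I_deg_def)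
qed

lemma reduced_initial_part:
  assumes R: "admissible R" and w: "w \<in> cone_of R" and t: "t \<in> mins R"
  shows "symb w (wt w t) (reduced R t) \<in> dual_initial w (mdeg t)"
  using w t by (intro initial_part_in_dual_initial reduced(1)[OF R t]) (auto simp: cone_of_def)

text \<open>
  A nonzero part of weight \<open>m\<close> lifts to a functional \<open>l\<close> annihilating \<open>I\<close> without terms of weight below \<open>m\<close>. Expanding
  \<open>l\<close> in the reduced basis at a monomial of weight \<open>m\<close>, some \<open>t\<close> with \<open>w(t) \<le> m\<close> occurs, and there \<open>\<psi>\<close>
  agrees with \<open>l\<close> and does not vanish.
\<close>

lemma dual_initial_zero:
  assumes R: "admissible R" and w: "w \<in> cone_of R" and \<psi>: "\<psi> \<in> dual_initial w d" "\<And>t. t \<in> mins R \<Longrightarrow> \<psi> t = 0"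
  shows "\<psi> s = 0"
proof (rule ccontr)
  assume s: "\<psi> s \<noteq> 0"
  have W: "w \<in> W_loc" using w by (simp add: cone_of_def)
  define m where "m = wt w s"
  have wm: "wt w t = m" if "symb w m \<psi> t \<noteq> 0" for t using that by (auto simp: symb_def split: if_splits)
  obtain l where l: "l \<in> dual d" "\<And>t. wt w t \<le> m \<Longrightarrow> l t = symb w m \<psi> t"
    using dual_initial_lift[OF W symb_dual_initial[OF W \<psi>(1), of m] wm] by blast
  have "l s \<noteq> 0" using l(2)[of s] s by (simp add: m_def symb_def)
  then have "(\<Sum>t\<in>{t. l t \<noteq> 0 \<and> t \<in> mins R}. l t * reduced R t s) \<noteq> 0"
    using reduced_expansion[OF R l(1), of s] by simp
  then obtain t where "t \<in> {t. l t \<noteq> 0 \<and> t \<in> mins R}" "l t * reduced R t s \<noteq> 0"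
    by (rule sum.not_neutral_contains_not_neutral)
  then have t: "t \<in> mins R" "l t \<noteq> 0" "reduced R t s \<noteq> 0" by auto
  then have "wt w t \<le> m" using w by (auto simp: cone_of_def m_def)
  then have "l t = symb w m \<psi> t" by (rule l(2))
  then show False using t(2) \<psi>(2)[OF t(1)] by (simp add: symb_def split: if_splits)
qed

lemma dual_initial_expansion:
  assumes R: "admissible R" and w: "w \<in> cone_of R" and \<psi>: "\<psi> \<in> dual_initial w d"
  shows "\<psi> = (\<lambda>s. \<Sum>t\<in>{t. \<psi> t \<noteq> 0 \<and> t \<in> mins R}. \<psi> t * symb w (wt w t) (reduced R t) s)"
proof
  fix s
  let ?X = "{t. \<psi> t \<noteq> 0 \<and> t \<in> mins R}"
  have X: "finite ?X" using \<psi> by (rule_tac finite_subset[of _ "Supp \<psi>"]) (auto simp: Supp_def dual_initial_def annihilator_def)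
  note sub = fun_subspace_dual_initial[of w d]
  have deg: "mdeg t = d" if "\<psi> t \<noteq> 0" for t using \<psi> that by (simp add: dual_initial_def annihilator_def)
  have "(\<lambda>s. \<Sum>t\<in>?X. \<psi> t * symb w (wt w t) (reduced R t) s) \<in> dual_initial w d"
  proof (rule fun_subspace_sum[OF sub X], rule fun_subspaceD(3)[OF sub])
    fix t assume "t \<in> ?X"
    then show "symb w (wt w t) (reduced R t) \<in> dual_initial w d"
      using reduced_initial_part[OF R w, of t] deg[of t] by simp
  qed
  then have "(\<lambda>s. \<psi> s - 1 * (\<Sum>t\<in>?X. \<psi> t * symb w (wt w t) (reduced R t) s)) \<in> dual_initial w d"
    by (rule fun_subspaceD(4)[OF sub \<psi>])
  then have "\<psi> s - 1 * (\<Sum>t\<in>?X. \<psi> t * symb w (wt w t) (reduced R t) s) = 0"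
  proof (rule dual_initial_zero[OF R w])
    fix u assume u: "u \<in> mins R"
    have "(\<Sum>t\<in>?X. \<psi> t * symb w (wt w t) (reduced R t) u) = (\<Sum>t\<in>?X. if t = u then \<psi> u else 0)"
    proof (rule sum.cong[OF refl])
      fix t assume "t \<in> ?X"
      then show "\<psi> t * symb w (wt w t) (reduced R t) u = (if t = u then \<psi> u else 0)"
        using reduced_at_mins[OF R _ u, of t] reduced_at_mins[OF R u u] by (auto simp: symb_def)
    qed
    then show "\<psi> u - 1 * (\<Sum>t\<in>?X. \<psi> t * symb w (wt w t) (reduced R t) u) = 0" using X u by simp
  qed
  then show "\<psi> s = (\<Sum>t\<in>?X. \<psi> t * symb w (wt w t) (reduced R t) s)" by simp
qed

text \<open>
  The initial ideals live in the same graded ring, and are recovered from their annihilators degree by degree and weight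
  by weight.
\<close>

lemma initial_ideal_le_of_dual:
  assumes w: "w \<in> W_loc" "w' \<in> same_graded w"
    and dual: "\<And>d. dual_initial w' d \<subseteq> dual_initial w d"
  shows "initial_ideal A w I \<subseteq> initial_ideal A w' I"
proof
  fix f assume f: "f \<in> initial_ideal A w I"
  have W': "w' \<in> W_loc" and gr: "gr w' A = gr w A" using w(2) by (auto simp: same_graded_def gr_def)
  have fgr: "f \<in> carrier (gr w' A)" using f gr by (simp add: initial_ideal_iff[OF w(1)])
  have fC: "f \<in> C" using fgr by (simp add: gr_iff[OF W'])
  have "symb w' m f \<in> symbols w' m" for m
  proof -
    define g where "g = symb w' m f"
    have part: "hpart d g \<in> symbols w' m" for d
    proof (rule symbols_closed[OF W', where d=d])
      show "hpart d g \<in> C_deg d"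
        using hpart_C[OF symb_C[OF fC]] by (auto simp: C_deg_def g_def hpart_def)
      show "wt w' t = m" if "hpart d g t \<noteq> 0" for t
        using that by (auto simp: hpart_def g_def symb_def split: if_splits)
      fix l assume l: "l \<in> dual_initial w' d"
      have "symb w' m l \<in> dual_initial w d" using symb_dual_initial[OF W' l] dual by blast
      then have "pairing (symb w' m l) f = 0" using f by (simp add: dual_initial_def annihilator_def)
      moreover have "pairing (symb w' m l) f = pairing l (hpart d g)"
      proof -
        have fin: "finite (Supp l)" using l by (simp add: dual_initial_def annihilator_def)
        have sub: "Supp (symb w' m l) \<subseteq> Supp l" by (auto simp: Supp_def symb_def)
        show ?thesis
          unfolding pairing_eq[OF fin sub] pairing_eq[OF fin subset_refl]
          by (rule sum.cong) (use l in \<open>auto simp: symb_def g_def hpart_def dual_initial_def annihilator_def Supp_def\<close>)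
      qed
      ultimately show "pairing l (hpart d g) = 0" by simp
    qed
    define Z where "Z = mdeg ` Supp g"
    have Z: "finite Z"
    proof -
      have "g \<in> formal_ops" using symb_C[OF fC, of w' m] C_formal unfolding g_def by blast
      then have "finite ((\<lambda>(\<beta>, k). msize \<beta> + k) ` snd ` Supp g)" by (simp add: formal_ops_def)
      moreover have "Z = (\<lambda>(\<beta>, k). msize \<beta> + k) ` snd ` Supp g"
        unfolding Z_def image_image by (rule image_cong) (auto simp: mdeg_def)
      ultimately show ?thesis by simp
    qed
    have "g t = (\<Sum>d\<in>Z. hpart d g t)" for t
    proof (cases "g t = 0")
      case True
      then have "hpart d g t = 0" for d by (simp add: hpart_def)
      then show ?thesis using True by simp
    next
      case False
      then have "mdeg t \<in> Z" by (auto simp: Z_def Supp_def)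
      then have "(\<Sum>d\<in>Z. hpart d g t) = (\<Sum>d\<in>{mdeg t}. hpart d g t)"
        using Z by (intro sum.mono_neutral_right) (auto simp: hpart_def)
      then show ?thesis by (simp add: hpart_def)
    qed
    then have eq: "g = (\<lambda>t. \<Sum>d\<in>Z. hpart d g t)" by (rule ext)
    have "(\<lambda>t. \<Sum>d\<in>Z. hpart d g t) \<in> symbols w' m" by (rule fun_subspace_sum[OF fun_subspace_symbols Z part])
    then show ?thesis unfolding eq[symmetric] by (simp add: g_def)
  qed
  then show "f \<in> initial_ideal A w' I" using fgr by (simp add: initial_ideal_iff[OF W'])
qed

definition same_ties :: "('n mon \<Rightarrow> 'n mon \<Rightarrow> bool) \<Rightarrow> 'n weight \<Rightarrow> 'n weight \<Rightarrow> bool" where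
  "same_ties R w w' \<longleftrightarrow> (\<forall>t\<in>mins R. \<forall>s. reduced R t s \<noteq> 0 \<longrightarrow> (wt w s = wt w t \<longleftrightarrow> wt w' s = wt w' t))"

lemma dual_initial_le_of_same_ties:
  assumes R: "admissible R" and w: "w \<in> cone_of R" "w' \<in> cone_of R" and ties: "same_ties R w w'"
  shows "dual_initial w d \<subseteq> dual_initial w' d"
proof
  fix \<psi> assume \<psi>: "\<psi> \<in> dual_initial w d"
  let ?X = "{t. \<psi> t \<noteq> 0 \<and> t \<in> mins R}"
  have X: "finite ?X" using \<psi> by (rule_tac finite_subset[of _ "Supp \<psi>"]) (auto simp: Supp_def dual_initial_def annihilator_def)
  note sub = fun_subspace_dual_initial[of w' d]
  have eq: "symb w (wt w t) (reduced R t) = symb w' (wt w' t) (reduced R t)" if "t \<in> mins R" for t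
  proof
    fix s show "symb w (wt w t) (reduced R t) s = symb w' (wt w' t) (reduced R t) s"
      using ties that by (cases "reduced R t s = 0") (auto simp: same_ties_def symb_def)
  qed
  have "(\<lambda>s. \<Sum>t\<in>?X. \<psi> t * symb w (wt w t) (reduced R t) s) \<in> dual_initial w' d"
  proof (rule fun_subspace_sum[OF sub X], rule fun_subspaceD(3)[OF sub])
    fix t assume t: "t \<in> ?X"
    then have "mdeg t = d" using \<psi> by (simp add: dual_initial_def annihilator_def)
    then show "symb w (wt w t) (reduced R t) \<in> dual_initial w' d"
      using reduced_initial_part[OF R w(2), of t] eq[of t] t by simp
  qed
  then show "\<psi> \<in> dual_initial w' d" unfolding dual_initial_expansion[OF R w(1) \<psi>, symmetric] .
qed

text \<open>
  If the ties agree, then so do the initial parts of the reduced functionals, hence the annihilators of the initial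
  ideals and the initial ideals themselves. Conversely, if the initial ideals agree, then the \<open>w'\<close>-initial part of the
  reduced functional of \<open>t\<close> annihilates \<open>in\<^sub>w(I)\<close>, so by \<open>dual_initial_zero\<close> it is nonzero at \<open>t\<close> and equals the
  \<open>w\<close>-initial part.
\<close>

lemma initial_ideal_eq_iff:
  assumes R: "admissible R" and w: "w \<in> cone_of R" and w': "w' \<in> same_graded w"
  shows "initial_ideal A w I = initial_ideal A w' I \<longleftrightarrow> w' \<in> cone_of R \<and> same_ties R w w'"
proof
  have W: "w \<in> W_loc" using w by (simp add: cone_of_def)
  have W': "w' \<in> W_loc" using w' by (simp add: same_graded_def)
  {
    assume "initial_ideal A w I = initial_ideal A w' I"
    then have dual: "dual_initial w' d = dual_initial w d" for d by (simp add: dual_initial_def annihilator_def)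
    have key: "(\<forall>s. reduced R t s \<noteq> 0 \<longrightarrow> wt w' t \<le> wt w' s \<and> (wt w s = wt w t \<longleftrightarrow> wt w' s = wt w' t))"
      if t: "t \<in> mins R" for t
    proof -
      have fin: "finite (Supp (reduced R t))" using L_fin[OF reduced(1)[OF R t]] .
      have ne: "t \<in> Supp (reduced R t)" using reduced(2)[OF R t] by (simp add: Supp_def)
      define m where "m = Min (wt w' ` Supp (reduced R t))"
      have m: "m \<le> wt w' s" if "reduced R t s \<noteq> 0" for s
        unfolding m_def using fin that by (intro Min_le) (auto simp: Supp_def)
      have "m \<in> wt w' ` Supp (reduced R t)" unfolding m_def using fin ne by (intro Min_in) auto
      then obtain s0 where s0: "reduced R t s0 \<noteq> 0" "wt w' s0 = m" by (auto simp: Supp_def)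
      have \<chi>: "symb w' m (reduced R t) \<in> dual_initial w (mdeg t)"
        using initial_part_in_dual_initial[OF W' reduced(1)[OF R t] m] dual by simp
      have "wt w' t = m"
      proof (rule ccontr)
        assume nt: "wt w' t \<noteq> m"
        have "symb w' m (reduced R t) s0 = 0"
        proof (rule dual_initial_zero[OF R w \<chi>])
          fix u assume "u \<in> mins R"
          then show "symb w' m (reduced R t) u = 0"
            using nt reduced_at_mins[OF R t, of u] by (auto simp: symb_def)
        qed
        then show False using s0 by (simp add: symb_def)
      qed
      have "symb w (wt w t) (reduced R t) s - 1 * symb w' m (reduced R t) s = 0" for s
      proof (rule dual_initial_zero[OF R w fun_subspaceD(4)[OF fun_subspace_dual_initial reduced_initial_part[OF R w t] \<chi>, of 1]])
        fix u assume "u \<in> mins R"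
        then show "symb w (wt w t) (reduced R t) u - 1 * symb w' m (reduced R t) u = 0"
          using \<open>wt w' t = m\<close> reduced_at_mins[OF R t, of u] by (auto simp: symb_def)
      qed
      then have "(if wt w s = wt w t then reduced R t s else 0) = (if wt w' s = wt w' t then reduced R t s else 0)" for s
        using \<open>wt w' t = m\<close> by (simp add: symb_def)
      then show ?thesis using m \<open>wt w' t = m\<close> by metis
    qed
    then show "w' \<in> cone_of R \<and> same_ties R w w'"
      using W' by (auto simp: cone_of_def same_ties_def)
  next
    assume *: "w' \<in> cone_of R \<and> same_ties R w w'"
    then have ties': "same_ties R w' w" by (auto simp: same_ties_def)
    have sg: "w \<in> same_graded w'" using w' W by (auto simp: same_graded_def)
    show "initial_ideal A w I = initial_ideal A w' I"
      using initial_ideal_le_of_dual[OF W w'] initial_ideal_le_of_dual[OF W' sg]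
        dual_initial_le_of_same_ties[OF R w] dual_initial_le_of_same_ties[OF R _ w ties'] * by blast
  }
qed

end

section \<open>Groebner cones as cells\<close>

definition exponent_diff :: "'n::finite mon \<Rightarrow> 'n mon \<Rightarrow> 'n weight" where
  "exponent_diff s t = (\<chi> i. real (fst s $ i) - real (fst t $ i),
     \<chi> i. real (fst (snd s) $ i) - real (fst (snd t) $ i))"

text \<open>
  The normal vectors of the inequalities \<open>u\<^sub>i \<le> 0\<close> and \<open>u\<^sub>i + v\<^sub>i \<ge> 0\<close>. Two weights define the same graded ring if and
  only if the same of these inequalities are equalities.
\<close>

definition loc_normals :: "'n::finite weight set" where
  "loc_normals = range (\<lambda>i. (- axis i 1, 0)) \<union> range (\<lambda>i. (axis i 1, axis i 1))"

lemma inner_exponent_diff: "exponent_diff s t \<bullet> w = wt w s - wt w t"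
  by (simp add: exponent_diff_def wt_def inner_vec_def case_prod_unfold inner_prod_def
      left_diff_distrib right_diff_distrib sum_subtractf mult.commute)

lemma rational_exponent_diff: "rational_vec (exponent_diff s t)"
  unfolding exponent_diff_def rational_vec_Pair by (auto simp: rational_vec_def Basis_vec_def inner_axis)

lemma rational_axis: "rational_vec (axis i 1 :: real^'n::finite)"
  by (intro Basis_rational_vec) (simp add: axis_in_Basis_iff)

lemma loc_normals: "finite (loc_normals :: 'n::finite weight set)"
  "a \<in> loc_normals \<Longrightarrow> rational_vec (a :: 'n weight)"
  using rational_axis rational_vec_simps(1) rational_vec_simps(2)[OF rational_axis]
  by (auto simp: loc_normals_def rational_vec_Pair)

lemma ineq_cone_loc_normals: "ineq_cone loc_normals = W_loc"
  by (auto simp: ineq_cone_def loc_normals_def W_loc_def inner_axis' ball_Un)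

lemma same_graded_iff:
  assumes "w \<in> W_loc"
  shows "w' \<in> same_graded w \<longleftrightarrow> w' \<in> ineq_cell loc_normals w"
proof -
  obtain u v u' v' where eq: "w = (u, v)" "w' = (u', v')" by (cases w, cases w') blast
  have "M_set w' = M_set w \<longleftrightarrow> (\<forall>i. u' $ i = 0 \<longleftrightarrow> u $ i = 0)"
    "P_set w' = P_set w \<longleftrightarrow> (\<forall>i. u' $ i + v' $ i = 0 \<longleftrightarrow> u $ i + v $ i = 0)" if w': "w' \<in> W_loc"
  proof -
    have "u $ i \<le> 0" "u' $ i \<le> 0" "0 \<le> u $ i + v $ i" "0 \<le> u' $ i + v' $ i" for i
      using assms w' by (auto simp: W_loc_def eq)
    then have "u $ i < 0 \<longleftrightarrow> u $ i \<noteq> 0" "u' $ i < 0 \<longleftrightarrow> u' $ i \<noteq> 0"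
      "0 < u $ i + v $ i \<longleftrightarrow> u $ i + v $ i \<noteq> 0" "0 < u' $ i + v' $ i \<longleftrightarrow> u' $ i + v' $ i \<noteq> 0" for i
      by (metis less_le)+
    then show "M_set w' = M_set w \<longleftrightarrow> (\<forall>i. u' $ i = 0 \<longleftrightarrow> u $ i = 0)"
      "P_set w' = P_set w \<longleftrightarrow> (\<forall>i. u' $ i + v' $ i = 0 \<longleftrightarrow> u $ i + v $ i = 0)"
      by (auto simp: M_set_def P_set_def eq set_eq_iff)
  qed
  moreover have "(\<forall>a\<in>loc_normals. a \<bullet> w' = 0 \<longleftrightarrow> a \<bullet> w = 0) \<longleftrightarrow>
      (\<forall>i. u' $ i = 0 \<longleftrightarrow> u $ i = 0) \<and> (\<forall>i. u' $ i + v' $ i = 0 \<longleftrightarrow> u $ i + v $ i = 0)"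
    unfolding loc_normals_def ball_Un ball_simps by (simp add: eq inner_axis')
  ultimately show ?thesis
    unfolding same_graded_def ineq_cell_def ineq_cone_loc_normals by blast
qed

context hom_ideal
begin

text \<open>
  The cone is cut out by finitely many of its inequalities, but the ties in \<open>same_ties\<close> concern all of them. Within one
  cell of the finite system, the remaining valid inequalities have the same ties by \<open>ineq_cell_zero\<close>.
\<close>

lemma groebner_cones_are_cells:
  assumes R: "admissible R"
  obtains B where "finite B" "\<And>a. a \<in> B \<Longrightarrow> rational_vec a" "ineq_cone B = cone_of R"
    "\<And>w. w \<in> cone_of R \<Longrightarrow> groebner_cone A I w = ineq_cell B w"
proof -
  obtain D where D: "finite D" "\<And>s t. (s, t) \<in> D \<Longrightarrow> t \<in> mins R \<and> reduced R t s \<noteq> 0"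
    "\<And>w. w \<in> W_loc \<Longrightarrow> (\<And>s t. (s, t) \<in> D \<Longrightarrow> wt w t \<le> wt w s) \<Longrightarrow> w \<in> cone_of R"
    by (rule cone_of_finitely_many_inequalities[OF R]) blast
  define E where "E = (\<lambda>(s, t). exponent_diff s t) ` D"
  define B where "B = E \<union> loc_normals"
  have finB: "finite B" using D(1) loc_normals(1) by (simp add: B_def E_def)
  have ratB: "rational_vec a" if "a \<in> B" for a
  proof (cases "a \<in> loc_normals")
    case False
    then obtain s t where "a = exponent_diff s t" using \<open>a \<in> B\<close> by (auto simp: B_def E_def)
    then show ?thesis using rational_exponent_diff by simp
  qed (rule loc_normals(2))
  have coneE: "w \<in> ineq_cone E \<longleftrightarrow> (\<forall>(s, t)\<in>D. wt w t \<le> wt w s)" for w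
    by (auto simp: ineq_cone_def E_def inner_exponent_diff)
  have cone: "ineq_cone B = cone_of R"
  proof
    show "ineq_cone B \<subseteq> cone_of R"
    proof
      fix w assume "w \<in> ineq_cone B"
      then have "w \<in> W_loc" "w \<in> ineq_cone E"
        unfolding B_def ineq_cone_Un ineq_cone_loc_normals by auto
      then show "w \<in> cone_of R" using D(3)[of w] coneE by blast
    qed
    show "cone_of R \<subseteq> ineq_cone B"
      unfolding B_def ineq_cone_Un ineq_cone_loc_normals
    proof (intro subsetI IntI)
      fix w assume w: "w \<in> cone_of R"
      then show "w \<in> W_loc" by (simp add: cone_of_def)
      have "wt w t \<le> wt w s" if "(s, t) \<in> D" for s t
        using D(2)[OF that] w by (simp add: cone_of_def)
      then show "w \<in> ineq_cone E" unfolding coneE by blast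
    qed
  qed
  have zero: "wt w' s = wt w' t"
    if w: "w \<in> ineq_cone B" "w' \<in> ineq_cell B w" and t: "t \<in> mins R" "reduced R t s \<noteq> 0" "wt w s = wt w t"
    for w w' s t
  proof -
    have "exponent_diff s t \<bullet> w' = 0"
    proof (rule ineq_cell_zero[OF finB w])
      show "0 \<le> exponent_diff s t \<bullet> x" if "x \<in> ineq_cone B" for x
        using that t unfolding cone by (simp add: cone_of_def inner_exponent_diff)
    qed (simp add: inner_exponent_diff t)
    then show ?thesis by (simp add: inner_exponent_diff)
  qed
  have cell: "groebner_cone A I w = ineq_cell B w" if w: "w \<in> cone_of R" for w
  proof -
    have W: "w \<in> W_loc" using w by (simp add: cone_of_def)
    have wB: "w \<in> ineq_cone B" using w by (simp add: cone)
    have "w' \<in> groebner_cone A I w \<longleftrightarrow> w' \<in> ineq_cell loc_normals w \<and> w' \<in> cone_of R \<and> same_ties R w w'" for w'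
      using initial_ideal_eq_iff[OF R w, of w'] by (auto simp: groebner_cone_def same_graded_iff[OF W])
    moreover have "w' \<in> ineq_cell loc_normals w \<and> w' \<in> cone_of R \<and> same_ties R w w' \<longleftrightarrow> w' \<in> ineq_cell B w" for w'
    proof (intro iffI conjI; (elim conjE)?)
      assume w': "w' \<in> ineq_cell loc_normals w" "w' \<in> cone_of R" "same_ties R w w'"
      have "wt w' s = wt w' t \<longleftrightarrow> wt w s = wt w t" if "(s, t) \<in> D" for s t
        using D(2)[OF that] w'(3) by (simp add: same_ties_def)
      then have "\<forall>a\<in>E. a \<bullet> w' = 0 \<longleftrightarrow> a \<bullet> w = 0" by (auto simp: E_def inner_exponent_diff)
      then show "w' \<in> ineq_cell B w"
        using w' unfolding ineq_cell_def cone by (simp add: B_def ball_Un)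
    next
      assume w': "w' \<in> ineq_cell B w"
      then have w'B: "w' \<in> ineq_cone B" by (simp add: ineq_cell_def)
      then show "w' \<in> cone_of R" by (simp add: cone)
      show "w' \<in> ineq_cell loc_normals w"
        using w' by (simp add: ineq_cell_def B_def ineq_cone_Un ball_Un)
      show "same_ties R w w'"
        using zero[OF wB w'] zero[OF w'B ineq_cell_sym[OF wB w']] unfolding same_ties_def by blast
    qed
    ultimately show ?thesis by blast
  qed
  show thesis by (rule that[OF finB ratB cone cell])
qed

theorem groebner_fan: "rational_polyhedral_fan (closed_groebner_fan A I)"
proof -
  obtain \<R> where \<R>: "finite \<R>" "\<And>R. R \<in> \<R> \<Longrightarrow> admissible R" "\<And>w. w \<in> W_loc \<Longrightarrow> \<exists>R\<in>\<R>. w \<in> cone_of R"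
    using finitely_many_cones by blast
  have "\<exists>B. finite B \<and> (\<forall>a\<in>B. rational_vec a) \<and> ineq_cone B = cone_of R \<and>
      (\<forall>w\<in>cone_of R. groebner_cone A I w = ineq_cell B w)" if R: "R \<in> \<R>" for R
    by (rule groebner_cones_are_cells[OF \<R>(2)[OF R]]) blast
  then obtain B where B: "\<And>R. R \<in> \<R> \<Longrightarrow> finite (B R) \<and> (\<forall>a\<in>B R. rational_vec a) \<and> ineq_cone (B R) = cone_of R \<and>
      (\<forall>w\<in>cone_of R. groebner_cone A I w = ineq_cell (B R) w)" by metis
  show ?thesis
    unfolding closed_groebner_fan_def
  proof (rule rational_polyhedral_fan_of_cells[where \<A>="B ` \<R>"])
    show "finite (B ` \<R>)" using \<R>(1) by simp
    show "finite X" if "X \<in> B ` \<R>" for X using that B by blast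
    show "rational_vec a" if "X \<in> B ` \<R>" "a \<in> X" for X a using that B by blast
    show "ineq_cone X \<subseteq> W_loc" if "X \<in> B ` \<R>" for X using that B by (auto simp: cone_of_def)
    show "\<exists>X\<in>B ` \<R>. w \<in> ineq_cone X" if "w \<in> W_loc" for w using \<R>(3)[OF that] B by blast
    show "groebner_cone A I w = ineq_cell X w" if "X \<in> B ` \<R>" "w \<in> ineq_cone X" for X w
      using that B by blast
  qed
qed

end

theorem theorem3p0p1:
  fixes I :: "('k::field, 'n::finite) hdo set"
    and J :: "(complex, 'n) hdo set"
  shows "(homogeneous_ideal I hD_formal \<longrightarrow> rational_polyhedral_fan (closed_groebner_fan hD_formal I)) \<and>
         (homogeneous_ideal J hD_conv \<longrightarrow> rational_polyhedral_fan (closed_groebner_fan hD_conv J))"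
proof (intro conjI impI)
  assume "homogeneous_ideal I hD_formal"
  then interpret hom_ideal formal_ops hD_formal I
    by unfold_locales (simp_all add: hD_formal_def)
  show "rational_polyhedral_fan (closed_groebner_fan hD_formal I)" by (rule groebner_fan)
next
  assume "homogeneous_ideal J hD_conv"
  then interpret hom_ideal convergent_ops hD_conv J
    by unfold_locales (simp_all add: hD_conv_def)
  show "rational_polyhedral_fan (closed_groebner_fan hD_conv J)" by (rule groebner_fan)
qed

end
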